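(* Let $\Omega\subset\mathbb{C}$ be a compact convex set with non-empty interior. The following are equivalent: (i) $\Omega$ is a disk; (ii) $c(\Omega)=0$; (iii) $a(\Omega)=0$.
   Context: Let $\Omega\subset\mathbb{C}$ be a compact convex set with non-empty interior. Its boundary $\partial\Omega$ is a rectifiable simple closed curve, oriented counter-clockwise; $s$ denotes arclength measure on $\partial\Omega$. At every $\zeta\in\partial\Omega$ the one-sided tangent angles $\alpha_-(\zeta)\le\alpha_+(\zeta)$ (incoming and outgoing, with branches chosen so that $0\le\alpha_+(\zeta)-\alpha_-(\zeta)<\pi$) exist; $\zeta$ is called a corner if $\alpha_-(\zeta)<\alpha_+(\zeta)$, and there are at most countably many corners. Put $\theta_\zeta:=\pi-\alpha_+(\zeta)+\alpha_-(\zeta)\in(0,\pi]$ (the interior angle at $\zeta$; it equals $\pi$ if $\zeta$ is not a corner). At a non-corner $\sigma$ let $T(\sigma)$ be the unit tangent (in the positive direction) and $N(\sigma)=-iT(\sigma)$ the outward unit normal. For $\zeta\in\partial\Omega$ let $\mu_\zeta$ be the Borel probability measure on $\partial\Omega$ given by $d\mu_\zeta=(1-\theta_\zeta/\pi)\,d\delta_\zeta+\rho_\zeta\,ds$, where $\delta_\zeta$ is the unit point mass at $\zeta$ and $\rho_\zeta(\sigma)=\frac1\pi\operatorname{Re}\Big(\frac{N(\sigma)}{\sigma-\zeta}\Big)$ for non-corners $\sigma\ne\zeta$. Let $C(\partial\Omega)$ be the space of complex-valued continuous functions on $\partial\Omega$. The Neumann–Poincaré operator $K_\Omega:C(\partial\Omega)\to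 C(\partial\Omega)$ is $K_\Omega f(\zeta):=\int_{\partial\Omega}f\,d\mu_\zeta$, $\zeta\in\partial\Omega$; it fixes the constant function $\mathbf{1}$, so it acts on $C(\partial\Omega)/\mathbb{C}\mathbf{1}$, which has the quotient norm $\|g+\mathbb{C}\mathbf{1}\|_{\partial\Omega}=\min_{\lambda\in\mathbb{C}}\max_{\zeta\in\partial\Omega}|g(\zeta)-\lambda|$. The configuration constant $c(\Omega)$ is the operator norm of $K_\Omega$ on $C(\partial\Omega)/\mathbb{C}\mathbf{1}$. Let $\mathcal{A}(\Omega)$ be the space of functions continuous on $\Omega$ and analytic in the interior of $\Omega$, regarded as a subspace of $C(\partial\Omega)$ by restriction to $\partial\Omega$. The analytic configuration constant is the operator norm $a(\Omega):=\|K_\Omega:\mathcal{A}(\Omega)/\mathbb{C}\mathbf{1}\to C(\partial\Omega)/\mathbb{C}\mathbf{1}\|$. *)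

theory Defs
  imports "HOL-Complex_Analysis.Complex_Analysis" "HOL-Probability.Giry_Monad"
begin

definition curve_length :: "(real \<Rightarrow> complex) \<Rightarrow> real \<Rightarrow> real \<Rightarrow> ennreal" where
  "curve_length \<gamma> a b =
     (SUP (n, t) \<in> {(n::nat, t::nat \<Rightarrow> real). mono t \<and> range t \<subseteq> {a..b}}.
        \<Sum>i<n. ennreal (dist (\<gamma> (t i)) (\<gamma> (t (Suc i)))))"

text \<open>\<open>\<gamma>\<close> is an \<open>L\<close>-periodic arclength parametrization of the boundary of \<open>\<Omega>\<close>, injective on one
  period and counter-clockwise (winding number 1 about the interior points). For a compact convex
  set with non-empty interior it exists and is unique up to a shift of the parameter; nothing
  defined below depends on that shift, so the choice operator is harmless.\<close>

definition arclength_param :: "complex set \<Rightarrow> real \<Rightarrow> (real \<Rightarrow> complex) \<Rightarrow> bool" where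
  "arclength_param \<Omega> L \<gamma> \<longleftrightarrow>
     0 < L \<and> continuous_on UNIV \<gamma> \<and> (\<forall>t. \<gamma> (t + L) = \<gamma> t) \<and>
     bij_betw \<gamma> {0..<L} (frontier \<Omega>) \<and>
     (\<forall>z\<in>interior \<Omega>. winding_number (\<lambda>x. \<gamma> (L * x)) z = 1) \<and>
     (\<forall>a b. 0 \<le> a \<and> a \<le> b \<and> b \<le> L \<longrightarrow> curve_length \<gamma> a b = ennreal (b - a))"

definition boundary_param :: "complex set \<Rightarrow> real \<times> (real \<Rightarrow> complex)" where
  "boundary_param \<Omega> = (SOME (L, \<gamma>). arclength_param \<Omega> L \<gamma>)"

definition perimeter :: "complex set \<Rightarrow> real" where
  "perimeter \<Omega> = fst (boundary_param \<Omega>)"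

definition bdy :: "complex set \<Rightarrow> real \<Rightarrow> complex" where
  "bdy \<Omega> = snd (boundary_param \<Omega>)"

definition bdy_time :: "complex set \<Rightarrow> complex \<Rightarrow> real" where
  "bdy_time \<Omega> \<zeta> = the_inv_into {0..<perimeter \<Omega>} (bdy \<Omega>) \<zeta>"

abbreviation boundary_borel :: "complex set \<Rightarrow> complex measure" where
  "boundary_borel \<Omega> \<equiv> restrict_space borel (frontier \<Omega>)"

definition arclength_measure :: "complex set \<Rightarrow> complex measure" where
  "arclength_measure \<Omega> =
     distr (restrict_space lborel {0..<perimeter \<Omega>}) (boundary_borel \<Omega>) (bdy \<Omega>)"

text \<open>The incoming and outgoing unit tangents are the limits of the directions of chords from
  before \<open>\<zeta>\<close> to \<open>\<zeta>\<close>, and from \<open>\<zeta>\<close> to after \<open>\<zeta>\<close>.\<close>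

definition tangent_in :: "complex set \<Rightarrow> complex \<Rightarrow> complex" where
  "tangent_in \<Omega> \<zeta> = Lim (at_left (bdy_time \<Omega> \<zeta>)) (\<lambda>u. sgn (\<zeta> - bdy \<Omega> u))"

definition tangent_out :: "complex set \<Rightarrow> complex \<Rightarrow> complex" where
  "tangent_out \<Omega> \<zeta> = Lim (at_right (bdy_time \<Omega> \<zeta>)) (\<lambda>u. sgn (bdy \<Omega> u - \<zeta>))"

text \<open>The branch of the outgoing angle is tied to that of the incoming one. By convexity and the
  counter-clockwise orientation the increment \<open>Arg (tangent_out / tangent_in)\<close> lies in \<open>[0, \<pi>)\<close>.\<close>

definition angle_in :: "complex set \<Rightarrow> complex \<Rightarrow> real" where
  "angle_in \<Omega> \<zeta> = Arg (tangent_in \<Omega> \<zeta>)"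

definition angle_out :: "complex set \<Rightarrow> complex \<Rightarrow> real" where
  "angle_out \<Omega> \<zeta> = angle_in \<Omega> \<zeta> + Arg (tangent_out \<Omega> \<zeta> / tangent_in \<Omega> \<zeta>)"

lemma cis_angles:
  assumes "norm (tangent_in \<Omega> \<zeta>) = 1" "norm (tangent_out \<Omega> \<zeta>) = 1"
  shows "cis (angle_in \<Omega> \<zeta>) = tangent_in \<Omega> \<zeta>" "cis (angle_out \<Omega> \<zeta>) = tangent_out \<Omega> \<zeta>"
proof -
  have nz: "tangent_in \<Omega> \<zeta> \<noteq> 0" "tangent_out \<Omega> \<zeta> \<noteq> 0"
    using assms by auto
  show *: "cis (angle_in \<Omega> \<zeta>) = tangent_in \<Omega> \<zeta>"
    using assms nz by (simp add: angle_in_def cis_Arg sgn_div_norm)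
  have "cis (angle_out \<Omega> \<zeta>) =
      cis (angle_in \<Omega> \<zeta>) * cis (Arg (tangent_out \<Omega> \<zeta> / tangent_in \<Omega> \<zeta>))"
    by (simp add: angle_out_def cis_mult)
  also have "\<dots> = tangent_out \<Omega> \<zeta>"
    using assms nz * by (simp add: cis_Arg sgn_div_norm norm_divide)
  finally show "cis (angle_out \<Omega> \<zeta>) = tangent_out \<Omega> \<zeta>" .
qed

definition corner :: "complex set \<Rightarrow> complex \<Rightarrow> bool" where
  "corner \<Omega> \<zeta> \<longleftrightarrow> angle_in \<Omega> \<zeta> < angle_out \<Omega> \<zeta>"

definition interior_angle :: "complex set \<Rightarrow> complex \<Rightarrow> real" where
  "interior_angle \<Omega> \<zeta> = pi - angle_out \<Omega> \<zeta> + angle_in \<Omega> \<zeta>"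

text \<open>Used at non-corners only, where the two one-sided tangents agree.\<close>

definition outward_normal :: "complex set \<Rightarrow> complex \<Rightarrow> complex" where
  "outward_normal \<Omega> \<sigma> = - \<i> * tangent_out \<Omega> \<sigma>"

text \<open>The value 0 at \<open>\<zeta>\<close> and at the corners is immaterial: these points form a countable set,
  which is null for arclength.\<close>

definition np_density :: "complex set \<Rightarrow> complex \<Rightarrow> complex \<Rightarrow> real" where
  "np_density \<Omega> \<zeta> \<sigma> =
     (if \<sigma> \<noteq> \<zeta> \<and> \<not> corner \<Omega> \<sigma> then 1 / pi * Re (outward_normal \<Omega> \<sigma> / (\<sigma> - \<zeta>)) else 0)"

definition add_measure :: "'a measure \<Rightarrow> 'a measure \<Rightarrow> 'a measure" where
  "add_measure M N = measure_of (space M) (sets M) (\<lambda>A. emeasure M A + emeasure N A)"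

lemma space_add_measure [simp]: "space (add_measure M N) = space M"
  and sets_add_measure [simp]: "sets (add_measure M N) = sets M"
  by (simp_all add: add_measure_def)

lemma emeasure_add_measure:
  assumes "sets N = sets M" "A \<in> sets M"
  shows "emeasure (add_measure M N) A = emeasure M A + emeasure N A"
proof (rule emeasure_measure_of[OF add_measure_def])
  show "sets M \<subseteq> Pow (space M)" by (rule sets.space_closed)
  show "positive (sets (add_measure M N)) (\<lambda>A. emeasure M A + emeasure N A)"
    by (simp add: positive_def)
  show "countably_additive (sets (add_measure M N)) (\<lambda>A. emeasure M A + emeasure N A)"
  proof (rule countably_additiveI)
    fix F :: "nat \<Rightarrow> 'a set"
    assume F: "range F \<subseteq> sets (add_measure M N)" "disjoint_family F"
    then have "range F \<subseteq> sets M" "range F \<subseteq> sets N" by (simp_all add: assms(1))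
    with F(2) show "(\<Sum>i. emeasure M (F i) + emeasure N (F i)) =
        emeasure M (\<Union>i. F i) + emeasure N (\<Union>i. F i)"
      by (simp add: suminf_add [symmetric] suminf_emeasure)
  qed
  show "A \<in> sets (add_measure M N)" using assms by simp
qed

definition np_measure :: "complex set \<Rightarrow> complex \<Rightarrow> complex measure" where
  "np_measure \<Omega> \<zeta> =
     add_measure
       (scale_measure (ennreal (1 - interior_angle \<Omega> \<zeta> / pi)) (return (boundary_borel \<Omega>) \<zeta>))
       (density (arclength_measure \<Omega>) (\<lambda>\<sigma>. ennreal (np_density \<Omega> \<zeta> \<sigma>)))"

definition neumann_poincare :: "complex set \<Rightarrow> (complex \<Rightarrow> complex) \<Rightarrow> complex \<Rightarrow> complex" where
  "neumann_poincare \<Omega> f \<zeta> = (LINT \<sigma>|np_measure \<Omega> \<zeta>. f \<sigma>)"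

text \<open>Function spaces on the boundary are represented by sets of functions on the plane of which
  only the values on \<open>frontier \<Omega>\<close> are used, and cosets modulo constants by their members.\<close>

definition quotient_norm :: "complex set \<Rightarrow> (complex \<Rightarrow> complex) \<Rightarrow> real" where
  "quotient_norm \<Omega> g = (INF c::complex. SUP \<zeta>\<in>frontier \<Omega>. norm (g \<zeta> - c))"

definition boundary_continuous :: "complex set \<Rightarrow> (complex \<Rightarrow> complex) set" where
  "boundary_continuous \<Omega> = {f. continuous_on (frontier \<Omega>) f}"

definition analytic_algebra :: "complex set \<Rightarrow> (complex \<Rightarrow> complex) set" where
  "analytic_algebra \<Omega> = {f. continuous_on \<Omega> f \<and> f holomorphic_on interior \<Omega>}"

definition np_quotient_opnorm :: "complex set \<Rightarrow> (complex \<Rightarrow> complex) set \<Rightarrow> real" where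
  "np_quotient_opnorm \<Omega> S =
     (SUP f \<in> {f \<in> S. quotient_norm \<Omega> f \<le> 1}. quotient_norm \<Omega> (neumann_poincare \<Omega> f))"

definition configuration_constant :: "complex set \<Rightarrow> real" where
  "configuration_constant \<Omega> = np_quotient_opnorm \<Omega> (boundary_continuous \<Omega>)"

definition analytic_configuration_constant :: "complex set \<Rightarrow> real" where
  "analytic_configuration_constant \<Omega> = np_quotient_opnorm \<Omega> (analytic_algebra \<Omega>)"

end

theory Submission
  imports Defs
begin

text \<open>
  Only the function \<open>f(z) = z\<close> is needed to recognise a disk. Multiplying the kernel of \<open>K\<close> by
  \<open>\<sigma> - \<zeta>\<close> shows that \<open>K f(\<zeta>) - \<zeta>\<close> is the complex conjugate of
  \<open>G(\<zeta>) = 1/(2 \<pi> \<i>) \<integral> cnj (\<sigma> - \<zeta>) / (\<sigma> - \<zeta>)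
    d\<sigma>\<close> for boundary points \<open>\<zeta>\<close>. The integrand is
  bounded, so \<open>G\<close> is continuous on the plane, and outside \<open>\<Omega>\<close> it equals
    the Cauchy integral of
  \<open>cnj \<sigma>\<close>, which is holomorphic there. If \<open>K f\<close> is a constant \<open>k\<close>, then
  \<open>H(z) = (z - k) G(z)\<close> equals \<open>- |z - k|\<^sup>2\<close> on the boundary and has a
    real limit at infinity. By
  the maximum principle \<open>H\<close> is constant in the exterior, so \<open>|z - k|\<close> is
    constant on the boundary.

  An arclength parametrization of a convex curve has unit one-sided derivatives everywhere, equal
  off a countable set. This suffices for the fundamental theorem of calculus, so
    \<open>\<mu>\<^sub>\<zeta>\<close> has total
  mass one: its absolutely continuous part measures the variation of \<open>arg (\<sigma> - \<zeta>)\<close>.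
\<close>

section \<open>Cross products in the plane\<close>

text \<open>The definitions presuppose geometry that has to be supplied first: the parametrization
  is a choice and the tangents are \<open>Lim\<close> terms, so both must be shown to exist from
  convexity before the kernel means anything. Most orientation arguments are signs of
  \<open>cross\<close>, which avoids branches of angles. The limit of \<open>H\<close> at infinity
  is real because the real part of the integral of \<open>cnj \<sigma>\<close> along the boundary is
  half the increment of the squared norm, which is 0 on a closed curve; what remains is imaginary
  and is divided by \<open>2 * pi * \<i>\<close>. Total mass one is used twice: it isolates
  \<open>\<zeta>\<close> in the value of the operator on the identity, and it makes the operator
  contract distances to constants, so that the real suprema in the operator norm are bounded. For
  the converse, the kernel of a circle is constant, so the operator sends every function to its
  mean. Both equivalences are instances of one statement about a set of continuous functions that
  contains all multiples of the identity.\<close>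

definition cross :: "complex \<Rightarrow> complex \<Rightarrow> real" where
  "cross a b = Im (cnj a * b)"

lemma cross_expand: "cross a b = Re a * Im b - Im a * Re b"
  by (simp add: cross_def)

text \<open>\<open>y\<close> and \<open>z\<close> merge into one point of the convex set, and a
  positive share of an interior point pulls any point of the set into the interior.\<close>

lemma interior_weights:
  fixes p y z :: complex
  assumes "convex S" "p \<in> interior S" "y \<in> S" "z \<in> S" "a > 0" "b \<ge> 0" "c \<ge> 0" "a + b + c = 1"
  shows "a *\<^sub>R p + b *\<^sub>R y + c *\<^sub>R z \<in> interior S"
proof (cases "a = 1")
  case True
  moreover have "b = 0" "c = 0" using assms True by linarith+
  ultimately show ?thesis using assms by simp
next
  case False
  then have bc: "b + c > 0" "a = 1 - (b + c)" using assms by auto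
  define w where "w = (b / (b + c)) *\<^sub>R y + (c / (b + c)) *\<^sub>R z"
  have "w \<in> S" unfolding w_def using bc assms
    by (intro convexD) (auto simp: add_divide_distrib[symmetric])
  then have int: "w - a *\<^sub>R (w - p) \<in> interior S"
    using assms bc by (intro mem_interior_convex_shrink) auto
  have "(b + c) *\<^sub>R w = b *\<^sub>R y + c *\<^sub>R z"
    using bc by (simp add: w_def scaleR_add_right)
  moreover have "w = (a + (b + c)) *\<^sub>R w" using assms by (simp add: add.assoc)
  ultimately have "w - a *\<^sub>R (w - p) = a *\<^sub>R p + b *\<^sub>R y + c *\<^sub>R z"
    unfolding scaleR_add_left scaleR_diff_right by (simp add: algebra_simps)
  then show ?thesis using int by simp
qed

text \<open>For three points in counter-clockwise order within a half turn around an interior point,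
  a clockwise triangle would put the middle point into the interior.\<close>

lemma cross_chords_nonneg:
  assumes "convex S" "p \<in> interior S" "a \<in> S" "c \<in> S" "b \<notin> interior S"
    and ab: "cross (a - p) (b - p) > 0" and bc: "cross (b - p) (c - p) > 0"
    and ac: "cross (a - p) (c - p) > 0"
  shows "cross (b - a) (c - b) \<ge> 0"
proof (rule ccontr)
  assume neg: "\<not> ?thesis"
  define k where "k = cross (a - p) (c - p)"
  define u where "u = cross (b - p) (c - p) / k"
  define v where "v = cross (a - p) (b - p) / k"
  have k: "k > 0" using ac by (simp add: k_def)
  have uv: "u > 0" "v > 0" using k assms by (simp_all add: u_def v_def)
  \<comment> \<open>Cramer's rule: \<open>b - p\<close> in the basis \<open>a - p\<close>,
    \<open>c - p\<close>.\<close>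
  have kb: "k *\<^sub>R (b - p) = cross (b - p) (c - p) *\<^sub>R (a - p) + cross (a - p) (b - p) *\<^sub>R (c - p)"
    by (simp add: k_def cross_expand complex_eq_iff algebra_simps)
  have "b - p = (1/k) *\<^sub>R (k *\<^sub>R (b - p))" using k by simp
  also have "\<dots> = u *\<^sub>R (a - p) + v *\<^sub>R (c - p)"
    unfolding kb by (simp add: u_def v_def scaleR_add_right)
  finally have b: "b = (1 - u - v) *\<^sub>R p + u *\<^sub>R a + v *\<^sub>R c"
    by (simp add: algebra_simps)
  \<comment> \<open>The cross product of the two edges is \<open>k * (u + v - 1)\<close>, so a
    clockwise turn leaves the positive weight \<open>1 - u - v\<close> for \<open>p\<close>.\<close>
  have "cross (b - p) (c - p) + cross (a - p) (b - p) - k < 0"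
    using neg by (simp add: k_def cross_expand algebra_simps)
  then have "u + v < 1" using k by (simp add: u_def v_def field_simps)
  then have "b \<in> interior S"
    unfolding b using assms uv by (intro interior_weights) auto
  then show False using assms by simp
qed

lemma cross_scaleR: "cross (r *\<^sub>R a) b = r * cross a b" "cross a (r *\<^sub>R b) = r * cross a b"
  by (simp_all add: cross_expand algebra_simps)

lemma cross_add: "cross (a + b) c = cross a c + cross b c" "cross a (b + c) = cross a b + cross a c"
  by (simp_all add: cross_expand algebra_simps)

lemma cross_diff: "cross (a - b) c = cross a c - cross b c" "cross a (b - c) = cross a b - cross a c"
  by (simp_all add: cross_expand algebra_simps)

lemma tendsto_cross [tendsto_intros]:
  "(f \<longlongrightarrow> a) F \<Longrightarrow> (g \<longlongrightarrow> b) F \<Longrightarrow>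
    ((\<lambda>x. cross (f x) (g x)) \<longlongrightarrow> cross a b) F"
  unfolding cross_def by (intro tendsto_intros)

text \<open>Up to the factor \<open>(norm q)\<^sup>2\<close>, \<open>cross u q\<close> and
  \<open>inner u q\<close> are the coordinates of \<open>u\<close> along \<open>- \<i> * q\<close>
  and \<open>q\<close>. Factoring out the first leaves a slope, the quantity that is monotone along
  a convex arc.\<close>

lemma frame_decomp:
  assumes "q \<noteq> 0"
  shows "u = cross u q *\<^sub>R (q * (of_real (inner u q / cross u q) - \<i>)) / of_real ((norm q)\<^sup>2)
     \<or> cross u q = 0"
proof (cases "cross u q = 0")
  case False
  have "(norm q)\<^sup>2 \<noteq> 0" using assms by simp
  have "cross u q *\<^sub>R (q * (of_real (inner u q / cross u q) - \<i>))
     = q * (of_real (inner u q) - of_real (cross u q) * \<i>)"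
    using False by (simp add: scaleR_conv_of_real algebra_simps)
  also have "\<dots> = of_real ((norm q)\<^sup>2) * u"
    unfolding cross_expand inner_complex_def cmod_power2
    by (simp add: complex_eq_iff algebra_simps power2_eq_square)
  finally show ?thesis using assms by simp
qed simp

section \<open>One-sided tangents of a convex curve\<close>

lemma norm_frame: "(norm q)\<^sup>2 * (norm u)\<^sup>2 = (cross u q)\<^sup>2 + (inner u q)\<^sup>2"
  unfolding cross_expand inner_complex_def cmod_power2
  by (simp add: algebra_simps power2_eq_square)

lemma cross_frame: "(norm q)\<^sup>2 * cross u v = cross u q * inner v q - inner u q * cross v q"
  unfolding cross_expand inner_complex_def cmod_power2
  by (simp add: algebra_simps power2_eq_square)

lemma parallel_if_cross_0:
  assumes "cross e w = 0" "w \<noteq> 0"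
  obtains k where "e = k *\<^sub>R w"
proof
  have "(norm w)\<^sup>2 *\<^sub>R e = inner e w *\<^sub>R w + (cross e w) *\<^sub>R (- \<i> * w)"
    unfolding cross_expand inner_complex_def cmod_power2
    by (simp add: complex_eq_iff algebra_simps power2_eq_square)
  then have "(1 / (norm w)\<^sup>2) *\<^sub>R (norm w)\<^sup>2 *\<^sub>R e = (1 / (norm w)\<^sup>2)
    *\<^sub>R inner e w *\<^sub>R w"
    using assms by simp
  then show "e = (inner e w / (norm w)\<^sup>2) *\<^sub>R w" using assms by simp
qed

lemma cross_cycle: "cross u v *\<^sub>R q + cross v q *\<^sub>R u + cross q u *\<^sub>R v = 0"
  by (simp add: cross_expand complex_eq_iff algebra_simps)

lemma cross_minus: "cross (-a) b = - cross a b" "cross a (-b) = - cross a b"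
  by (simp_all add: cross_expand)

lemma cross_self: "cross a a = 0" by (simp add: cross_expand)

lemma cross_commute: "cross b a = - cross a b" by (simp add: cross_expand)

text \<open>\<open>\<gamma>\<close> runs counter-clockwise along the boundary of \<open>\<Omega>\<close>,
  turning by less than \<open>\<pi>\<close>
  around \<open>p\<close> during the time \<open>]a, b[\<close>. The premise \<open>arc_le\<close> bounds
    the length of an arc by the total
  increment of any function that dominates the chords.\<close>

locale local_boundary =
  fixes \<Omega> :: "complex set" and p :: complex and \<gamma> :: "real \<Rightarrow> complex" and a t0 b :: real
  assumes conv: "convex \<Omega>" and p: "p \<in> interior \<Omega>"
    and less: "a < t0" "t0 < b"
    and in_S: "\<And>t. a < t \<Longrightarrow> t < b \<Longrightarrow> \<gamma> t \<in> \<Omega>"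
    and not_int: "\<And>t. a < t \<Longrightarrow> t < b \<Longrightarrow> \<gamma> t \<notin> interior \<Omega>"
    and cont: "continuous_on {a<..<b} \<gamma>"
    and turn: "\<And>s t. a < s \<Longrightarrow> s < t \<Longrightarrow> t < b \<Longrightarrow> cross
      (\<gamma> s - p) (\<gamma> t - p) > 0"
    and chord_le: "\<And>t. t0 \<le> t \<Longrightarrow> t < b \<Longrightarrow> dist (\<gamma> t0)
      (\<gamma> t) \<le> t - t0"
    and arc_le: "\<And>X t. t0 \<le> t \<Longrightarrow> t < b \<Longrightarrow>
       (\<And>s u. t0 \<le> s \<Longrightarrow> s \<le> u \<Longrightarrow> u \<le> t \<Longrightarrow>
         dist (\<gamma> s) (\<gamma> u) \<le> X u - X s) \<Longrightarrow> t - t0 \<le> X t - X t0"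
begin

text \<open>Near \<open>\<gamma> t0\<close> the curve is a convex graph over the direction
  \<open>- \<i> * q\<close>, with heights measured towards \<open>p\<close>. Up to the factor
  \<open>norm q\<close>, \<open>x\<close> is the abscissa and \<open>inner (u t) q\<close> the
  height, so \<open>m\<close> is the slope of the chord from \<open>\<gamma> t0\<close>.\<close>

definition "q = p - \<gamma> t0"
definition "u t = \<gamma> t - \<gamma> t0"
definition "x t = cross (u t) q"
definition "m t = inner (u t) q / x t"

lemma cross_u_q: "x t = cross (\<gamma> t0 - p) (\<gamma> t - p)"
  by (simp add: x_def u_def q_def cross_expand algebra_simps)

lemma x_pos: "t0 < t \<Longrightarrow> t < b \<Longrightarrow> 0 < x t"
  unfolding cross_u_q using turn less by simp

lemma x_neg: assumes "a < t" "t < t0" shows "x t < 0"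
  using turn[of t t0] less assms unfolding cross_u_q cross_commute[of "\<gamma> t0 - p"] by simp

lemma chords: "a < s \<Longrightarrow> s < t \<Longrightarrow> t < r \<Longrightarrow> r < b
  \<Longrightarrow> cross (\<gamma> t - \<gamma> s) (\<gamma> r - \<gamma> t) \<ge> 0"
  using conv p by (rule cross_chords_nonneg) (auto intro: in_S turn simp: not_int)

lemma q_nz: "q \<noteq> 0"
  using less not_int[of t0] p unfolding q_def by auto

lemma nq: "norm q > 0" using q_nz by simp

lemma tendsto_u: "(u \<longlongrightarrow> 0) (at_right t0)"
proof -
  have "isCont \<gamma> t0"
    using cont less by (simp add: continuous_on_eq_continuous_at)
  then have "(\<gamma> \<longlongrightarrow> \<gamma> t0) (at_right t0)"
    using isCont_def filterlim_at_split by blast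
  then show ?thesis unfolding u_def by (simp add: LIM_zero)
qed

lemma ev_right: "c > t0 \<Longrightarrow> eventually (\<lambda>t. t0 < t \<and> t < c) (at_right t0)"
  using eventually_at_right by auto

text \<open>A left turn at \<open>\<gamma> s\<close> on the way from \<open>\<gamma> t0\<close> to
  \<open>\<gamma> t\<close> means, through \<open>cross_frame\<close>, that chord slopes
  increase.\<close>

lemma m_mono: assumes "t0 < s" "s \<le> t" "t < b" shows "m s \<le> m t"
proof (cases "s = t")
  case False
  have "cross (u s) (u t) \<ge> 0"
    using chords[of t0 s t] assms less False unfolding u_def cross_expand by (simp add: algebra_simps)
  then have "0 \<le> (norm q)\<^sup>2 * cross (u s) (u t)" by simp
  then have "inner (u s) q * x t \<le> x s * inner (u t) q"
    by (simp add: cross_frame x_def)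
  then show ?thesis using x_pos[of s] x_pos[of t] assms
    unfolding m_def by (simp add: field_simps)
qed simp

text \<open>A chord to an earlier point has a smaller slope; the midpoint of \<open>a\<close> and
  \<open>t0\<close> provides such a point.\<close>

lemma m_bound: obtains K where "\<And>t. t0 < t \<Longrightarrow> t < b \<Longrightarrow> K \<le> m t"
proof
  fix t assume t: "t0 < t" "t < b"
  define s where "s = (a + t0) / 2"
  have s: "a < s" "s < t0" using less by (auto simp: s_def)
  have "cross (- u s) (u t) \<ge> 0"
    using chords[of s t0 t] s t unfolding u_def by simp
  then have "0 \<le> (norm q)\<^sup>2 * cross (- u s) (u t)" by simp
  then have "0 \<le> - x s * inner (u t) q + inner (u s) q * x t"
    by (simp add: cross_frame x_def cross_minus)
  then show "inner (u ((a + t0) / 2)) q / x ((a + t0) / 2) \<le> m t"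
    using x_pos[OF t] x_neg[OF s]
    unfolding m_def s_def[symmetric] by (simp add: field_simps)
qed

text \<open>Monotone slopes converge to their infimum, so this is the slope of the right
  tangent.\<close>

definition "m0 = Inf (m ` ({t0<..} \<inter> {..<b}))"

lemma tendsto_m: "(m \<longlongrightarrow> m0) (at_right t0)"
proof -
  obtain K where "\<And>t. t0 < t \<Longrightarrow> t < b \<Longrightarrow> K \<le> m t" using m_bound by blast
  then have "(m \<longlongrightarrow> m0) (at t0 within ({t0<..} \<inter> {..<b}))"
    unfolding m0_def by (intro Lim_right_bound[where K = K]) (auto intro: m_mono)
  moreover have "at t0 within ({t0<..} \<inter> {..<b}) = at t0 within {t0<..}"
    by (rule at_within_nhd[of _ "{..<b}"]) (use less in auto)
  ultimately show ?thesis by simp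
qed

lemma m0_le: assumes "t0 < t" "t < b" shows "m0 \<le> m t"
proof -
  obtain K where "\<And>t. t0 < t \<Longrightarrow> t < b \<Longrightarrow> K \<le> m t" using m_bound by blast
  then show ?thesis unfolding m0_def using assms
    by (intro cInf_lower bdd_belowI2[where m = K]) auto
qed

text \<open>Forward motion is known relative to the direction from \<open>\<gamma> s\<close> to
  \<open>p\<close>; here it is compared with the fixed frame at \<open>\<gamma> t0\<close>. If a
  short chord moved backward in that frame, its line would pass through a point close to
  \<open>p\<close>, hence interior and far away compared with the chord; then one end of the chord
  would lie between the other and an interior point.\<close>

lemma near_chord:
  obtains c where "t0 < c" "c \<le> b" "\<And>s t. t0 < s \<Longrightarrow> s < t \<Longrightarrow> t < c
    \<Longrightarrow> cross (\<gamma> t - \<gamma> s) q > 0"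
proof -
  obtain d where d: "d > 0" "ball p d \<subseteq> \<Omega>" using p mem_interior by blast
  then have d_int: "ball p d \<subseteq> interior \<Omega>" by (simp add: interior_maximal)
  \<comment> \<open>With \<open>d / 4\<close>, chords are shorter than \<open>d / 2\<close>, whereas
    the interior point found below has distance more than \<open>d / 2\<close> from
    \<open>\<gamma> s\<close>.\<close>
  have "0 < d / 4" using d by simp
  then have "eventually (\<lambda>t. dist (u t) 0 < d / 4) (at_right t0)"
    using tendsto_u tendstoD by blast
  then have "eventually (\<lambda>t. norm (u t) < d / 4) (at_right t0)"
    by (simp only: dist_norm diff_0_right)
  then obtain c where c: "c > t0" "\<And>t. t0 < t \<Longrightarrow> t < c \<Longrightarrow> norm (u t) < d / 4"
    unfolding eventually_at_right[OF less(2)] by auto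
  show ?thesis
  proof (rule that[of "min b c"])
    show "t0 < min b c" "min b c \<le> b" using c less by auto
    fix s t assume st: "t0 < s" "s < t" "t < min b c"
    define e where "e = \<gamma> t - \<gamma> s"
    have us: "norm (u s) < d / 4" and "norm (u t) < d / 4" using c st by auto
    then have ne: "norm e < d / 2"
      unfolding e_def u_def using norm_triangle_ineq4[of "\<gamma> t - \<gamma> t0" "\<gamma> s - \<gamma> t0"] by simp
    show "cross (\<gamma> t - \<gamma> s) q > 0"
    proof (rule ccontr)
      assume "\<not> ?thesis"
      then have neg: "cross e q \<le> 0" by (simp add: e_def)
      have pos: "cross e (p - \<gamma> s) > 0"
        using turn[of s t] st less unfolding e_def by (simp add: cross_expand algebra_simps)
      \<comment> \<open>\<open>cross e\<close> is affine along the segment from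
        \<open>p - \<gamma> s\<close> to \<open>q\<close>, positive at the start and nonpositive at
        the end; \<open>\<mu>\<close> is its zero and \<open>w\<close> the vector found
        there.\<close>
      define \<mu> where "\<mu> = cross e (p - \<gamma> s) / (cross e (p - \<gamma> s) - cross e q)"
      have \<mu>: "0 \<le> \<mu>" "\<mu> \<le> 1" using neg pos by (auto simp: \<mu>_def field_simps)
      define w where "w = p + \<mu> *\<^sub>R u s - \<gamma> s"
      have "cross e w = cross e (p - \<gamma> s) - \<mu> * (cross e (p - \<gamma> s) - cross e q)"
        unfolding w_def u_def q_def by (simp add: cross_expand algebra_simps)
      also have "\<dots> = 0" using neg pos by (simp add: \<mu>_def)
      finally have w0: "cross e w = 0" .
      have nu: "norm (\<mu> *\<^sub>R u s) < d / 4"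
        using us \<mu> mult_left_le_one_le[of "norm (u s)" \<mu>] by simp
      have "p + \<mu> *\<^sub>R u s \<in> ball p d" using nu d by (simp add: dist_norm)
      then have pint: "p + \<mu> *\<^sub>R u s \<in> interior \<Omega>" using d_int by auto
      have "\<gamma> s \<notin> ball p d" using not_int[of s] st less d_int by auto
      then have "norm (p - \<gamma> s) \<ge> d" by (simp add: dist_norm)
      moreover have "norm (p - \<gamma> s) \<le> norm w + norm (\<mu> *\<^sub>R u s)"
        unfolding w_def using norm_triangle_ineq4[of "p + \<mu> *\<^sub>R u s - \<gamma> s" "\<mu>
          *\<^sub>R u s"] by simp
      ultimately have wd: "norm w > d / 2" using nu d(1) by linarith
      then have "w \<noteq> 0" using d by auto
      with w0 obtain k where k: "e = k *\<^sub>R w" by (rule parallel_if_cross_0)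
      have pw: "p + \<mu> *\<^sub>R u s = \<gamma> s + w" by (simp add: w_def)
      note int_w = pint[unfolded pw]
      have "a < s" "s < b" "a < t" "t < b" using st less by auto
      then have sS: "\<gamma> s \<in> \<Omega>" "\<gamma> s \<notin> interior \<Omega>" "\<gamma> t \<in>
        \<Omega>" "\<gamma> t \<notin> interior \<Omega>"
        using in_S[of s] in_S[of t] not_int[of s] not_int[of t] by blast+
      have gt: "\<gamma> t = \<gamma> s + k *\<^sub>R w" using k by (simp add: e_def algebra_simps)
      \<comment> \<open>\<open>k\<close> is the position of \<open>\<gamma> t\<close> on the line
        from \<open>\<gamma> s\<close> (at 0) through the interior point (at 1).\<close>
      consider "k > 1" | "0 < k" "k \<le> 1" | "k = 0" | "k < 0" by linarith
      then show False
      proof cases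
        case 1
        have "1 * norm w \<le> k * norm w" using 1 by (intro mult_right_mono) auto
        also have "\<dots> = norm e" unfolding k norm_scaleR using 1 by simp
        finally have "norm w \<le> norm e" by simp
        then show False using ne wd by simp
      next
        case 2
        have "\<gamma> s - k *\<^sub>R (\<gamma> s - (\<gamma> s + w)) \<in> interior \<Omega>"
          by (rule mem_interior_convex_shrink[OF conv int_w sS(1) 2])
        then show False using gt sS by simp
      next
        case 3
        then have "e = 0" using k by simp
        then show False using pos by (simp add: cross_expand)
      next
        case 4
        \<comment> \<open>With this share, moving from \<open>\<gamma> t\<close> towards the
          interior point stops at \<open>\<gamma> s\<close>.\<close>
        define l where "l = - k / (1 - k)"
        have l: "0 < l" "l \<le> 1" using 4 by (simp_all add: l_def divide_simps)
        have "\<gamma> t - l *\<^sub>R (\<gamma> t - (\<gamma> s + w)) \<in> interior \<Omega>"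
          by (rule mem_interior_convex_shrink[OF conv int_w sS(3) l])
        moreover have "\<gamma> t - l *\<^sub>R (\<gamma> t - (\<gamma> s + w)) = \<gamma> s + (k - l *
          (k - 1)) *\<^sub>R w"
          unfolding gt by (simp add: complex_eq_iff algebra_simps)
        moreover have "k - l * (k - 1) = 0" using 4 by (simp add: l_def divide_simps) (simp add: algebra_simps)?
        ultimately show False using sS by simp
      qed
    qed
  qed
qed

text \<open>By convexity the slope of a chord is at least \<open>m s\<close>, the slope from
  \<open>\<gamma> t0\<close> to its start, and at most the slope of the next chord, which ends at a
  fixed \<open>\<gamma> t1\<close>. The former is at least \<open>m0\<close>; the latter tends to
  \<open>m t1\<close>, which is chosen below \<open>m0 + \<epsilon>\<close>.\<close>

lemma chord_slope:
  assumes "\<epsilon> > 0"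
  obtains c where "t0 < c" "c \<le> b"
    "\<And>s t. t0 \<le> s \<Longrightarrow> s < t \<Longrightarrow> t < c \<Longrightarrow> cross
      (\<gamma> t - \<gamma> s) q > 0 \<and>
      m0 * cross (\<gamma> t - \<gamma> s) q \<le> inner (\<gamma> t - \<gamma> s) q \<and>
      inner (\<gamma> t - \<gamma> s) q \<le> (m0 + \<epsilon>) * cross (\<gamma> t - \<gamma> s) q"
proof -
  obtain c1 where c1: "t0 < c1" "c1 \<le> b"
    and pos: "\<And>s t. t0 < s \<Longrightarrow> s < t \<Longrightarrow> t < c1 \<Longrightarrow> cross
      (\<gamma> t - \<gamma> s) q > 0"
    using near_chord by blast
  have "eventually (\<lambda>t. m t < m0 + \<epsilon> \<and> t0 < t \<and> t < c1) (at_right t0)"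
    using order_tendstoD(2)[OF tendsto_m, of "m0 + \<epsilon>"] assms ev_right[OF c1(1)]
    by (auto elim: eventually_elim2)
  then obtain t1 where t1: "m t1 < m0 + \<epsilon>" "t0 < t1" "t1 < c1"
    by (auto dest: eventually_happens)
  have "((\<lambda>t. inner (u t1 - u t) q - (m0 + \<epsilon>) * cross (u t1 - u t) q) \<longlongrightarrow>
      inner (u t1 - 0) q - (m0 + \<epsilon>) * cross (u t1 - 0) q) (at_right t0)"
    by (intro tendsto_intros tendsto_u)
  moreover have "inner (u t1 - 0) q - (m0 + \<epsilon>) * cross (u t1 - 0) q < 0"
    using t1 x_pos[of t1] c1 unfolding m_def x_def by (simp add: field_simps)
  ultimately have "eventually (\<lambda>t. inner (u t1 - u t) q - (m0 + \<epsilon>) * cross (u t1 - u t)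
    q < 0) (at_right t0)"
    by (rule order_tendstoD(2))
  then obtain c2 where c2: "c2 > t0"
    "\<And>t. t0 < t \<Longrightarrow> t < c2 \<Longrightarrow> inner (u t1 - u t) q - (m0 + \<epsilon>)
      * cross (u t1 - u t) q < 0"
    unfolding eventually_at_right[OF less(2)] by auto
  show ?thesis
  proof (rule that[of "min t1 c2"])
    show "t0 < min t1 c2" "min t1 c2 \<le> b" using t1 c2 c1 by auto
    fix s t assume st: "t0 \<le> s" "s < t" "t < min t1 c2"
    define e where "e = \<gamma> t - \<gamma> s"
    define f where "f = \<gamma> t1 - \<gamma> t"
    have xe: "cross e q > 0"
    proof (cases "s = t0")
      case True
      then show ?thesis using x_pos[of t] st t1 c1 by (simp add: e_def x_def u_def)
    qed (use st pos[of s t] t1 in \<open>auto simp: e_def\<close>)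
    have xf: "cross f q > 0" using pos[of t t1] st t1 by (auto simp: f_def)
    have lower: "m0 * cross e q \<le> inner e q"
    proof (cases "s = t0")
      case True
      then show ?thesis using m0_le[of t] x_pos[of t] st t1 c1
        by (simp add: e_def m_def x_def u_def field_simps)
    next
      case False
      have s: "t0 < s" "s < b" using False st t1 c1 by auto
      have "0 \<le> (norm q)\<^sup>2 * cross (u s) e"
        using chords[of t0 s t] st t1 c1 False less by (simp add: e_def u_def)
      then have "inner (u s) q * cross e q \<le> x s * inner e q" by (simp add: cross_frame x_def)
      then have "m s * cross e q \<le> inner e q"
        using x_pos[OF s] by (simp add: m_def field_simps)
      moreover have "m0 * cross e q \<le> m s * cross e q"
        using m0_le[OF s] xe by (intro mult_right_mono) auto
      ultimately show ?thesis by simp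
    qed
    have fle: "inner f q \<le> (m0 + \<epsilon>) * cross f q"
      using c2(2)[of t] st by (auto simp: f_def u_def)
    have "0 \<le> (norm q)\<^sup>2 * cross e f"
      using chords[of s t t1] st t1 c1 less by (simp add: e_def f_def)
    then have "inner e q * cross f q \<le> cross e q * inner f q" by (simp add: cross_frame)
    also have "\<dots> \<le> cross e q * ((m0 + \<epsilon>) * cross f q)"
      using fle xe by (intro mult_left_mono) auto
    also have "\<dots> = ((m0 + \<epsilon>) * cross e q) * cross f q" by simp
    finally have upper: "inner e q \<le> (m0 + \<epsilon>) * cross e q"
      using xf mult_le_cancel_right_pos by blast
    show "cross (\<gamma> t - \<gamma> s) q > 0 \<and> m0 * cross (\<gamma> t - \<gamma> s) q \<le> inner
      (\<gamma> t - \<gamma> s) q \<and>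
      inner (\<gamma> t - \<gamma> s) q \<le> (m0 + \<epsilon>) * cross (\<gamma> t - \<gamma> s) q"
      using xe lower upper by (simp add: e_def)
  qed
qed

text \<open>The length of a segment of slope \<open>m0\<close> per unit of abscissa.\<close>

definition "W0 = sqrt (1 + m0\<^sup>2)"

lemma W0: "W0 \<ge> 1" "W0\<^sup>2 = 1 + m0\<^sup>2" "\<bar>m0\<bar> \<le> W0"
proof -
  show "W0\<^sup>2 = 1 + m0\<^sup>2" by (simp add: W0_def)
  show "W0 \<ge> 1" by (simp add: W0_def)
  show "\<bar>m0\<bar> \<le> W0" unfolding W0_def by (rule real_le_rsqrt) simp
qed

text \<open>All chords near \<open>t0\<close> have slopes between \<open>m0\<close> and
  \<open>m0 + \<epsilon>\<close>, so a multiple of \<open>x\<close> dominates their lengths, and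
  \<open>arc_le\<close> carries this over to the arc. The constant \<open>W0 + \<epsilon>\<close>
  works because \<open>\<bar>m0\<bar> \<le> W0\<close>.\<close>

lemma arc_upper:
  assumes "\<epsilon> > 0"
  shows "eventually (\<lambda>t. t - t0 \<le> x t * (W0 + \<epsilon>) / norm q) (at_right t0)"
proof -
  obtain c where c: "t0 < c" "c \<le> b" and
    sl: "\<And>s t. t0 \<le> s \<Longrightarrow> s < t \<Longrightarrow> t < c \<Longrightarrow> cross
      (\<gamma> t - \<gamma> s) q > 0 \<and>
      m0 * cross (\<gamma> t - \<gamma> s) q \<le> inner (\<gamma> t - \<gamma> s) q \<and>
      inner (\<gamma> t - \<gamma> s) q \<le> (m0 + \<epsilon>) * cross (\<gamma> t - \<gamma> s) q"
    using chord_slope[OF assms] by blast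
  have chord: "dist (\<gamma> s) (\<gamma> t) \<le> x t * (W0 + \<epsilon>) / norm q - x s * (W0 + \<epsilon>) / norm q"
    if st: "t0 \<le> s" "s \<le> t" "t < c" for s t
  proof (cases "s = t")
    case False
    define e where "e = \<gamma> t - \<gamma> s"
    define X where "X = cross e q"
    have X: "X > 0" "m0 * X \<le> inner e q" "inner e q \<le> (m0 + \<epsilon>) * X"
      using sl[of s t] st False by (auto simp: X_def e_def)
    have "\<bar>inner e q - m0 * X\<bar> \<le> \<epsilon> * X" using X by (simp add: algebra_simps abs_if)
    then have "\<bar>inner e q\<bar> \<le> \<bar>m0 * X\<bar> + \<epsilon> * X" by linarith
    also have "\<dots> = (\<bar>m0\<bar> + \<epsilon>) * X" using X by (simp add: abs_mult algebra_simps)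
    finally have ie: "(inner e q)\<^sup>2 \<le> ((\<bar>m0\<bar> + \<epsilon>) * X)\<^sup>2"
      using abs_le_square_iff[of "inner e q" "(\<bar>m0\<bar> + \<epsilon>) * X"] X assms by simp
    have "(norm q * norm e)\<^sup>2 = X\<^sup>2 + (inner e q)\<^sup>2"
      using norm_frame[of q e] by (simp add: X_def power_mult_distrib)
    also have "\<dots> \<le> X\<^sup>2 + ((\<bar>m0\<bar> + \<epsilon>) * X)\<^sup>2" using ie by simp
    also have "\<dots> = X\<^sup>2 * (1 + m0\<^sup>2 + 2 * \<epsilon> * \<bar>m0\<bar> + \<epsilon>\<^sup>2)"
      using power2_abs[of m0] by algebra
    also have "\<dots> \<le> X\<^sup>2 * (W0 + \<epsilon>)\<^sup>2"
    proof (rule mult_left_mono)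
      have "\<epsilon> * \<bar>m0\<bar> \<le> \<epsilon> * W0" using W0(3) assms by (intro mult_left_mono) auto
      then show "1 + m0\<^sup>2 + 2 * \<epsilon> * \<bar>m0\<bar> + \<epsilon>\<^sup>2 \<le> (W0 + \<epsilon>)\<^sup>2"
        unfolding power2_sum W0(2) by (simp add: mult_ac)
    qed simp
    also have "\<dots> = (X * (W0 + \<epsilon>))\<^sup>2" by (rule power_mult_distrib[symmetric])
    finally have "norm q * norm e \<le> X * (W0 + \<epsilon>)"
      by (rule power2_le_imp_le) (use X W0(1) assms in simp)
    then have "norm e \<le> X * (W0 + \<epsilon>) / norm q" using nq by (simp add: field_simps)
    moreover have "X = x t - x s" by (simp add: X_def e_def x_def u_def cross_diff)
    ultimately show ?thesis
      by (simp add: e_def dist_norm norm_minus_commute left_diff_distrib diff_divide_distrib)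
  qed simp
  have "t - t0 \<le> x t * (W0 + \<epsilon>) / norm q" if "t0 < t \<and> t < c" for t
  proof -
    have "t - t0 \<le> x t * (W0 + \<epsilon>) / norm q - x t0 * (W0 + \<epsilon>) / norm q"
      using that c by (intro arc_le chord) auto
    moreover have "x t0 = 0" by (simp add: x_def u_def cross_expand)
    ultimately show ?thesis by simp
  qed
  with ev_right[OF c(1)] show ?thesis by (auto elim: eventually_mono)
qed

text \<open>A chord is no longer than its arc, and \<open>norm_frame\<close> expresses its length by
  \<open>x\<close> and \<open>m\<close>.\<close>

lemma arc_lower: assumes "t0 < t" "t < b"
  shows "sqrt (1 + (m t)\<^sup>2) / norm q \<le> (t - t0) / x t"
proof -
  have xt: "x t > 0" using x_pos assms by simp
  have "(x t * sqrt (1 + (m t)\<^sup>2))\<^sup>2 = (x t)\<^sup>2 * (1 + (m t)\<^sup>2)"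
    by (simp add: power_mult_distrib)
  also have "\<dots> = (norm q * norm (u t))\<^sup>2"
    using norm_frame[of q "u t"] xt by (simp add: power_mult_distrib m_def x_def power_divide field_simps)
  finally have "x t * sqrt (1 + (m t)\<^sup>2) = norm q * norm (u t)"
    using xt by (simp add: power2_eq_iff_nonneg)
  also have "\<dots> \<le> norm q * (t - t0)"
    using chord_le[of t] assms by (intro mult_left_mono) (auto simp: u_def dist_norm norm_minus_commute)
  finally show ?thesis using xt nq by (simp add: field_simps)
qed

text \<open>Here arclength enters: \<open>arc_lower\<close> and \<open>arc_upper\<close> squeeze the
  ratio of arc to abscissa, so that time and abscissa agree to first order up to a factor.\<close>

lemma tendsto_x_ratio: "((\<lambda>t. x t / (t - t0)) \<longlongrightarrow> norm q / W0) (at_right t0)"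
proof -
  have "((\<lambda>t. (t - t0) / x t) \<longlongrightarrow> W0 / norm q) (at_right t0)"
  proof (rule order_tendstoI)
    fix l assume l: "l < W0 / norm q"
    have "((\<lambda>t. sqrt (1 + (m t)\<^sup>2) / norm q) \<longlongrightarrow> sqrt (1 + m0\<^sup>2) /
      norm q) (at_right t0)"
      using nq by (intro tendsto_intros tendsto_m) auto
    from order_tendstoD(1)[OF this, of l] l
    have "eventually (\<lambda>t. l < sqrt (1 + (m t)\<^sup>2) / norm q) (at_right t0)" by (simp add: W0_def)
    with ev_right[OF less(2)] show "eventually (\<lambda>t. l < (t - t0) / x t) (at_right t0)"
    proof eventually_elim
      case (elim t)
      then show ?case using arc_lower[of t] by linarith
    qed
  next
    fix l assume l: "W0 / norm q < l"
    \<comment> \<open>\<open>(W0 + \<epsilon>) / norm q\<close> is then the midpoint between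
      \<open>W0 / norm q\<close> and \<open>l\<close>.\<close>
    define \<epsilon> where "\<epsilon> = (l * norm q - W0) / 2"
    have e: "\<epsilon> > 0" using l nq by (simp add: \<epsilon>_def field_simps)
    have "(W0 + \<epsilon>) / norm q < l" using l nq e by (simp add: \<epsilon>_def field_simps)
    then have ltan: "(W0 + \<epsilon>) / norm q < l" .
    from arc_upper[OF e] ev_right[OF less(2)]
    show "eventually (\<lambda>t. (t - t0) / x t < l) (at_right t0)"
    proof eventually_elim
      case (elim t)
      then have "(t - t0) / x t \<le> (W0 + \<epsilon>) / norm q" using x_pos[of t] nq by (simp add: field_simps)
      then show ?case using ltan by linarith
    qed
  qed
  moreover have "W0 / norm q \<noteq> 0" using nq W0 by auto
  ultimately have "((\<lambda>t. inverse ((t - t0) / x t)) \<longlongrightarrow> inverse (W0 / norm q)) (at_right t0)"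
    by (rule tendsto_inverse)
  then show ?thesis by simp
qed

text \<open>The unit vector of slope \<open>m0\<close> in the frame of \<open>q\<close>.\<close>

definition "\<tau> = of_real (1 / (norm q * W0)) * (q * (of_real m0 - \<i>))"

lemma tendsto_tangent: "((\<lambda>t. (\<gamma> t - \<gamma> t0) /\<^sub>R (t - t0))
  \<longlongrightarrow> \<tau>) (at_right t0)"
proof -
  have "((\<lambda>t. of_real (x t / (t - t0)) * (q * (of_real (m t) - \<i>)) / of_real ((norm
    q)\<^sup>2)) \<longlongrightarrow>
     of_real (norm q / W0) * (q * (of_real m0 - \<i>)) / of_real ((norm q)\<^sup>2)) (at_right t0)"
    using q_nz by (intro tendsto_intros tendsto_m tendsto_x_ratio) auto
  moreover have "of_real (norm q / W0) * (q * (of_real m0 - \<i>)) / of_real ((norm q)\<^sup>2) = \<tau>"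
    using nq by (simp add: \<tau>_def power2_eq_square)
  moreover have "eventually (\<lambda>t. of_real (x t / (t - t0)) * (q * (of_real (m t) - \<i>)) /
    of_real ((norm q)\<^sup>2)
      = (\<gamma> t - \<gamma> t0) /\<^sub>R (t - t0)) (at_right t0)"
    using ev_right[OF less(2)]
  proof eventually_elim
    case (elim t)
    then have "x t > 0" using x_pos by simp
    then have "u t = x t *\<^sub>R (q * (of_real (m t) - \<i>)) / of_real ((norm q)\<^sup>2)"
      using frame_decomp[OF q_nz, of "u t"] unfolding x_def m_def by simp
    then have "(u t) /\<^sub>R (t - t0) = (x t *\<^sub>R (q * (of_real (m t) - \<i>)) / of_real ((norm
      q)\<^sup>2)) /\<^sub>R (t - t0)" by simp
    then show ?case unfolding u_def by (simp add: scaleR_conv_of_real field_simps)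
  qed
  ultimately show ?thesis by (simp add: filterlim_cong)
qed

lemma norm_tangent: "norm \<tau> = 1"
proof -
  have "norm (complex_of_real m0 - \<i>) = W0" by (simp add: W0_def cmod_def)
  then show ?thesis using nq W0(1) by (simp add: \<tau>_def norm_mult norm_divide)
qed

text \<open>If \<open>z\<close> were strictly to the right of the tangent, it would be to the right
  of short chords too. Then \<open>\<gamma> t\<close> or \<open>\<gamma> t0\<close> is a convex
  combination of the other one, \<open>z\<close> and \<open>p\<close> with positive weight at
  \<open>p\<close>, hence interior.\<close>

lemma tangent_supports:
  assumes z: "z \<in> \<Omega>"
  shows "cross \<tau> (z - \<gamma> t0) \<ge> 0"
proof (rule ccontr)
  assume neg: "\<not> ?thesis"
  define v where "v = z - \<gamma> t0"
  have zv: "z = \<gamma> t0 + v" by (simp add: v_def)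
  have "((\<lambda>t. cross ((\<gamma> t - \<gamma> t0) /\<^sub>R (t - t0)) v) \<longlongrightarrow>
    cross \<tau> v) (at_right t0)"
    by (intro tendsto_intros tendsto_tangent)
  then have "eventually (\<lambda>t. cross ((\<gamma> t - \<gamma> t0) /\<^sub>R (t - t0)) v < 0) (at_right t0)"
    using neg by (intro order_tendstoD(2)) (auto simp: v_def)
  with ev_right[OF less(2)] have ev1: "eventually (\<lambda>t. t0 < t \<and> t < b \<and> cross (u t) v <
    0) (at_right t0)"
  proof eventually_elim
    case (elim t)
    then show ?case by (auto simp: u_def cross_scaleR mult_less_0_iff)
  qed
  have S: "\<gamma> t0 \<in> \<Omega>" "\<gamma> t0 \<notin> interior \<Omega>" using in_S not_int less by auto
  show False
  proof (cases "cross v q > 0")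
    case True
    \<comment> \<open>This quotient is \<open>\<alpha> + \<beta>\<close> below; it tends to 0, so
      weight remains for \<open>\<gamma> t0\<close>.\<close>
    have "((\<lambda>t. (x t - cross (u t) v) / cross v q) \<longlongrightarrow> (cross 0 q - cross 0 v)
      / cross v q) (at_right t0)"
      unfolding x_def using True by (intro tendsto_intros tendsto_u) auto
    then have "eventually (\<lambda>t. (x t - cross (u t) v) / cross v q < 1) (at_right t0)"
      by (rule order_tendstoD) (simp add: cross_expand)
    with ev1 have "eventually (\<lambda>t. t0 < t \<and> t < b \<and> cross (u t) v < 0 \<and> (x t -
      cross (u t) v) / cross v q < 1) (at_right t0)"
      by eventually_elim auto
    then obtain t where t: "t0 < t" "t < b" "cross (u t) v < 0" "(x t - cross (u t) v) / cross v q < 1"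
      by (auto dest: eventually_happens)
    define \<alpha> where "\<alpha> = - cross (u t) v / cross v q"
    define \<beta> where "\<beta> = x t / cross v q"
    have ab: "\<alpha> > 0" "\<beta> \<ge> 0" "\<alpha> + \<beta> < 1"
      using t True x_pos[of t] by (auto simp: \<alpha>_def \<beta>_def add_divide_distrib[symmetric] field_simps)
    have "cross v q *\<^sub>R u t = - cross (u t) v *\<^sub>R q + x t *\<^sub>R v"
      using cross_cycle[of "u t" v q] unfolding x_def cross_commute[of q "u t"]
      by (simp add: algebra_simps eq_neg_iff_add_eq_0)
    then have "(1 / cross v q) *\<^sub>R cross v q *\<^sub>R u t = (1 / cross v q) *\<^sub>R (- cross (u
      t) v *\<^sub>R q + x t *\<^sub>R v)"
      by simp
    then have "u t = \<alpha> *\<^sub>R q + \<beta> *\<^sub>R v" using True by (simp add: \<alpha>_def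
      \<beta>_def scaleR_diff_right)
    then have "\<gamma> t = \<alpha> *\<^sub>R p + \<beta> *\<^sub>R z + (1 - \<alpha> - \<beta>) *\<^sub>R \<gamma> t0"
      unfolding u_def q_def v_def by (simp add: algebra_simps)
    also have "\<dots> \<in> interior \<Omega>"
      using ab S z by (intro interior_weights conv p) auto
    finally show False using not_int[of t] t less by auto
  next
    case False
    obtain t where t: "t0 < t" "t < b" "cross (u t) v < 0"
      using eventually_happens[OF ev1] by auto
    \<comment> \<open>\<open>cross_cycle\<close> is a linear relation among \<open>q\<close>,
      \<open>u t\<close> and \<open>v\<close> whose coefficients, after the sign changes, are
      nonnegative in this case; \<open>S\<close> normalizes them to weights.\<close>
    define S where "S = - cross (u t) v - cross v q + x t"
    have xt: "x t > 0" using x_pos t by simp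
    have Sp: "S > 0" using t False xt by (simp add: S_def)
    have "- cross (u t) v *\<^sub>R q + - cross v q *\<^sub>R u t + x t *\<^sub>R v = 0"
      using cross_cycle[of "u t" v q] unfolding x_def cross_commute[of q "u t"]
      by (simp add: algebra_simps eq_neg_iff_add_eq_0 add_eq_0_iff)
    then have "(1/S) *\<^sub>R (- cross (u t) v *\<^sub>R q + - cross v q *\<^sub>R u t + x t *\<^sub>R v) = 0" by simp
    then have "0 = (- cross (u t) v / S) *\<^sub>R q + (- cross v q / S) *\<^sub>R u t + (x t / S) *\<^sub>R v"
      by (simp add: scaleR_add_right scaleR_diff_right)
    moreover have sum: "(- cross (u t) v / S) + (- cross v q / S) + (x t / S) = 1"
      using Sp unfolding add_divide_distrib[symmetric] by (simp add: S_def)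
    moreover have "w = a *\<^sub>R p + b *\<^sub>R g + c *\<^sub>R z"
      if "0 = a *\<^sub>R (p - w) + b *\<^sub>R (g - w) + c *\<^sub>R (z - w)" "a + b + c = 1" for a b c
        and w g :: complex
    proof -
      have "(a + b + c) *\<^sub>R w = a *\<^sub>R p + b *\<^sub>R g + c *\<^sub>R z"
        using that(1) by (simp add: algebra_simps)
      then show ?thesis using that(2) by simp
    qed
    ultimately have "\<gamma> t0 = (- cross (u t) v / S) *\<^sub>R p + (- cross v q / S) *\<^sub>R
      \<gamma> t + (x t / S) *\<^sub>R z"
      unfolding u_def q_def v_def by blast
    also have "\<dots> \<in> interior \<Omega>"
      using sum Sp t False xt z in_S[of t] less by (intro interior_weights conv p) (auto simp: divide_simps)
    finally show False using not_int[of t0] less by auto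
  qed
qed

end

section \<open>Lengths of curves\<close>

definition partition_seq :: "real \<Rightarrow> real \<Rightarrow> (nat \<Rightarrow> real) \<Rightarrow> bool" where
  "partition_seq a b t \<longleftrightarrow> mono t \<and> range t \<subseteq> {a..b}"

lemma partition_seqD:
  assumes "partition_seq a b t"
  shows "i \<le> j \<Longrightarrow> t i \<le> t j" "a \<le> t i" "t i \<le> b"
  using assms by (auto simp: partition_seq_def mono_def image_subset_iff)

lemma polygon_le_curve_length:
  "partition_seq a b t \<Longrightarrow> (\<Sum>i<n. ennreal (dist (\<gamma> (t i)) (\<gamma> (t (Suc
    i))))) \<le> curve_length \<gamma> a b"
  unfolding curve_length_def partition_seq_def by (rule SUP_upper2[of "(n, t)"]) auto

lemma curve_length_leI:
  assumes "\<And>n t. partition_seq a b t \<Longrightarrow> (\<Sum>i<n. ennreal (dist (\<gamma> (t i))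
    (\<gamma> (t (Suc i))))) \<le> C"
  shows "curve_length \<gamma> a b \<le> C"
  unfolding curve_length_def using assms by (intro SUP_least) (auto simp: partition_seq_def)

text \<open>Polygon sums telescope once each chord is bounded by an increment of \<open>X\<close>.
  In this form upper bounds of lengths can be used without partitions.\<close>

lemma curve_length_le_dominating:
  assumes ab: "a \<le> b"
    and X: "\<And>s u. a \<le> s \<Longrightarrow> s \<le> u \<Longrightarrow> u \<le> b
      \<Longrightarrow> dist (\<gamma> s) (\<gamma> u) \<le> X u - X s"
  shows "curve_length \<gamma> a b \<le> ennreal (X b - X a)"
proof (rule curve_length_leI)
  fix n and t :: "nat \<Rightarrow> real"
  assume t: "partition_seq a b t"
  note tD = partition_seqD[OF t]
  have Xm: "X s \<le> X u" if "a \<le> s" "s \<le> u" "u \<le> b" for s u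
    using X[OF that] zero_le_dist[of "\<gamma> s" "\<gamma> u"] by linarith
  have "(\<Sum>i<n. dist (\<gamma> (t i)) (\<gamma> (t (Suc i)))) \<le> (\<Sum>i<n. X (t (Suc i)) - X (t i))"
    using tD by (intro sum_mono X) auto
  also have "\<dots> = X (t n) - X (t 0)" by (rule sum_lessThan_telescope)
  also have "\<dots> \<le> X b - X a" using Xm[of a "t 0"] Xm[of "t n" b] tD by fastforce
  finally show "(\<Sum>i<n. ennreal (dist (\<gamma> (t i)) (\<gamma> (t (Suc i))))) \<le> ennreal (X b - X a)"
    by (simp add: sum_ennreal ennreal_leI)
qed

lemma dist_le_curve_length:
  assumes "a \<le> s" "s \<le> u" "u \<le> b"
  shows "ennreal (dist (\<gamma> s) (\<gamma> u)) \<le> curve_length \<gamma> a b"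
proof -
  \<comment> \<open>\<open>s\<close> followed by \<open>u\<close> forever: a single chord.\<close>
  have "partition_seq a b (\<lambda>i. if i = 0 then s else u)"
    using assms by (auto simp: partition_seq_def mono_def)
  from polygon_le_curve_length[OF this, where n = 1 and \<gamma> = \<gamma>] show ?thesis by simp
qed

lemma curve_length_reparam_le:
  assumes h: "\<And>x y. a \<le> x \<Longrightarrow> x \<le> y \<Longrightarrow> y \<le> b
    \<Longrightarrow> h x \<le> h y"
    and eq: "\<And>x. a \<le> x \<Longrightarrow> x \<le> b \<Longrightarrow> \<gamma> x = \<beta> (h x)"
  shows "curve_length \<gamma> a b \<le> curve_length \<beta> (h a) (h b)"
proof (rule curve_length_leI)
  fix n and t :: "nat \<Rightarrow> real"
  assume t: "partition_seq a b t"
  note tD = partition_seqD[OF t]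
  have "partition_seq (h a) (h b) (\<lambda>i. h (t i))"
    unfolding partition_seq_def mono_def using tD by (auto intro!: h intro: order_trans)
  from polygon_le_curve_length[OF this, where n = n and \<gamma> = \<beta>]
  show "(\<Sum>i<n. ennreal (dist (\<gamma> (t i)) (\<gamma> (t (Suc i))))) \<le> curve_length \<beta> (h a) (h b)"
    using tD by (simp add: eq)
qed

lemma curve_length_reparam:
  assumes h: "\<And>x y. x \<le> y \<Longrightarrow> h x \<le> h y" and k: "\<And>x y. x \<le> y
    \<Longrightarrow> k x \<le> k y"
    and inv: "\<And>x. k (h x) = x" "\<And>x. h (k x) = x"
  shows "curve_length (\<lambda>x. \<beta> (h x)) a b = curve_length \<beta> (h a) (h b)"
proof (rule antisym)
  show "curve_length (\<lambda>x. \<beta> (h x)) a b \<le> curve_length \<beta> (h a) (h b)"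
    by (rule curve_length_reparam_le) (auto intro: h)
  have "curve_length \<beta> (h a) (h b) \<le> curve_length (\<lambda>x. \<beta> (h x)) (k (h a)) (k (h b))"
    by (rule curve_length_reparam_le) (auto intro: k simp: inv)
  then show "curve_length \<beta> (h a) (h b) \<le> curve_length (\<lambda>x. \<beta> (h x)) a b" by (simp add: inv)
qed

text \<open>Clipping a partition with \<open>min\<close> and \<open>max\<close> at \<open>b\<close>
  gives partitions of both pieces; only the chord that straddles \<open>b\<close> needs the triangle
  inequality.\<close>

lemma curve_length_add_le:
  assumes "a \<le> b" "b \<le> c"
  shows "curve_length \<gamma> a c \<le> curve_length \<gamma> a b + curve_length \<gamma> b c"
proof (rule curve_length_leI)
  fix n and t :: "nat \<Rightarrow> real"
  assume t: "partition_seq a c t"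
  note tD = partition_seqD[OF t]
  let ?d = "\<lambda>x y. ennreal (dist (\<gamma> x) (\<gamma> y))"
  have "(\<Sum>i<n. ?d (t i) (t (Suc i))) \<le>
     (\<Sum>i<n. ?d (min (t i) b) (min (t (Suc i)) b) + ?d (max (t i) b) (max (t (Suc i)) b))"
  proof (rule sum_mono)
    fix i
    have "t i \<le> t (Suc i)" using tD by simp
    then consider "t (Suc i) \<le> b" | "b \<le> t i" | "t i \<le> b" "b \<le> t (Suc i)" by linarith
    then show "?d (t i) (t (Suc i)) \<le> ?d (min (t i) b) (min (t (Suc i)) b) + ?d (max (t i) b) (max (t (Suc i)) b)"
    proof cases
      case 3
      then show ?thesis by (simp add: min_def max_def dist_triangle flip: ennreal_plus)
    qed (use \<open>t i \<le> t (Suc i)\<close> in \<open>simp_all add: min_def max_def\<close>)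
  qed
  also have "\<dots> = (\<Sum>i<n. ?d (min (t i) b) (min (t (Suc i)) b)) + (\<Sum>i<n. ?d (max (t i) b)
    (max (t (Suc i)) b))"
    by (rule sum.distrib)
  also have "\<dots> \<le> curve_length \<gamma> a b + curve_length \<gamma> b c"
  proof (rule add_mono)
    show "(\<Sum>i<n. ?d (min (t i) b) (min (t (Suc i)) b)) \<le> curve_length \<gamma> a b"
      by (rule polygon_le_curve_length)
         (use assms tD(2) in \<open>simp add: partition_seq_def monoI[OF min.mono[OF tD(1) order_refl]]
           image_subset_iff\<close>)
    show "(\<Sum>i<n. ?d (max (t i) b) (max (t (Suc i)) b)) \<le> curve_length \<gamma> b c"
      by (rule polygon_le_curve_length)
         (use assms tD(3) in \<open>simp add: partition_seq_def monoI[OF max.mono[OF tD(1) order_refl]]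
           image_subset_iff\<close>)
  qed
  finally show "(\<Sum>i<n. ?d (t i) (t (Suc i))) \<le> curve_length \<gamma> a b + curve_length \<gamma> b c" .
qed

lemma curve_length_add_ge:
  assumes "a \<le> b" "b \<le> c"
  shows "curve_length \<gamma> a b + curve_length \<gamma> b c \<le> curve_length \<gamma> a c"
proof -
  let ?d = "\<lambda>x y. ennreal (dist (\<gamma> x) (\<gamma> y))"
  have pair: "(\<Sum>i<n. ?d (t i) (t (Suc i))) + (\<Sum>i<m. ?d (r i) (r (Suc i))) \<le> curve_length \<gamma> a c"
    if t: "partition_seq a b t" and r: "partition_seq b c r" for n m and t r :: "nat \<Rightarrow> real"
  proof -
    note tD = partition_seqD[OF t] and rD = partition_seqD[OF r]
    \<comment> \<open>The first \<open>n + 1\<close> points come from \<open>t\<close>, the rest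
      from \<open>r\<close>. The chord with index \<open>n\<close>, which joins the two, is left out
      of the sums below.\<close>
    define v where "v i = (if i \<le> n then t i else r (i - Suc n))" for i
    have v: "partition_seq a c v"
      unfolding partition_seq_def mono_def
    proof (intro conjI allI impI subsetI)
      fix i j :: nat assume "i \<le> j"
      then show "v i \<le> v j" unfolding v_def using tD rD order_trans[OF tD(3) rD(2)] by auto
    next
      fix y assume "y \<in> range v"
      then obtain i where "y = v i" by auto
      then show "y \<in> {a..c}"
        using tD(2,3)[of i] rD(2,3)[of "i - Suc n"] assms by (auto simp: v_def)
    qed
    have "(\<Sum>i<n. ?d (t i) (t (Suc i))) = (\<Sum>i<n. ?d (v i) (v (Suc i)))"
      by (rule sum.cong) (auto simp: v_def)
    moreover have "(\<Sum>i<m. ?d (r i) (r (Suc i))) = (\<Sum>i<m. ?d (v (i + Suc n)) (v (Suc (i + Suc n))))"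
      by (rule sum.cong) (auto simp: v_def)
    moreover have "(\<Sum>i<m. ?d (v (i + Suc n)) (v (Suc (i + Suc n)))) = (\<Sum>i\<in>{Suc n..<m + Suc
      n}. ?d (v i) (v (Suc i)))"
      using sum.shift_bounds_nat_ivl[of "\<lambda>i. ?d (v i) (v (Suc i))" 0 "Suc n" m]
      by (simp add: lessThan_atLeast0)
    moreover have "(\<Sum>i<n. ?d (v i) (v (Suc i))) + (\<Sum>i\<in>{Suc n..<m + Suc n}. ?d (v i) (v (Suc i)))
        = (\<Sum>i\<in>{..<n} \<union> {Suc n..<m + Suc n}. ?d (v i) (v (Suc i)))"
      by (rule sum.union_disjoint[symmetric]) auto
    moreover have "\<dots> \<le> (\<Sum>i<m + Suc n. ?d (v i) (v (Suc i)))"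
      by (rule sum_mono2) auto
    moreover have "\<dots> \<le> curve_length \<gamma> a c"
      by (rule polygon_le_curve_length[OF v])
    ultimately show ?thesis by simp
  qed
  define I where "I x y = {(n::nat, t::nat \<Rightarrow> real). mono t \<and> range t \<subseteq> {x..y}}" for x y
  have I: "(n, t) \<in> I x y \<longleftrightarrow> partition_seq x y t" for n t x y by (auto simp: I_def
    partition_seq_def)
  have ne: "I x y \<noteq> {}" if "x \<le> y" for x y
    using that unfolding I_def by (auto intro!: exI[of _ "\<lambda>_. x"] simp: mono_def)
  have 1: "curve_length \<gamma> x y = (SUP i\<in>I x y. case i of (n, t) \<Rightarrow> \<Sum>i<n. ?d (t
    i) (t (Suc i)))" for x y
    by (simp add: curve_length_def I_def)
  show ?thesis
    unfolding 1[of a b] 1[of b c]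
    unfolding ennreal_SUP_add_left[OF ne[OF assms(1)], symmetric] ennreal_SUP_add_right[OF ne[OF assms(2)]]
    by (intro SUP_least) (auto simp: I simp del: sum_ennreal intro: pair)
qed

lemma curve_length_add:
  "a \<le> b \<Longrightarrow> b \<le> c \<Longrightarrow> curve_length \<gamma> a c = curve_length
    \<gamma> a b + curve_length \<gamma> b c"
  using curve_length_add_le curve_length_add_ge by (intro antisym)

section \<open>Continuous logarithms and the polar description of a convex curve\<close>

lemma continuous_logs_increment:
  fixes f g :: "'a::topological_space \<Rightarrow> complex"
  assumes "connected S" "continuous_on S f" "continuous_on S g"
    and "\<And>x. x \<in> S \<Longrightarrow> exp (f x) = exp (g x)" and "x \<in> S" "y \<in> S"
  shows "f x - g x = f y - g y"
proof -
  \<comment> \<open>Two logarithms of one number differ by an integer multiple of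
    \<open>2 * pi * \<i>\<close>, so distinct values of the continuous difference are at least
    \<open>2 * pi\<close> apart.\<close>
  have "(\<lambda>x. f x - g x) constant_on S"
  proof (rule continuous_discrete_range_constant[OF assms(1)])
    show "continuous_on S (\<lambda>x. f x - g x)" by (intro continuous_intros assms)
    fix x assume "x \<in> S"
    show "\<exists>e>0. \<forall>y. y \<in> S \<and> f y - g y \<noteq> f x - g x \<longrightarrow> e
      \<le> norm (f y - g y - (f x - g x))"
    proof (intro exI[of _ "2 * pi"] conjI allI impI)
      fix y assume y: "y \<in> S \<and> f y - g y \<noteq> f x - g x"
      obtain n where n: "f x = g x + of_int (2 * n) * pi * \<i>"
        using assms(4)[OF \<open>x \<in> S\<close>] by (auto simp: exp_eq)
      obtain m where m: "f y = g y + of_int (2 * m) * pi * \<i>"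
        using assms(4)[of y] y by (auto simp: exp_eq)
      have d: "f y - g y - (f x - g x) = of_real (2 * pi * of_int (m - n)) * \<i>"
        unfolding n m by (simp add: algebra_simps)
      then have "m \<noteq> n" using y by auto
      then have "1 \<le> \<bar>real_of_int (m - n)\<bar>" by linarith
      then show "2 * pi \<le> norm (f y - g y - (f x - g x))"
        unfolding d norm_mult norm_of_real by (simp add: abs_mult)
    qed simp
  qed
  then show ?thesis using assms(5,6) by (auto simp: constant_on_def)
qed

lemma norm_cis_diff_le: "norm (cis a - cis b) \<le> \<bar>a - b\<bar>"
proof -
  have "cis a - cis b = cis b * (exp (\<i> * of_real (a - b)) - 1)"
    by (simp add: cis_conv_exp algebra_simps flip: exp_add)
  then have "norm (cis a - cis b) = 2 * \<bar>sin ((a - b) / 2)\<bar>"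
    by (simp only: norm_mult dist_exp_i_1) simp
  also have "\<dots> \<le> 2 * \<bar>(a - b) / 2\<bar>" using abs_sin_x_le_abs_x[of "(a - b) / 2"] by linarith
  finally show ?thesis by simp
qed

text \<open>The nearer of two boundary points on a ray would be interior, since it is reached from
  the farther one by moving towards \<open>p\<close>.\<close>

lemma frontier_ray_unique:
  fixes p l :: complex
  assumes "convex S" "closed S" "p \<in> interior S" "d > 0" "e > 0"
    and "p + d *\<^sub>R l \<in> frontier S" "p + e *\<^sub>R l \<in> frontier S"
  shows "d *\<^sub>R l = e *\<^sub>R l"
proof -
  have *: False if "0 < d" "d < e" "p + d *\<^sub>R l \<in> frontier S" "p + e *\<^sub>R l \<in> frontier S" for d e
  proof -
    have "p + e *\<^sub>R l \<in> S" "0 < 1 - d / e" "1 - d / e \<le> 1"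
      using assms that frontier_subset_closed[of S] by auto
    from mem_interior_convex_shrink[OF assms(1,3) this]
    have "p + (e - (1 - d / e) * e) *\<^sub>R l \<in> interior S" by (simp add: scaleR_diff_left add_diff_eq)
    moreover have "e - (1 - d / e) * e = d" using that by (simp add: field_simps)
    ultimately have "p + d *\<^sub>R l \<in> interior S" by simp
    then show False using that by (simp add: frontier_def)
  qed
  show ?thesis using *[of d e] *[of e d] assms by (cases d e rule: linorder_cases) auto
qed

locale convex_body =
  fixes \<Omega> :: "complex set"
  assumes compact: "compact \<Omega>" and convex: "convex \<Omega>"
begin

lemma closed: "closed \<Omega>" and bounded: "bounded \<Omega>"
  using compact by (auto intro: compact_imp_closed compact_imp_bounded)

lemma frontier_in: "z \<in> frontier \<Omega> \<Longrightarrow> z \<in> \<Omega>" and frontier_not_int: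
  "z \<in> frontier \<Omega> \<Longrightarrow> z \<notin> interior \<Omega>"
  using frontier_subset_closed[OF closed] by (auto simp: frontier_def)

text \<open>The Lipschitz constant comes from a disk of radius \<open>d\<close> inside and one of
  radius \<open>R\<close> around \<open>\<Omega>\<close>, both centred at \<open>p\<close>. If the
  radius grew faster than \<open>R * R / d\<close>, the nearer boundary point would lie between the
  farther one and a point of the inner disk, hence in the interior.\<close>

lemma polar_lipschitz:
  assumes p: "p \<in> interior \<Omega>"
  obtains \<rho> M where "M > 0" "\<And>t. \<rho> t > 0" "\<And>t. p + \<rho> t *\<^sub>R cis t \<in> frontier \<Omega>"
    "\<And>s t. \<bar>\<rho> s - \<rho> t\<bar> \<le> M * \<bar>s - t\<bar>" "\<And>t. \<rho> t \<le> M"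
proof -
  have "\<exists>d>0. p + d *\<^sub>R cis t \<in> frontier \<Omega>" for t
  proof -
    have "cis t \<noteq> 0" by simp
    from ray_to_frontier[OF bounded p this] show ?thesis by blast
  qed
  then obtain \<rho> where \<rho>: "\<And>t. \<rho> t > 0" "\<And>t. p + \<rho> t *\<^sub>R cis t \<in>
    frontier \<Omega>" by metis
  obtain d where d: "d > 0" "ball p d \<subseteq> \<Omega>" using p mem_interior by blast
  then have d_int: "ball p d \<subseteq> interior \<Omega>" by (simp add: interior_maximal)
  obtain R where R: "R > 0" "\<Omega> \<subseteq> ball p R" using bounded bounded_subset_ballD by blast
  have le: "\<rho> t \<le> R" for t
  proof -
    have "p + \<rho> t *\<^sub>R cis t \<in> ball p R" using \<rho>(2) frontier_in R by blast
    then show ?thesis using \<rho>(1)[of t] by (simp add: dist_norm)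
  qed
  have one: "\<rho> t - \<rho> s \<le> (R * R / d) * \<bar>s - t\<bar>" for s t
  proof (rule ccontr)
    assume n: "\<not> ?thesis"
    then have gt: "\<rho> t - \<rho> s > (R * R / d) * \<bar>s - t\<bar>" by simp
    then have pos: "\<rho> t - \<rho> s > 0"
      using R d by (smt (verit) divide_nonneg_pos mult_nonneg_nonneg abs_ge_zero)
    define l where "l = \<rho> s / \<rho> t"
    have l: "0 < l" "l < 1" using \<rho>(1)[of s] \<rho>(1)[of t] pos by (auto simp: l_def)
    \<comment> \<open>Solved from \<open>p + \<rho> s *\<^sub>R cis s = l *\<^sub>R (p + \<rho> t
      *\<^sub>R cis t) + (1 - l) *\<^sub>R (p + w)\<close>.\<close>
    define w where "w = (\<rho> s / (1 - l)) *\<^sub>R (cis s - cis t)"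
    have "norm w = \<rho> s / (1 - l) * norm (cis s - cis t)" using \<rho>(1)[of s] l by (simp add: w_def)
    also have "\<dots> \<le> \<rho> s / (1 - l) * \<bar>s - t\<bar>"
      using \<rho>(1)[of s] l norm_cis_diff_le by (intro mult_left_mono) auto
    also have "\<rho> s / (1 - l) = \<rho> s * \<rho> t / (\<rho> t - \<rho> s)"
      using \<rho>(1)[of t] pos by (simp add: l_def field_simps)
    also have "\<dots> \<le> R * R / (\<rho> t - \<rho> s)"
      using \<rho>(1)[of t] \<rho>(1)[of s] le pos by (intro divide_right_mono mult_mono) (use R in
        \<open>auto simp: less_imp_le\<close>)
    finally have nw: "norm w \<le> R * R / (\<rho> t - \<rho> s) * \<bar>s - t\<bar>" by (simp add: mult_right_mono)
    also have "\<dots> < d" using gt pos d by (simp add: field_simps)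
    finally have "p + w \<in> interior \<Omega>" using d_int by (auto simp: dist_norm)
    then have "(p + \<rho> t *\<^sub>R cis t) - (1 - l) *\<^sub>R ((p + \<rho> t *\<^sub>R cis t) - (p +
      w)) \<in> interior \<Omega>"
      using l \<rho>(2) frontier_in by (intro mem_interior_convex_shrink convex) auto
    also have "(p + \<rho> t *\<^sub>R cis t) - (1 - l) *\<^sub>R ((p + \<rho> t *\<^sub>R cis t) - (p + w))
       = p + (l * \<rho> t) *\<^sub>R cis t + (1 - l) *\<^sub>R w"
      by (simp add: complex_eq_iff algebra_simps)
    also have "(1 - l) *\<^sub>R w = \<rho> s *\<^sub>R (cis s - cis t)" using l by (simp add: w_def)
    also have "l * \<rho> t = \<rho> s" using \<rho>(1)[of t] by (simp add: l_def)
    finally have "p + \<rho> s *\<^sub>R cis s \<in> interior \<Omega>" by (simp add: algebra_simps)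
    then show False using \<rho>(2)[of s] frontier_not_int by blast
  qed
  define M where "M = max R (R * R / d)"
  have M: "M > 0" "\<And>t. \<rho> t \<le> M" using R le by (auto simp: M_def max_def intro: order_trans)
  have "\<bar>\<rho> s - \<rho> t\<bar> \<le> M * \<bar>s - t\<bar>" for s t
  proof -
    have "\<bar>\<rho> s - \<rho> t\<bar> \<le> (R * R / d) * \<bar>s - t\<bar>"
      using one[of t s] one[of s t] by (simp add: abs_le_iff abs_minus_commute)
    also have "\<dots> \<le> M * \<bar>s - t\<bar>" by (intro mult_right_mono) (auto simp: M_def)
    finally show ?thesis .
  qed
  then show ?thesis using that \<rho> M by blast
qed

end

section \<open>Arclength parametrization of the boundary\<close>

lemma cis_inject:
  assumes "cis a = cis b" "\<bar>a - b\<bar> < 2 * pi" shows "a = b"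
proof -
  have "sin a = sin b \<and> cos a = cos b" using assms(1) by (simp add: complex_eq_iff)
  then obtain n :: int where n: "a = b + 2 * pi * n" by (auto simp: sin_cos_eq_iff)
  have "\<bar>real_of_int n\<bar> < 1"
    using assms(2) by (simp add: n abs_mult)
  then show ?thesis using n by simp
qed

lemma sgn_scaled_cis: "r > 0 \<Longrightarrow> sgn (r *\<^sub>R cis t) = cis t"
  by (simp add: sgn_scaleR sgn_div_norm)

context convex_body
begin

lemma frontier_eqI:
  assumes "p \<in> interior \<Omega>" "z \<in> frontier \<Omega>" "w \<in> frontier \<Omega>" "sgn (z -
    p) = sgn (w - p)"
  shows "z = w"
proof -
  have "z \<noteq> p" "w \<noteq> p" using assms frontier_not_int by auto
  moreover from this have "z = p + norm (z - p) *\<^sub>R sgn (z - p)" "w = p + norm (w - p) *\<^sub>R sgn (w - p)"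
    by (simp_all add: sgn_div_norm)
  then have "z = p + norm (z - p) *\<^sub>R sgn (z - p)" "w = p + norm (w - p) *\<^sub>R sgn (z - p)"
    using assms(4) by simp_all
  ultimately show ?thesis
    using frontier_ray_unique[OF convex closed assms(1), of "norm (z - p)" "norm (w - p)" "sgn (z - p)"] assms
    by (metis zero_less_norm_iff right_minus_eq)
qed

text \<open>The polar curve \<open>P\<close> is Lipschitz, hence rectifiable, and its length
  \<open>s\<close>, counted from angle 0, is a strictly increasing continuous bijection of the line.
  Composing \<open>P\<close> with the inverse \<open>k\<close> of \<open>s\<close> gives unit
  speed.\<close>

lemma arclength_param_exists:
  assumes p: "p \<in> interior \<Omega>"
  shows "\<exists>L \<gamma>. arclength_param \<Omega> L \<gamma>"
proof -
  obtain \<rho> M where M: "M > 0" and \<rho>: "\<And>t. \<rho> t > 0" and front: "\<And>t. p + \<rho> t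
    *\<^sub>R cis t \<in> frontier \<Omega>"
    and lip: "\<And>s t. \<bar>\<rho> s - \<rho> t\<bar> \<le> M * \<bar>s - t\<bar>" and le: "\<And>t.
      \<rho> t \<le> M"
    using polar_lipschitz[OF p] by metis
  define P where "P t = p + \<rho> t *\<^sub>R cis t" for t
  have P_front: "P t \<in> frontier \<Omega>" for t using front by (simp add: P_def)
  have P_sgn: "sgn (P t - p) = cis t" for t using \<rho> by (simp add: P_def sgn_scaled_cis)
  have P_per: "P (t + 2 * pi) = P t" for t
    by (rule frontier_eqI[OF p P_front P_front]) (simp add: P_sgn complex_eq_iff)
  have P_norm: "norm (P t - p) = \<rho> t" for t using \<rho>[of t] by (simp add: P_def)
  have \<rho>_per: "\<rho> (t + 2 * pi) = \<rho> t" for t using P_norm P_per by metis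
  have P_inj: "P s \<noteq> P t" if "s < t" "t < s + 2 * pi" for s t
    using cis_inject[of s t] P_sgn[of s] P_sgn[of t] that by auto
  have P_surj: "\<exists>t\<ge>0. t < 2 * pi \<and> P t = z" if z: "z \<in> frontier \<Omega>" for z
  proof (intro exI[of _ "Arg2pi (z - p)"] conjI)
    have "z - p \<noteq> 0" using z p frontier_not_int by auto
    moreover have "z - p = norm (z - p) *\<^sub>R cis (Arg2pi (z - p))"
      using Arg2pi_eq[of "z - p"] by (simp add: cis_conv_exp scaleR_conv_of_real)
    ultimately have "sgn (z - p) = cis (Arg2pi (z - p))"
      using sgn_scaled_cis[of "norm (z - p)"] by (metis zero_less_norm_iff)
    then show "P (Arg2pi (z - p)) = z"
      by (intro frontier_eqI[OF p P_front z]) (simp add: P_sgn)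
  qed (use Arg2pi[of "z - p"] in auto)
  have P_lip: "dist (P s) (P t) \<le> 2 * M * \<bar>s - t\<bar>" for s t
  proof -
    have "dist (P s) (P t) = norm ((\<rho> s - \<rho> t) *\<^sub>R cis s + \<rho> t *\<^sub>R (cis s - cis t))"
      by (simp add: P_def dist_norm algebra_simps)
    also have "\<dots> \<le> \<bar>\<rho> s - \<rho> t\<bar> + \<rho> t * norm (cis s - cis t)"
      using norm_triangle_ineq[of "(\<rho> s - \<rho> t) *\<^sub>R cis s" "\<rho> t *\<^sub>R (cis s -
        cis t)"] \<rho>[of t] by simp
    also have "\<dots> \<le> M * \<bar>s - t\<bar> + M * \<bar>s - t\<bar>"
      using lip[of s t] \<rho>[of t] le[of t] norm_cis_diff_le[of s t] by (intro add_mono mult_mono) auto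
    finally show ?thesis by simp
  qed
  define l where "l a b = enn2real (curve_length P a b)" for a b
  have len_le: "curve_length P a b \<le> ennreal (2 * M * b - 2 * M * a)" if "a \<le> b" for a b
  proof (rule curve_length_le_dominating[OF that])
    fix s u :: real assume "s \<le> u"
    then show "dist (P s) (P u) \<le> 2 * M * u - 2 * M * s"
      using P_lip[of s u] by (simp add: algebra_simps)
  qed
  then have len_l: "curve_length P a b = ennreal (l a b)" if "a \<le> b" for a b
    using that unfolding l_def by (metis ennreal_enn2real_if ennreal_less_top not_le neq_top_trans top.not_eq_extremum)
  have l_nonneg: "0 \<le> l a b" for a b by (simp add: l_def)
  have l_le: "l a b \<le> 2 * M * (b - a)" if "a \<le> b" for a b
    using len_le[OF that] M that len_l[OF that] l_nonneg[of a b]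
    by (simp add: algebra_simps ennreal_le_iff mult_left_mono)
  have l_add: "l a c = l a b + l b c" if "a \<le> b" "b \<le> c" for a b c
    using curve_length_add[OF that, of P] that len_l[of a b] len_l[of b c] len_l[of a c] l_nonneg
    by (simp flip: ennreal_plus)
  have l_dist: "dist (P a) (P b) \<le> l a b" if "a \<le> b" for a b
    using dist_le_curve_length[of a a b b P] that len_l[OF that] l_nonneg by simp
  have l_shift: "l (a + 2 * pi) (b + 2 * pi) = l a b" for a b
    using curve_length_reparam[of "\<lambda>x. x + 2 * pi" "\<lambda>x. x - 2 * pi" P a b]
    by (simp add: l_def P_per)
  have l_pos: "0 < l a b" if "a < b" for a b
  proof -
    \<comment> \<open>Points less than a full turn apart are distinct, so the arc is cut to at most
      half a turn before its chord is used.\<close>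
    define c where "c = min b (a + pi)"
    have c: "a < c" "c \<le> b" "c < a + 2 * pi" using that pi_gt_zero unfolding c_def by linarith+
    have "0 < dist (P a) (P c)" using P_inj c by simp
    also have "\<dots> \<le> l a c" using c l_dist by simp
    also have "\<dots> \<le> l a b" using l_add[of a c b] c l_nonneg[of c b] by simp
    finally show ?thesis .
  qed
  \<comment> \<open>Signed length, so that the periodicity of \<open>P\<close> becomes
    \<open>s (t + 2 * pi) = s t + L\<close> for all real \<open>t\<close>.\<close>
  define s where "s t = (if 0 \<le> t then l 0 t else - l t 0)" for t
  have l00: "l 0 0 = 0" using l_add[of 0 0 0] by simp
  have s_diff: "s b - s a = l a b" if "a \<le> b" for a b
    using that l_add[of 0 a b] l_add[of a b 0] l_add[of a 0 b] by (auto simp: s_def)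
  have s_less: "s a < s b" if "a < b" for a b using s_diff[of a b] l_pos[OF that] that by simp
  define L where "L = s (2 * pi)"
  have s0: "s 0 = 0" by (simp add: s_def l00)
  have L: "L > 0" using s_less[of 0 "2 * pi"] by (simp add: L_def s0)
  have s_per: "s (t + 2 * pi) = s t + L" for t
  proof -
    have "s (t + 2 * pi) - s t = s (0 + 2 * pi) - s 0"
    proof (cases "0 \<le> t")
      case True
      then show ?thesis
        using s_diff[of 0 t] s_diff[of "0 + 2 * pi" "t + 2 * pi"] l_shift[of 0 t] by simp
    next
      case False
      then show ?thesis
        using s_diff[of t 0] s_diff[of "t + 2 * pi" "0 + 2 * pi"] l_shift[of t 0] by simp
    qed
    then show ?thesis by (simp add: L_def s0)
  qed
  have s_cont: "continuous_on UNIV s"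
  proof (rule lipschitz_on_continuous_on)
    show "(2 * M)-lipschitz_on UNIV s"
    proof (rule lipschitz_onI)
      fix x y :: real
      have *: "\<bar>s b - s a\<bar> \<le> 2 * M * (b - a)" if "a \<le> b" for a b
        using s_diff[OF that] l_le[OF that] l_nonneg[of a b] by simp
      show "dist (s x) (s y) \<le> 2 * M * dist x y"
        using *[of x y] *[of y x] by (cases x y rule: linorder_cases) (auto simp: dist_real_def abs_minus_commute)
    qed (use M in simp)
  qed
  have s_mono: "s a \<le> s b \<longleftrightarrow> a \<le> b" for a b using s_less[of a b] s_less[of b a] by fastforce
  \<comment> \<open>Subtracting a linear function from \<open>s\<close> leaves a periodic one; this
    yields the values of \<open>s\<close> at all multiples of \<open>2 * pi\<close>, and hence
    surjectivity.\<close>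
  interpret s_periodic: periodic_fun_simple "\<lambda>t. s t - L * t / (2 * pi)" "2 * pi"
    by standard (simp add: s_per distrib_left add_divide_distrib)
  have s_int: "s (of_int n * (2 * pi)) = of_int n * L" for n
    using s_periodic.plus_of_int[of 0 n] by (simp add: s0)
  have surj: "surj s"
    unfolding surj_def
  proof
    show "\<exists>x. y = s x" for y
    proof -
      define n where "n = \<lfloor>y / L\<rfloor>"
      have "s (of_int n * (2 * pi)) \<le> y" "y \<le> s (of_int (n + 1) * (2 * pi))"
        using floor_divide_lower[OF L, of y] floor_divide_upper[OF L, of y] unfolding s_int n_def
        by (auto simp: algebra_simps)
      then show ?thesis
        using IVT'[of s "of_int n * (2 * pi)" y "of_int (n + 1) * (2 * pi)"] continuous_on_subset[OF s_cont]
        by (metis (no_types, lifting) mult_right_mono of_int_le_iff zle_add1_eq_le pi_ge_zero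
          mult_nonneg_nonneg zero_le_numeral subset_UNIV less_add_one order_less_imp_le)
    qed
  qed
  define k where "k = inv s"
  have sk: "s (k y) = y" for y using surj by (simp add: k_def surj_f_inv_f)
  have ks: "k (s x) = x" for x using sk[of "s x"] s_mono by (metis order_antisym order_refl)
  have k_mono: "k x \<le> k y \<longleftrightarrow> x \<le> y" for x y using s_mono[of "k x" "k y"] sk by simp
  have k_cont: "continuous_on UNIV k"
  proof (rule continuous_onI_mono)
    have "range k = UNIV" using ks by (metis surjI)
    then show "open (range k)" by simp
  qed (simp add: k_mono)
  have k_per: "k (t + L) = k t + 2 * pi" for t
    using s_per[of "k t"] ks[of "k t + 2 * pi"] by (simp add: sk)
  have k0: "k 0 = 0" using ks[of 0] s0 by simp
  have kL: "k L = 2 * pi" using k_per[of 0] k0 by simp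
  have P_cont: "continuous_on UNIV P"
    by (rule lipschitz_on_continuous_on[of "2 * M"], rule lipschitz_onI)
       (use M P_lip in \<open>auto simp: dist_real_def\<close>)
  define \<gamma> where "\<gamma> t = P (k t)" for t
  have \<gamma>_cont: "continuous_on UNIV \<gamma>"
    unfolding \<gamma>_def using continuous_on_compose[OF k_cont continuous_on_subset[OF P_cont]]
    by (simp add: o_def)
  have \<gamma>_per: "\<gamma> (t + L) = \<gamma> t" for t by (simp add: \<gamma>_def k_per P_per)
  have bij: "bij_betw \<gamma> {0..<L} (frontier \<Omega>)"
    unfolding bij_betw_def
  proof
    have less: "\<gamma> x \<noteq> \<gamma> y" if "0 \<le> x" "x < y" "y < L" for x y
      unfolding \<gamma>_def using that k_mono[of 0 x] k_mono[of L y] k_mono[of y x]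
      by (intro P_inj) (auto simp: k0 kL)
    show "inj_on \<gamma> {0..<L}"
    proof (rule inj_onI)
      fix x y assume "x \<in> {0..<L}" "y \<in> {0..<L}" "\<gamma> x = \<gamma> y"
      then show "x = y" using less[of x y] less[of y x] by (cases x y rule: linorder_cases) auto
    qed
    show "\<gamma> ` {0..<L} = frontier \<Omega>"
    proof
      show "\<gamma> ` {0..<L} \<subseteq> frontier \<Omega>" using P_front by (auto simp: \<gamma>_def)
      show "frontier \<Omega> \<subseteq> \<gamma> ` {0..<L}"
      proof
        fix z assume "z \<in> frontier \<Omega>"
        then obtain t where t: "0 \<le> t" "t < 2 * pi" "P t = z" using P_surj by blast
        then have "0 \<le> s t" "s t < L" using s_mono[of 0 t] s_less[of t "2 * pi"] by (auto simp: s0 L_def)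
        then show "z \<in> \<gamma> ` {0..<L}"
          using t by (intro image_eqI[of _ _ "s t"]) (auto simp: \<gamma>_def ks)
      qed
    qed
  qed
  define g where "g x = \<gamma> (L * x)" for x
  have g_path: "path g"
    unfolding path_def g_def using continuous_on_compose2[OF \<gamma>_cont, of "{0..1}" "\<lambda>x. L * x"]
    by (auto intro!: continuous_intros)
  have g_img: "path_image g \<inter> interior \<Omega> = {}"
    using P_front frontier_not_int by (auto simp: path_image_def g_def \<gamma>_def)
  have g_loop: "pathfinish g = pathstart g"
    using \<gamma>_per[of 0] by (simp add: pathfinish_def pathstart_def g_def)
  have wn: "winding_number g p = 1"
  proof -
    have pg: "p \<notin> path_image g" using p g_img by auto
    obtain h where h: "path h" "pathfinish h - pathstart h = 2 * of_real pi * \<i> * winding_number g p"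
      "\<And>t. t \<in> {0..1} \<Longrightarrow> g t = p + exp (h t)"
      using winding_number_as_continuous_log[OF g_path pg] by blast
    \<comment> \<open>An explicit logarithm of \<open>g - p\<close> with total increment
      \<open>2 * pi * \<i>\<close>, to be compared with the logarithm that computes the winding
      number.\<close>
    define e where "e x = of_real (ln (\<rho> (k (L * x)))) + \<i> * of_real (k (L * x))" for x
    have \<rho>_cont: "continuous_on UNIV \<rho>"
      by (rule lipschitz_on_continuous_on[of M], rule lipschitz_onI)
         (use M lip in \<open>auto simp: dist_real_def\<close>)
    have kL_cont: "continuous_on {0..1} (\<lambda>x. k (L * x))"
      by (rule continuous_on_compose2[OF k_cont]) (auto intro!: continuous_intros)
    have "continuous_on {0..1} e"
      unfolding e_def using \<rho>
      by (intro continuous_intros kL_cont continuous_on_compose2[OF \<rho>_cont kL_cont]) (auto simp: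
        less_imp_neq[symmetric])
    moreover have "exp (h x) = exp (e x)" if "x \<in> {0..1}" for x
    proof -
      have "exp (e x) = \<rho> (k (L * x)) *\<^sub>R cis (k (L * x))"
        using \<rho>[of "k (L * x)"]
        by (simp add: e_def exp_add cis_conv_exp scaleR_conv_of_real exp_of_real)
      also have "\<dots> = g x - p" by (simp add: g_def \<gamma>_def P_def)
      finally show ?thesis using h(3)[OF that] by simp
    qed
    ultimately have "h 1 - e 1 = h 0 - e 0"
      using h(1) by (intro continuous_logs_increment[of "{0..1}"]) (auto simp: path_def)
    then have "h 1 - h 0 = e 1 - e 0" by (simp add: algebra_simps)
    also have "\<dots> = 2 * of_real pi * \<i>"
      using \<rho>_per[of 0] by (simp add: e_def k0 kL)
    finally show ?thesis using h(2) by (simp add: pathfinish_def pathstart_def)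
  qed
  have wn_int: "winding_number g z = 1" if "z \<in> interior \<Omega>" for z
    using winding_number_eq[OF g_path g_loop that p] convex_connected[OF convex_interior[OF convex]] g_img wn
    by (auto simp: Int_commute)
  have len: "curve_length \<gamma> a b = ennreal (b - a)" if "a \<le> b" for a b
    using curve_length_reparam[of k s P a b] len_l[of "k a" "k b"] s_diff[of "k a" "k b"] that s_mono
    unfolding \<gamma>_def[symmetric] by (simp add: k_mono ks sk)
  have "arclength_param \<Omega> L \<gamma>"
    unfolding arclength_param_def using L \<gamma>_cont \<gamma>_per bij wn_int len by (auto simp: g_def[abs_def])
  then show ?thesis by blast
qed

end

section \<open>Turning of the boundary around an interior point\<close>

lemma cross_exp: "cross (exp a) (exp b) = norm (exp a) * norm (exp b) * sin (Im b - Im a)"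
  by (simp add: cross_expand Re_exp Im_exp sin_diff algebra_simps)

lemma cross_cnj: "cross (cnj a) (cnj b) = - cross a b"
  by (simp add: cross_expand)

text \<open>An arbitrary arclength parametrization is treated here; \<open>bdy \<Omega>\<close>, a
  choice among them, is an instance later.\<close>

locale convex_curve = convex_body +
  fixes L :: real and \<gamma> :: "real \<Rightarrow> complex"
  assumes param: "arclength_param \<Omega> L \<gamma>"
    and interior: "interior \<Omega> \<noteq> {}"
begin

lemma L_pos: "L > 0" and \<gamma>_cont: "continuous_on UNIV \<gamma>" and \<gamma>_per: "\<gamma> (t + L) = \<gamma> t"
  and \<gamma>_bij: "bij_betw \<gamma> {0..<L} (frontier \<Omega>)"
  and \<gamma>_winding: "z \<in> interior \<Omega> \<Longrightarrow> winding_number (\<lambda>x. \<gamma>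
    (L * x)) z = 1"
  and \<gamma>_length: "0 \<le> a \<Longrightarrow> a \<le> b \<Longrightarrow> b \<le> L
    \<Longrightarrow> curve_length \<gamma> a b = ennreal (b - a)"
  using param unfolding arclength_param_def by auto

sublocale periodic: periodic_fun_simple \<gamma> L
  by standard (rule \<gamma>_per)

lemma reduce_time: obtains n :: int where "0 \<le> t - of_int n * L" "t - of_int n * L < L"
  using floor_divide_lower[OF L_pos, of t] floor_divide_upper[OF L_pos, of t]
  by (intro that[of "\<lfloor>t / L\<rfloor>"]) (auto simp: algebra_simps)

lemma \<gamma>_front: "\<gamma> t \<in> frontier \<Omega>"
proof -
  obtain n where "0 \<le> t - of_int n * L" "t - of_int n * L < L" by (rule reduce_time)
  then have "\<gamma> (t - of_int n * L) \<in> frontier \<Omega>" using \<gamma>_bij by (auto simp: bij_betw_def)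
  then show ?thesis by (simp add: periodic.minus_of_int)
qed

lemma \<gamma>_in: "\<gamma> t \<in> \<Omega>" and \<gamma>_not_int: "\<gamma> t \<notin> interior \<Omega>"
  using \<gamma>_front frontier_in frontier_not_int by auto

lemma \<gamma>_eqD:
  assumes "\<gamma> s = \<gamma> t" obtains n :: int where "s = t + of_int n * L"
proof -
  obtain n where n: "0 \<le> s - of_int n * L" "s - of_int n * L < L" by (rule reduce_time)
  obtain m where m: "0 \<le> t - of_int m * L" "t - of_int m * L < L" by (rule reduce_time)
  have "\<gamma> (s - of_int n * L) = \<gamma> (t - of_int m * L)" using assms by (simp add: periodic.minus_of_int)
  then have "s - of_int n * L = t - of_int m * L"
    using n m \<gamma>_bij by (auto simp: bij_betw_def inj_on_def)
  then show ?thesis using that[of "n - m"] by (simp add: algebra_simps)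
qed

lemma chord_le:
  assumes "0 \<le> a" "a \<le> b" "b \<le> L" shows "dist (\<gamma> a) (\<gamma> b) \<le> b - a"
  using dist_le_curve_length[of a a b b \<gamma>] \<gamma>_length[OF assms] assms by simp

lemma arc_le:
  assumes "0 \<le> a" "a \<le> b" "b \<le> L"
    and X: "\<And>s u. a \<le> s \<Longrightarrow> s \<le> u \<Longrightarrow> u \<le> b
      \<Longrightarrow> dist (\<gamma> s) (\<gamma> u) \<le> X u - X s"
  shows "b - a \<le> X b - X a"
proof -
  have "0 \<le> X b - X a" using X[of a b] assms zero_le_dist[of "\<gamma> a" "\<gamma> b"] by linarith
  moreover have "curve_length \<gamma> a b \<le> ennreal (X b - X a)"
    using assms(2) X by (rule curve_length_le_dominating)
  ultimately show ?thesis using \<gamma>_length[OF assms(1-3)] by simp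
qed

text \<open>\<open>\<phi>\<close> is the imaginary part of a continuous logarithm of
  \<open>\<gamma> - p\<close>. A ray from \<open>p\<close> meets the boundary once, which makes
  \<open>\<phi>\<close> injective; winding number 1 makes it gain \<open>2 * pi\<close> per period,
  so it increases rather than decreases.\<close>

lemma angle_lift:
  assumes p: "p \<in> interior \<Omega>"
  obtains \<phi> where "continuous_on UNIV \<phi>" "strict_mono \<phi>"
    "\<And>s t. \<phi> s < \<phi> t \<Longrightarrow> \<phi> t < \<phi> s + pi \<Longrightarrow> cross
      (\<gamma> s - p) (\<gamma> t - p) > 0"
proof -
  have nz: "\<gamma> t - p \<noteq> 0" for t using p \<gamma>_not_int by auto
  obtain g where g: "continuous_on UNIV g" "\<And>t. \<gamma> t - p = exp (g t)"
  proof (rule continuous_logarithm_on_contractible)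
    show "continuous_on UNIV (\<lambda>t. \<gamma> t - p)" by (intro continuous_intros \<gamma>_cont)
    show "contractible (UNIV :: real set)" by (rule convex_imp_contractible[OF convex_UNIV])
  qed (use nz in auto)
  have g_shift: "continuous_on S (\<lambda>t. g (a * t + c))" for a c S
    by (rule continuous_on_compose2[OF g(1)]) (auto intro!: continuous_intros)
  have turn: "g L - g 0 = 2 * of_real pi * \<i>"
  proof -
    define c where "c x = \<gamma> (L * x)" for x
    have "path c"
      unfolding path_def c_def by (rule continuous_on_compose2[OF \<gamma>_cont]) (auto intro!: continuous_intros)
    moreover have "p \<notin> path_image c" using nz by (auto simp: path_image_def c_def)
    ultimately obtain h where h: "path h" "pathfinish h - pathstart h = 2 * of_real pi * \<i> * winding_number c p"
      "\<And>t. t \<in> {0..1} \<Longrightarrow> c t = p + exp (h t)"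
      using winding_number_as_continuous_log by blast
    have "h 1 - g (L * 1 + 0) = h 0 - g (L * 0 + 0)"
    proof (rule continuous_logs_increment[of "{0..1}"])
      show "exp (h x) = exp (g (L * x + 0))" if "x \<in> {0..1}" for x
        using h(3)[OF that] g(2)[of "L * x"] by (simp add: c_def algebra_simps)
    qed (use h(1) g_shift[of "{0..1}" L 0] in \<open>auto simp: path_def\<close>)
    moreover have "winding_number c p = 1" using \<gamma>_winding[OF p] by (simp add: c_def[abs_def])
    ultimately show ?thesis using h(2) by (simp add: pathfinish_def pathstart_def algebra_simps)
  qed
  have g_per: "g (t + L) = g t + 2 * of_real pi * \<i>" for t
  proof -
    have "g (1 * t + L) - g (1 * t + 0) = g (1 * 0 + L) - g (1 * 0 + 0)"
      by (rule continuous_logs_increment[of UNIV, OF _ g_shift g_shift]) (simp_all add: \<gamma>_per flip: g(2))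
    then show ?thesis using turn by (simp add: algebra_simps)
  qed
  define \<phi> where "\<phi> t = Im (g t)" for t
  have \<phi>_cont: "continuous_on UNIV \<phi>" unfolding \<phi>_def by (intro continuous_intros g)
  have \<phi>_per: "\<phi> (t + L) = \<phi> t + 2 * pi" for t by (simp add: \<phi>_def g_per)
  interpret \<phi>p: periodic_fun_simple "\<lambda>t. \<phi> t - 2 * pi * t / L" L
    using L_pos by unfold_locales (simp add: \<phi>_per distrib_left add_divide_distrib)
  have \<phi>_int: "\<phi> (t + of_int n * L) = \<phi> t + 2 * pi * of_int n" for t n
    using \<phi>p.plus_of_int[of t n] L_pos by (simp add: distrib_left add_divide_distrib)
  have inj: "inj \<phi>"
  proof (rule injI)
    fix s t assume st: "\<phi> s = \<phi> t"
    have "sgn (\<gamma> r - p) = cis (\<phi> r)" for r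
    proof -
      have "\<gamma> r - p = exp (Re (g r)) *\<^sub>R cis (\<phi> r)"
        by (simp add: g(2) \<phi>_def exp_eq_polar scaleR_conv_of_real)
      then show ?thesis by (simp add: sgn_scaled_cis)
    qed
    then have "\<gamma> s = \<gamma> t" using st by (intro frontier_eqI[OF p \<gamma>_front \<gamma>_front]) simp
    \<comment> \<open>Equal boundary points have times that differ by whole periods, and
      \<open>\<phi>\<close> tells the periods apart.\<close>
    then obtain n where "s = t + of_int n * L" by (rule \<gamma>_eqD)
    then show "s = t" using st \<phi>_int[of t n] by simp
  qed
  have less: "\<phi> s < \<phi> t" if "s < t" for s t
  proof -
    obtain n where "0 \<le> t - s - of_int n * L" "t - s - of_int n * L < L" by (rule reduce_time)
    then have n: "t < s + of_int (n + 1) * L" by (simp add: algebra_simps)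
    then have "0 < of_int (n + 1) * L" using that by linarith
    then have n0: "0 < real_of_int (n + 1)" using L_pos by (simp add: zero_less_mult_iff)
    have "\<phi> s < \<phi> t \<and> \<phi> t < \<phi> (s + of_int (n + 1) * L) \<or> \<phi> (s + of_int
      (n + 1) * L) < \<phi> t \<and> \<phi> t < \<phi> s"
      by (rule continuous_inj_imp_mono[OF that n])
         (use continuous_on_subset[OF \<phi>_cont] inj in \<open>auto intro: inj_on_subset\<close>)
    moreover have "\<phi> s < \<phi> (s + of_int (n + 1) * L)" unfolding \<phi>_int using n0 by simp
    ultimately show ?thesis by linarith
  qed
  have "cross (\<gamma> s - p) (\<gamma> t - p) > 0" if "\<phi> s < \<phi> t" "\<phi> t < \<phi> s + pi" for s t
    unfolding g(2) cross_exp using that by (intro mult_pos_pos sin_gt_zero) (auto simp: \<phi>_def)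
  then show ?thesis using that \<phi>_cont less by (auto simp: strict_mono_def)
qed

text \<open>As long as \<open>\<phi>\<close> stays within \<open>pi / 2\<close> of
  \<open>\<phi> t\<close>, any two of its values differ by less than \<open>pi\<close>.\<close>

lemma turning_window:
  assumes p: "p \<in> interior \<Omega>"
  obtains \<delta> where "\<delta> > 0"
    "\<And>s r. t - \<delta> < s \<Longrightarrow> s < r \<Longrightarrow> r < t + \<delta>
      \<Longrightarrow> cross (\<gamma> s - p) (\<gamma> r - p) > 0"
proof -
  obtain \<phi> where \<phi>: "continuous_on UNIV \<phi>" "strict_mono \<phi>"
    "\<And>s t. \<phi> s < \<phi> t \<Longrightarrow> \<phi> t < \<phi> s + pi \<Longrightarrow> cross
      (\<gamma> s - p) (\<gamma> t - p) > 0"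
    using angle_lift[OF p] by blast
  have "\<exists>\<delta>>0. \<forall>s. dist s t < \<delta> \<longrightarrow> dist (\<phi> s) (\<phi> t) < pi / 2"
    using \<phi>(1) pi_half_gt_zero unfolding continuous_on_iff by blast
  then obtain \<delta> where \<delta>: "\<delta> > 0" "\<And>s. dist s t < \<delta> \<Longrightarrow>
    dist (\<phi> s) (\<phi> t) < pi / 2" by blast
  show ?thesis
  proof (rule that[OF \<delta>(1)])
    fix s r assume *: "t - \<delta> < s" "s < r" "r < t + \<delta>"
    have "\<phi> s < \<phi> r" using \<phi>(2) * by (auto simp: strict_mono_def)
    moreover have "dist (\<phi> s) (\<phi> t) < pi / 2" "dist (\<phi> r) (\<phi> t) < pi / 2"
      using \<delta>(2)[of s] \<delta>(2)[of r] * by (auto simp: dist_real_def)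
    then have "\<phi> r < \<phi> s + pi" by (simp add: dist_real_def abs_if split: if_splits)
    ultimately show "cross (\<gamma> s - p) (\<gamma> r - p) > 0" by (rule \<phi>(3))
  qed
qed

lemma right_tangent_exists:
  obtains \<tau> where "norm \<tau> = 1" "((\<lambda>u. (\<gamma> u - \<gamma> t) /\<^sub>R (u - t))
    \<longlongrightarrow> \<tau>) (at_right t)"
    "\<And>z. z \<in> \<Omega> \<Longrightarrow> cross \<tau> (z - \<gamma> t) \<ge> 0"
proof -
  obtain p where p: "p \<in> interior \<Omega>" using interior by blast
  obtain \<delta> where \<delta>: "\<delta> > 0"
    "\<And>s r. t - \<delta> < s \<Longrightarrow> s < r \<Longrightarrow> r < t + \<delta>
      \<Longrightarrow> cross (\<gamma> s - p) (\<gamma> r - p) > 0"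
    using turning_window[OF p] by blast
  obtain n where n: "0 \<le> t - of_int n * L" "t - of_int n * L < L" by (rule reduce_time)
  \<comment> \<open>The window is cut at the end of the period that contains \<open>t\<close>,
    because arc lengths are given within one period only.\<close>
  interpret local_boundary \<Omega> p \<gamma> "t - \<delta>" t "min (t + \<delta>) (of_int n * L + L)"
  proof
    show "continuous_on {t - \<delta><..<min (t + \<delta>) (of_int n * L + L)} \<gamma>"
      using continuous_on_subset[OF \<gamma>_cont] by blast
    fix u assume u: "t \<le> u" "u < min (t + \<delta>) (of_int n * L + L)"
    show "dist (\<gamma> t) (\<gamma> u) \<le> u - t"
      using chord_le[of "t - of_int n * L" "u - of_int n * L"] u n by (simp add: periodic.minus_of_int)
    fix X :: "real \<Rightarrow> real"
    assume X: "\<And>s r. t \<le> s \<Longrightarrow> s \<le> r \<Longrightarrow> r \<le> u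
      \<Longrightarrow> dist (\<gamma> s) (\<gamma> r) \<le> X r - X s"
    have "(u - of_int n * L) - (t - of_int n * L) \<le>
        X ((u - of_int n * L) + of_int n * L) - X ((t - of_int n * L) + of_int n * L)"
    proof (rule arc_le)
      fix s r assume sr: "t - of_int n * L \<le> s" "s \<le> r" "r \<le> u - of_int n * L"
      show "dist (\<gamma> s) (\<gamma> r) \<le> X (r + of_int n * L) - X (s + of_int n * L)"
        using X[of "s + of_int n * L" "r + of_int n * L"] sr by (simp add: periodic.plus_of_int)
    qed (use u n in auto)
    then show "u - t \<le> X u - X t" by simp
  qed (use convex p \<delta> n \<gamma>_in \<gamma>_not_int in auto)
  show ?thesis
    using that norm_tangent tendsto_tangent tangent_supports by blast
qed

text \<open>Reversing time and conjugating each flip the orientation, so together they turn left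
  tangents into right tangents of the reflected body.\<close>

lemma left_tangent_exists:
  obtains \<tau> where "norm \<tau> = 1" "((\<lambda>u. (\<gamma> u - \<gamma> t) /\<^sub>R (u - t))
    \<longlongrightarrow> \<tau>) (at_left t)"
    "\<And>z. z \<in> \<Omega> \<Longrightarrow> cross \<tau> (z - \<gamma> t) \<ge> 0"
proof -
  obtain p where p: "p \<in> interior \<Omega>" using interior by blast
  obtain \<delta> where \<delta>: "\<delta> > 0"
    "\<And>s r. t - \<delta> < s \<Longrightarrow> s < r \<Longrightarrow> r < t + \<delta>
      \<Longrightarrow> cross (\<gamma> s - p) (\<gamma> r - p) > 0"
    using turning_window[OF p] by blast
  obtain n' where n': "0 \<le> - t - of_int n' * L" "- t - of_int n' * L < L" by (rule reduce_time)
  \<comment> \<open>Shifted so that \<open>t - of_int n * L\<close> is positive and at most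
    \<open>L\<close>: the window to the left of \<open>t\<close> must stay inside one
    period.\<close>
  define n where "n = - n' - 1"
  have n: "0 < t - of_int n * L" "t - of_int n * L \<le> L" using n' by (auto simp: n_def algebra_simps)
  have lin: "linear cnj" by (simp add: bounded_linear.linear bounded_linear_cnj)
  have int: "interior (cnj ` \<Omega>) = cnj ` interior \<Omega>"
    by (rule interior_injective_linear_image[OF lin]) (simp add: inj_def)
  interpret R: local_boundary "cnj ` \<Omega>" "cnj p" "\<lambda>u. cnj (\<gamma> (- u))" "- t -
    \<delta>" "- t" "min (- t + \<delta>) (- (of_int n * L))"
  proof
    show "convex (cnj ` \<Omega>)" using convex_linear_image[OF lin convex] .
    show "cnj p \<in> interior (cnj ` \<Omega>)" using p int by auto
    show "continuous_on {- t - \<delta><..<min (- t + \<delta>) (- (of_int n * L))} (\<lambda>u. cnj (\<gamma> (- u)))"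
      by (intro continuous_intros continuous_on_compose2[OF \<gamma>_cont]) auto
    show "cnj (\<gamma> (- u)) \<in> cnj ` \<Omega>" "cnj (\<gamma> (- u)) \<notin> interior (cnj ` \<Omega>)" for u
      unfolding int using \<gamma>_in \<gamma>_not_int by auto
    show "0 < cross (cnj (\<gamma> (- s)) - cnj p) (cnj (\<gamma> (- r)) - cnj p)"
      if "- t - \<delta> < s" "s < r" "r < min (- t + \<delta>) (- (of_int n * L))" for s r
      using \<delta>(2)[of "- r" "- s"] that
      unfolding complex_cnj_diff[symmetric] cross_cnj cross_commute[of "\<gamma> (- s) - p"] by auto
    fix u assume u: "- t \<le> u" "u < min (- t + \<delta>) (- (of_int n * L))"
    show "dist (cnj (\<gamma> (- (- t)))) (cnj (\<gamma> (- u))) \<le> u - - t"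
      using chord_le[of "- u - of_int n * L" "t - of_int n * L"] u n
      by (simp add: periodic.minus_of_int dist_norm norm_minus_commute flip: complex_cnj_diff)
    fix X :: "real \<Rightarrow> real"
    assume X: "\<And>s r. - t \<le> s \<Longrightarrow> s \<le> r \<Longrightarrow> r \<le> u
      \<Longrightarrow> dist (cnj (\<gamma> (- s))) (cnj (\<gamma> (- r))) \<le> X r - X s"
    have "(t - of_int n * L) - (- u - of_int n * L) \<le>
        - X (- ((t - of_int n * L) + of_int n * L)) - - X (- ((- u - of_int n * L) + of_int n * L))"
    proof (rule arc_le[of _ _ "\<lambda>x. - X (- (x + of_int n * L))"])
      fix s r assume sr: "- u - of_int n * L \<le> s" "s \<le> r" "r \<le> t - of_int n * L"
      show "dist (\<gamma> s) (\<gamma> r) \<le> - X (- (r + of_int n * L)) - - X (- (s + of_int n * L))"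
        using X[of "- (r + of_int n * L)" "- (s + of_int n * L)"] sr
        by (simp only: minus_minus periodic.plus_of_int dist_norm complex_mod_cnj complex_cnj_diff[symmetric])
           (simp add: norm_minus_commute)
    qed (use u n in auto)
    then show "u - - t \<le> X u - X (- t)" by simp
  qed (use \<delta> n in auto)
  show ?thesis
  proof (rule that[of "- cnj R.\<tau>"])
    show "norm (- cnj R.\<tau>) = 1" using R.norm_tangent by simp
    have "((\<lambda>u. - cnj ((cnj (\<gamma> (- (- u))) - cnj (\<gamma> (- (- t)))) /\<^sub>R (- u - -
      t))) \<longlongrightarrow> - cnj R.\<tau>) (at_left t)"
      by (intro tendsto_intros filterlim_compose[OF R.tendsto_tangent])
         (simp add: at_left_minus filterlim_filtermap filterlim_ident)
    moreover have "- cnj ((cnj (\<gamma> (- (- u))) - cnj (\<gamma> (- (- t)))) /\<^sub>R (- u - - t)) =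
      (\<gamma> u - \<gamma> t) /\<^sub>R (u - t)" for u
    proof -
      have "inverse (- u - - t) = - inverse (u - t)"
        by (metis inverse_minus_eq minus_diff_eq minus_diff_minus)
      then show ?thesis by (simp add: complex_eq_iff)
    qed
    ultimately show "((\<lambda>u. (\<gamma> u - \<gamma> t) /\<^sub>R (u - t)) \<longlongrightarrow> -
      cnj R.\<tau>) (at_left t)" by simp
    fix z assume "z \<in> \<Omega>"
    then have "0 \<le> cross R.\<tau> (cnj z - cnj (\<gamma> (- (- t))))" by (intro R.tangent_supports) auto
    also have "\<dots> = cross (- cnj R.\<tau>) (z - \<gamma> t)" by (simp add: cross_expand algebra_simps)
    finally show "0 \<le> cross (- cnj R.\<tau>) (z - \<gamma> t)" .
  qed
qed

end

section \<open>One-sided derivatives and integration\<close>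

lemma has_vector_derivative_right_iff:
  fixes f :: "real \<Rightarrow> complex"
  shows "(f has_vector_derivative D) (at t within {t..}) \<longleftrightarrow>
    ((\<lambda>u. (f u - f t) /\<^sub>R (u - t)) \<longlongrightarrow> D) (at_right t)"
proof -
  have 1: "at t within {t..} = at_right t" by (rule at_within_Ici_at_right)
  have "(f has_vector_derivative D) (at t within {t..}) \<longleftrightarrow>
     ((\<lambda>u. norm ((f u - f t) - (u - t) *\<^sub>R D) / norm (u - t)) \<longlongrightarrow> 0) (at_right t)"
    unfolding has_vector_derivative_def has_derivative_iff_norm 1
    by (simp add: bounded_linear_scaleR_left)
  also have "\<dots> \<longleftrightarrow> ((\<lambda>u. norm ((f u - f t) /\<^sub>R (u - t) - D))
    \<longlongrightarrow> 0) (at_right t)"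
  proof (rule filterlim_cong[OF refl refl])
    show "\<forall>\<^sub>F u in at_right t. norm ((f u - f t) - (u - t) *\<^sub>R D) / norm (u - t) =
      norm ((f u - f t) /\<^sub>R (u - t) - D)"
      using eventually_at_right_less
    proof eventually_elim
      case (elim u)
      then have "(f u - f t) /\<^sub>R (u - t) - D = ((f u - f t) - (u - t) *\<^sub>R D) /\<^sub>R (u - t)"
        by (simp add: scaleR_diff_right)
      then show ?case using elim by (simp add: divide_inverse_commute)
    qed
  qed
  also have "\<dots> \<longleftrightarrow> ((\<lambda>u. (f u - f t) /\<^sub>R (u - t))
    \<longlongrightarrow> D) (at_right t)"
    by (simp add: LIM_zero_iff tendsto_norm_zero_iff)
  finally show ?thesis .
qed

text \<open>The difference quotients converge boundedly to the right derivative, and their integrals are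
  differences of averages of \<open>F\<close> over short intervals at the end points.\<close>

lemma integral_right_derivative:
  fixes F D :: "real \<Rightarrow> complex"
  assumes ab: "a \<le> b" and h0: "h0 > 0"
    and lip: "\<And>s t. a \<le> s \<Longrightarrow> s \<le> t \<Longrightarrow> t \<le> b
      \<Longrightarrow> t < s + h0 \<Longrightarrow> norm (F t - F s) \<le> K * (t - s)"
    and der: "\<And>t. a \<le> t \<Longrightarrow> t < b \<Longrightarrow> (F has_vector_derivative D t)
      (at t within {t..})"
    and meas: "D \<in> borel_measurable borel"
  shows "set_integrable lborel {a..b} D" "(LINT t:{a..b}|lborel. D t) = F b - F a"
proof -
  \<comment> \<open>Clamping the time extends \<open>F\<close> by constants, so that steps beyond
    \<open>b\<close> still obey the Lipschitz bound. The bound concerns steps below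
    \<open>h0\<close> only, which is what a branch of the logarithm can offer.\<close>
  define c where "c t = max a (min b t)" for t
  have c: "a \<le> c t" "c t \<le> b" "c t \<in> {a..b}" for t using ab by (auto simp: c_def)
  define K' where "K' = max K 0"
  have K': "K' \<ge> 0" "K \<le> K'" by (auto simp: K'_def)
  define G where "G t = F (c t)" for t
  have G_lip: "norm (G (t + h) - G t) \<le> K' * h" if "0 \<le> h" "h < h0" for t h
  proof -
    have "c t \<le> c (t + h)" "c (t + h) - c t \<le> h" using that by (auto simp: c_def)
    then have "norm (G (t + h) - G t) \<le> K * (c (t + h) - c t)"
      unfolding G_def using c that by (intro lip) auto
    also have "\<dots> \<le> K' * h" using \<open>c t \<le> c (t + h)\<close> \<open>c (t + h) - c t
      \<le> h\<close> K' by (intro mult_mono) auto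
    finally show ?thesis .
  qed
  have G_cont: "continuous_on UNIV G"
  proof (rule continuous_at_imp_continuous_on, rule ballI, unfold continuous_at_eps_delta, intro allI impI)
    fix t e :: real assume e: "0 < e"
    define d where "d = min h0 (e / (K' + 1))"
    have d: "d > 0" "d \<le> h0" "d \<le> e / (K' + 1)" using h0 e K' by (auto simp: d_def)
    have "K' * d \<le> K' * (e / (K' + 1))" using d K' by (intro mult_left_mono) auto
    also have "\<dots> < e" using e K' by (simp add: field_simps)
    finally have Kd: "K' * d < e" .
    have "dist (G s) (G t) < e" if "dist s t < d" for s
    proof -
      have "norm (G (max s t) - G (min s t)) \<le> K' * \<bar>s - t\<bar>"
        using G_lip[of "\<bar>s - t\<bar>" "min s t"] that d by (auto simp: dist_real_def max_def min_def
          abs_if split: if_splits)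
      also have "\<dots> \<le> K' * d" using that K' by (intro mult_left_mono) (auto simp: dist_real_def)
      finally show ?thesis using Kd by (auto simp: dist_norm max_def min_def norm_minus_commute split: if_splits)
    qed
    then show "\<exists>d>0. \<forall>s. dist s t < d \<longrightarrow> dist (G s) (G t) < e" using d by blast
  qed
  \<comment> \<open>The margin beyond \<open>b\<close> accommodates \<open>t + h n\<close>, as
    \<open>h n\<close> is at most 1.\<close>
  obtain \<Psi> where \<Psi>': "\<And>x. x \<in> {a - 1..b + 2} \<Longrightarrow> (\<Psi>
    has_vector_derivative G x) (at x within {a - 1..b + 2})"
    using antiderivative_continuous[OF continuous_on_subset[OF G_cont], of "a - 1" "b + 2"] by auto
  have \<Psi>: "(\<Psi> has_vector_derivative G x) (at x)" if "a - 1 < x" "x < b + 2" for x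
  proof -
    have "at x within {a - 1..b + 2} = at x" using that by (intro at_within_interior) auto
    then show ?thesis using \<Psi>'[of x] that by simp
  qed
  define m where "m = min 1 (h0 / 2)"
  have m: "0 < m" "m \<le> 1" "m < h0" using h0 by (auto simp: m_def)
  define h where "h n = m * inverse (real (Suc n))" for n
  have h: "0 < h n" "h n \<le> 1" "h n < h0" for n
  proof -
    show "0 < h n" using m by (simp add: h_def)
    have "inverse (real (Suc n)) \<le> 1" by (simp add: inverse_le_1_iff)
    then have "h n \<le> m" using m mult_left_mono[of "inverse (real (Suc n))" 1 m] by (simp add: h_def)
    then show "h n \<le> 1" "h n < h0" using m by auto
  qed
  have h_lim: "h \<longlonglongrightarrow> 0"
    unfolding h_def[abs_def] by (rule tendsto_mult_right_zero[OF LIMSEQ_inverse_real_of_nat])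
  have h_right: "filterlim h (at_right 0) sequentially"
    unfolding filterlim_at
  proof
    have "h n \<in> {0<..} \<and> h n \<noteq> 0" for n using h(1)[of n] by simp
    then show "\<forall>\<^sub>F n in sequentially. h n \<in> {0<..} \<and> h n \<noteq> 0" by (intro
      always_eventually) blast
  qed (rule h_lim)
  define f where "f n t = (G (t + h n) - G t) /\<^sub>R h n" for n t
  have f_cont: "continuous_on S (f n)" for S n
    unfolding f_def using h[of n]
    by (intro continuous_intros continuous_on_compose2[OF G_cont]) auto
  have shift_der: "((\<lambda>t. \<Psi> (t + c)) has_vector_derivative G (t + c)) (at t within S)" if "a
    - 1 < t + c" "t + c < b + 2" for t c S
  proof -
    have "((\<lambda>t. \<Psi> (t + c)) has_vector_derivative G (t + c)) (at t)"
      using \<Psi>[OF that] vector_diff_chain_at[of "\<lambda>t. t + c" 1 t \<Psi> "G (t + c)"]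
      by (simp add: o_def has_vector_derivative_add_const has_vector_derivative_id)
    then show ?thesis by (rule has_vector_derivative_at_within)
  qed
  have f_int: "(LINT t:{a..b}|lborel. f n t) = (\<Psi> (b + h n) - \<Psi> b) /\<^sub>R h n - (\<Psi> (a +
    h n) - \<Psi> a) /\<^sub>R h n" for n
    unfolding set_lebesgue_integral_def
  proof (rule integral_FTC_Icc[OF ab, of "\<lambda>t. (\<Psi> (t + h n) - \<Psi> t) /\<^sub>R h n" "f n", THEN trans])
    fix x assume x: "a \<le> x" "x \<le> b"
    show "((\<lambda>t. (\<Psi> (t + h n) - \<Psi> t) /\<^sub>R h n) has_vector_derivative f n x) (at x within {a..b})"
      unfolding f_def using h[of n] x shift_der[of x "h n"] shift_der[of x 0]
      by (auto intro!: derivative_eq_intros)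
  qed (auto intro: f_cont)
  have end_lim: "(\<lambda>n. (\<Psi> (x + h n) - \<Psi> x) /\<^sub>R h n) \<longlonglongrightarrow> G x"
    if "a \<le> x" "x \<le> b" for x
  proof -
    have "(\<Psi> has_vector_derivative G x) (at x within {x..})"
      by (rule has_vector_derivative_at_within, rule \<Psi>) (use that in auto)
    then have "((\<lambda>u. (\<Psi> u - \<Psi> x) /\<^sub>R (u - x)) \<longlongrightarrow> G x) (at_right x)"
      by (simp add: has_vector_derivative_right_iff)
    then have "((\<lambda>u. (\<Psi> (u + x) - \<Psi> x) /\<^sub>R u) \<longlongrightarrow> G x) (at_right 0)"
      unfolding at_right_to_0[of x] filterlim_filtermap by simp
    from filterlim_compose[OF this h_right] show ?thesis by (simp add: add.commute)
  qed
  have lim1: "(\<lambda>n. LINT t:{a..b}|lborel. f n t) \<longlonglongrightarrow> G b - G a"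
    unfolding f_int using ab by (intro tendsto_diff end_lim) auto
  have f_lim: "(\<lambda>n. f n t) \<longlonglongrightarrow> D t" if t: "a \<le> t" "t < b" for t
  proof -
    have "((\<lambda>u. (F u - F t) /\<^sub>R (u - t)) \<longlongrightarrow> D t) (at_right t)"
      using der[OF t] by (simp add: has_vector_derivative_right_iff)
    then have "((\<lambda>u. (F (u + t) - F t) /\<^sub>R u) \<longlongrightarrow> D t) (at_right 0)"
      unfolding at_right_to_0[of t] filterlim_filtermap by simp
    from filterlim_compose[OF this h_right]
    have "(\<lambda>n. (F (h n + t) - F t) /\<^sub>R h n) \<longlonglongrightarrow> D t" .
    moreover have "\<forall>\<^sub>F n in sequentially. (F (h n + t) - F t) /\<^sub>R h n = f n t"
    proof -
      have "\<forall>\<^sub>F n in sequentially. h n < b - t" using h_lim t by (intro order_tendstoD) auto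
      then show ?thesis
      proof eventually_elim
        case (elim n)
        then have "c (t + h n) = t + h n" "c t = t" using t h[of n] by (auto simp: c_def)
        then show ?case by (simp add: f_def G_def add.commute)
      qed
    qed
    ultimately show ?thesis by (rule Lim_transform_eventually)
  qed
  have dom: "AE t in lborel. (\<lambda>n. indicator {a..b} t *\<^sub>R f n t) \<longlonglongrightarrow>
    indicator {a..b} t *\<^sub>R D t"
  proof -
    \<comment> \<open>At \<open>b\<close> the clamped function is constant to the right, so its
      quotients say nothing about \<open>D b\<close>; that point is null.\<close>
    have "AE t in lborel. t \<noteq> b" by (rule AE_lborel_singleton)
    then show ?thesis by eventually_elim (auto simp: indicator_def intro: f_lim)
  qed
  have bound: "norm (indicator {a..b} t *\<^sub>R f n t) \<le> K' * indicator {a..b} t" for n t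
  proof -
    have "norm (f n t) \<le> K'"
      using G_lip[of "h n" t] h[of n] by (simp add: f_def pos_divide_le_eq inverse_eq_divide mult.commute)
    then show ?thesis using K' by (simp add: indicator_def)
  qed
  have int: "integrable lborel (\<lambda>t. K' * indicator {a..b} t :: real)"
    by (intro integrable_mult_right integrable_real_indicator) (auto simp: emeasure_lborel_Icc_eq)
  have mf: "(\<lambda>t. indicator {a..b} t *\<^sub>R f n t) \<in> borel_measurable lborel" for n
    using borel_measurable_continuous_onI[OF f_cont[of UNIV n]] by measurable
  have mD: "(\<lambda>t. indicator {a..b} t *\<^sub>R D t) \<in> borel_measurable lborel" using meas by measurable
  show "set_integrable lborel {a..b} D"
    unfolding set_integrable_def
    by (rule integrable_dominated_convergence[OF mD mf int dom AE_I2]) (rule bound)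
  have "(\<lambda>n. LINT t:{a..b}|lborel. f n t) \<longlonglongrightarrow> (LINT t:{a..b}|lborel. D t)"
    unfolding set_lebesgue_integral_def
    by (rule integral_dominated_convergence[OF mD mf int dom AE_I2]) (rule bound)
  then have "(LINT t:{a..b}|lborel. D t) = G b - G a" using lim1 LIMSEQ_unique by blast
  then show "(LINT t:{a..b}|lborel. D t) = F b - F a" using ab by (simp add: G_def c_def)
qed

section \<open>Tangents and corners of the boundary\<close>

context convex_curve
begin

text \<open>An arc that crosses the end of a period is split there; whole periods do not change the
  distance and only increase \<open>t - s\<close>.\<close>

lemma \<gamma>_dist: assumes "s \<le> t" shows "dist (\<gamma> s) (\<gamma> t) \<le> t - s"
proof -
  have near: "dist (\<gamma> s) (\<gamma> t) \<le> t - s" if st: "s \<le> t" "t < s + L" for s t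
  proof -
    obtain n where n: "0 \<le> s - of_int n * L" "s - of_int n * L < L" by (rule reduce_time)
    show ?thesis
    proof (cases "t - of_int n * L \<le> L")
      case True
      then show ?thesis
        using chord_le[of "s - of_int n * L" "t - of_int n * L"] st n by (simp add: periodic.minus_of_int)
    next
      case False
      have "dist (\<gamma> (s - of_int n * L)) (\<gamma> L) \<le> L - (s - of_int n * L)"
        using n by (intro chord_le) auto
      moreover have "dist (\<gamma> 0) (\<gamma> (t - of_int (n + 1) * L)) \<le> (t - of_int (n + 1) * L) - 0"
        using False st n by (intro chord_le) (auto simp: algebra_simps)
      moreover have "\<gamma> L = \<gamma> 0" using \<gamma>_per[of 0] by simp
      ultimately have "dist (\<gamma> s) (\<gamma> 0) \<le> L - (s - of_int n * L)"
        "dist (\<gamma> 0) (\<gamma> t) \<le> t - of_int (n + 1) * L"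
        unfolding periodic.minus_of_int by simp_all
      moreover have "dist (\<gamma> s) (\<gamma> t) \<le> dist (\<gamma> s) (\<gamma> 0) + dist (\<gamma>
        0) (\<gamma> t)" by (rule dist_triangle)
      ultimately show ?thesis by (simp add: algebra_simps)
    qed
  qed
  obtain n where n: "0 \<le> (t - s) - of_int n * L" "(t - s) - of_int n * L < L" by (rule reduce_time)
  have "\<gamma> (t - of_int n * L) = \<gamma> t" by (rule periodic.minus_of_int)
  then have "dist (\<gamma> s) (\<gamma> t) \<le> (t - of_int n * L) - s"
    using near[of s "t - of_int n * L"] n by simp
  moreover have "0 \<le> real_of_int n"
  proof -
    have "0 < (of_int n + 1) * L" using n assms by (simp add: algebra_simps)
    then have "0 < real_of_int n + 1" using L_pos by (simp add: zero_less_mult_iff)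
    then have "0 \<le> n" by linarith
    then show ?thesis by simp
  qed
  then have "0 \<le> of_int n * L" using L_pos by simp
  ultimately show ?thesis by linarith
qed

text \<open>The existence lemma holds at every time, corners included, so this is a total function
  and can serve as an integrand.\<close>

definition "rtan t = (SOME \<tau>. norm \<tau> = 1 \<and> ((\<lambda>u. (\<gamma> u - \<gamma> t)
  /\<^sub>R (u - t)) \<longlongrightarrow> \<tau>) (at_right t) \<and>
    (\<forall>z\<in>\<Omega>. cross \<tau> (z - \<gamma> t) \<ge> 0))"

definition "ltan t = (SOME \<tau>. norm \<tau> = 1 \<and> ((\<lambda>u. (\<gamma> u - \<gamma> t)
  /\<^sub>R (u - t)) \<longlongrightarrow> \<tau>) (at_left t) \<and>
    (\<forall>z\<in>\<Omega>. cross \<tau> (z - \<gamma> t) \<ge> 0))"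

lemma rtan: "norm (rtan t) = 1" "((\<lambda>u. (\<gamma> u - \<gamma> t) /\<^sub>R (u - t))
  \<longlongrightarrow> rtan t) (at_right t)"
    "z \<in> \<Omega> \<Longrightarrow> cross (rtan t) (z - \<gamma> t) \<ge> 0"
proof -
  have "norm (rtan t) = 1 \<and> ((\<lambda>u. (\<gamma> u - \<gamma> t) /\<^sub>R (u - t))
    \<longlongrightarrow> rtan t) (at_right t) \<and>
    (\<forall>z\<in>\<Omega>. cross (rtan t) (z - \<gamma> t) \<ge> 0)"
    unfolding rtan_def by (rule someI_ex) (rule right_tangent_exists[of t], blast)
  then show "norm (rtan t) = 1" "((\<lambda>u. (\<gamma> u - \<gamma> t) /\<^sub>R (u - t))
    \<longlongrightarrow> rtan t) (at_right t)"
    "z \<in> \<Omega> \<Longrightarrow> cross (rtan t) (z - \<gamma> t) \<ge> 0" by auto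
qed

lemma ltan: "norm (ltan t) = 1" "((\<lambda>u. (\<gamma> u - \<gamma> t) /\<^sub>R (u - t))
  \<longlongrightarrow> ltan t) (at_left t)"
    "z \<in> \<Omega> \<Longrightarrow> cross (ltan t) (z - \<gamma> t) \<ge> 0"
proof -
  have "norm (ltan t) = 1 \<and> ((\<lambda>u. (\<gamma> u - \<gamma> t) /\<^sub>R (u - t))
    \<longlongrightarrow> ltan t) (at_left t) \<and>
    (\<forall>z\<in>\<Omega>. cross (ltan t) (z - \<gamma> t) \<ge> 0)"
    unfolding ltan_def by (rule someI_ex) (rule left_tangent_exists[of t], blast)
  then show "norm (ltan t) = 1" "((\<lambda>u. (\<gamma> u - \<gamma> t) /\<^sub>R (u - t))
    \<longlongrightarrow> ltan t) (at_left t)"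
    "z \<in> \<Omega> \<Longrightarrow> cross (ltan t) (z - \<gamma> t) \<ge> 0" by auto
qed

lemma rtan_nz: "rtan t \<noteq> 0" and ltan_nz: "ltan t \<noteq> 0" using rtan(1)[of t] ltan(1)[of t] by auto

lemma rtan_derivative: "(\<gamma> has_vector_derivative rtan t) (at t within {t..})"
  using rtan(2) by (simp add: has_vector_derivative_right_iff)

lemma tendsto_sgn_right: "((\<lambda>u. sgn (\<gamma> u - \<gamma> t)) \<longlongrightarrow> rtan t) (at_right t)"
proof -
  have "((\<lambda>u. sgn ((\<gamma> u - \<gamma> t) /\<^sub>R (u - t))) \<longlongrightarrow> sgn (rtan
    t)) (at_right t)"
    by (intro tendsto_sgn rtan(2) rtan_nz)
  moreover have "\<forall>\<^sub>F u in at_right t. sgn ((\<gamma> u - \<gamma> t) /\<^sub>R (u - t)) =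
    sgn (\<gamma> u - \<gamma> t)"
    using eventually_at_right_less by eventually_elim (simp add: sgn_scaleR)
  ultimately show ?thesis
    using rtan(1)[of t] by (simp add: sgn_div_norm[of "rtan t"] filterlim_cong)
qed

lemma tendsto_sgn_left: "((\<lambda>u. sgn (\<gamma> t - \<gamma> u)) \<longlongrightarrow> ltan t) (at_left t)"
proof -
  have "((\<lambda>u. sgn ((\<gamma> u - \<gamma> t) /\<^sub>R (u - t))) \<longlongrightarrow> sgn (ltan
    t)) (at_left t)"
    by (intro tendsto_sgn ltan(2) ltan_nz)
  moreover have "\<forall>\<^sub>F u in at_left t. u < t" by (simp add: eventually_at_filter)
  then have "\<forall>\<^sub>F u in at_left t. sgn ((\<gamma> u - \<gamma> t) /\<^sub>R (u - t)) = sgn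
    (\<gamma> t - \<gamma> u)"
  proof eventually_elim
    case (elim u)
    have "sgn ((\<gamma> u - \<gamma> t) /\<^sub>R (u - t)) = - sgn (\<gamma> u - \<gamma> t)" using elim
      by (simp add: sgn_scaleR)
    then show ?case by (metis minus_diff_eq sgn_minus)
  qed
  ultimately show ?thesis
    using ltan(1)[of t] by (simp add: sgn_div_norm[of "ltan t"] filterlim_cong)
qed

text \<open>A pointwise limit of continuous difference quotients.\<close>

lemma rtan_measurable: "rtan \<in> borel_measurable borel"
proof (rule borel_measurable_LIMSEQ_metric)
  fix n
  show "(\<lambda>t. (\<gamma> (t + 1 / real (Suc n)) - \<gamma> t) /\<^sub>R (1 / real (Suc n))) \<in>
    borel_measurable borel"
    by (intro borel_measurable_continuous_onI continuous_intros continuous_on_compose2[OF \<gamma>_cont]) auto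
next
  fix t
  have "filterlim (\<lambda>n. 1 / real (Suc n)) (at_right 0) sequentially"
    unfolding filterlim_at
  proof
    show "\<forall>\<^sub>F n in sequentially. 1 / real (Suc n) \<in> {0<..} \<and> 1 / real (Suc n) \<noteq> 0"
      by (intro always_eventually) simp
    show "(\<lambda>n. 1 / real (Suc n)) \<longlonglongrightarrow> 0" using LIMSEQ_inverse_real_of_nat by
      (simp add: inverse_eq_divide)
  qed
  moreover have "((\<lambda>u. (\<gamma> (t + u) - \<gamma> t) /\<^sub>R u) \<longlongrightarrow> rtan t) (at_right 0)"
    using rtan(2)[of t] unfolding at_right_to_0[of t] filterlim_filtermap by (simp add: add.commute)
  ultimately show "(\<lambda>n. (\<gamma> (t + 1 / real (Suc n)) - \<gamma> t) /\<^sub>R (1 / real (Suc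
    n))) \<longlonglongrightarrow> rtan t"
    by (rule filterlim_compose[rotated])
qed

lemma rtan_periodic: "rtan (t + of_int n * L) = rtan t"
proof -
  have 1: "((\<lambda>u. (\<gamma> (u + t) - \<gamma> t) /\<^sub>R u) \<longlongrightarrow> rtan t) (at_right 0)" for t
    using rtan(2)[of t] unfolding at_right_to_0[of t] filterlim_filtermap by simp
  have "((\<lambda>u. (\<gamma> ((u + t) + of_int n * L) - \<gamma> (t + of_int n * L)) /\<^sub>R u)
    \<longlongrightarrow> rtan (t + of_int n * L)) (at_right 0)"
    using 1[of "t + of_int n * L"] by (simp add: add.assoc)
  then show ?thesis
    unfolding periodic.plus_of_int using 1 tendsto_unique trivial_limit_at_right_real by blast
qed

lemma supporting_interior_pos:
  assumes "\<And>z. z \<in> \<Omega> \<Longrightarrow> cross \<tau> (z - w) \<ge> 0" "norm \<tau> = 1" "p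
    \<in> interior \<Omega>"
  shows "cross \<tau> (p - w) > 0"
proof -
  obtain d where d: "d > 0" "cball p d \<subseteq> \<Omega>" using assms(3) mem_interior_cball by blast
  \<comment> \<open>This step of length \<open>d\<close> to the right of \<open>\<tau>\<close> stays
    in the body and lowers the cross product by exactly \<open>d\<close>.\<close>
  have "p - d *\<^sub>R (\<i> * \<tau>) \<in> \<Omega>" using d assms(2) by (auto simp: dist_norm norm_mult)
  then have "0 \<le> cross \<tau> (p - d *\<^sub>R (\<i> * \<tau>) - w)" by (rule assms(1))
  also have "\<dots> = cross \<tau> (p - w) - d * (norm \<tau>)\<^sup>2"
    unfolding cross_expand cmod_power2 by (simp add: algebra_simps power2_eq_square)
  finally show ?thesis using d assms(2) by simp
qed

text \<open>The left tangent supports \<open>\<Omega>\<close>, so all chords that define the right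
  tangent are on its left. Parallel tangents agree because opposite ones cannot both have an
  interior point strictly on the left.\<close>

lemma cross_tangents: "cross (ltan t) (rtan t) \<ge> 0" "cross (ltan t) (rtan t) = 0
  \<longleftrightarrow> ltan t = rtan t"
proof -
  have "((\<lambda>u. cross (ltan t) ((\<gamma> u - \<gamma> t) /\<^sub>R (u - t))) \<longlongrightarrow>
    cross (ltan t) (rtan t)) (at_right t)"
    by (intro tendsto_intros rtan(2))
  moreover have "\<forall>\<^sub>F u in at_right t. 0 \<le> cross (ltan t) ((\<gamma> u - \<gamma> t)
    /\<^sub>R (u - t))"
    using eventually_at_right_less
    by eventually_elim (simp add: cross_scaleR ltan(3) \<gamma>_in)
  ultimately show "cross (ltan t) (rtan t) \<ge> 0"
    by (rule tendsto_lowerbound) simp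
  show "cross (ltan t) (rtan t) = 0 \<longleftrightarrow> ltan t = rtan t"
  proof
    assume 0: "cross (ltan t) (rtan t) = 0"
    then obtain k where k: "ltan t = k *\<^sub>R rtan t" using rtan_nz by (rule parallel_if_cross_0)
    have k1: "\<bar>k\<bar> = 1" using rtan(1)[of t] ltan(1)[of t] unfolding k by simp
    obtain p where p: "p \<in> interior \<Omega>" using interior by blast
    have "0 < cross (ltan t) (p - \<gamma> t)" "0 < cross (rtan t) (p - \<gamma> t)"
      using supporting_interior_pos[OF ltan(3) ltan(1) p] supporting_interior_pos[OF rtan(3) rtan(1) p] by auto
    then have "k > 0" unfolding k cross_scaleR by (simp add: zero_less_mult_iff)
    then show "ltan t = rtan t" using k k1 by simp
  qed (simp add: cross_self)
qed

text \<open>The normal cones of distinct boundary points have disjoint interiors, and a countable dense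
  set of directions meets each of those at a corner.\<close>

lemma countable_corners: "countable {t \<in> {0..<L}. ltan t \<noteq> rtan t}"
proof -
  obtain D :: "complex set" where D: "countable D" "\<And>X. open X \<Longrightarrow> X \<noteq> {}
    \<Longrightarrow> \<exists>d\<in>D. d \<in> X"
    using countable_dense_setE by blast
  \<comment> \<open>The open cone of directions strictly between the two tangents, a rotated normal
    cone.\<close>
  define N where "N t = {d. cross (ltan t) d > 0 \<and> cross d (rtan t) > 0}" for t
  have "\<exists>d\<in>D. d \<in> N t" if "ltan t \<noteq> rtan t" for t
  proof (rule D(2))
    show "open (N t)"
      unfolding N_def cross_expand
      by (intro open_Collect_conj open_Collect_less continuous_intros)
    have "cross (ltan t) (rtan t) > 0" using that cross_tangents[of t] by force
    then have "ltan t + rtan t \<in> N t" by (simp add: N_def cross_add cross_self)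
    then show "N t \<noteq> {}" by blast
  qed
  then obtain d where d: "\<And>t. ltan t \<noteq> rtan t \<Longrightarrow> d t \<in> D \<and> d t \<in> N t" by metis
  \<comment> \<open>A direction strictly between the tangents supports the body at
    \<open>\<gamma> t\<close> only, so it determines the corner.\<close>
  have strict: "cross (d t) (z - \<gamma> t) > 0" if t: "ltan t \<noteq> rtan t" and z: "z \<in>
    \<Omega>" "z \<noteq> \<gamma> t" for t z
  proof -
    define k where "k = cross (ltan t) (rtan t)"
    have k: "k > 0" using t cross_tangents[of t] unfolding k_def by force
    have ab: "cross (d t) (rtan t) > 0" "cross (ltan t) (d t) > 0" using d[OF t] by (auto simp: N_def)
    have e: "k * cross (d t) v = cross (d t) (rtan t) * cross (ltan t) v + cross (ltan t) (d t) * cross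
      (rtan t) v" for v
      unfolding k_def cross_expand by (simp add: algebra_simps)
    have nn: "0 \<le> cross (ltan t) (z - \<gamma> t)" "0 \<le> cross (rtan t) (z - \<gamma> t)" using
      ltan(3) rtan(3) z by auto
    have "\<not> (cross (ltan t) (z - \<gamma> t) = 0 \<and> cross (rtan t) (z - \<gamma> t) = 0)"
    proof
      assume *: "cross (ltan t) (z - \<gamma> t) = 0 \<and> cross (rtan t) (z - \<gamma> t) = 0"
      then have "cross (z - \<gamma> t) (ltan t) = 0" using cross_commute[of "ltan t" "z - \<gamma> t"] by linarith
      then have "k *\<^sub>R (z - \<gamma> t) = 0"
        using cross_cycle[of "ltan t" "rtan t" "z - \<gamma> t"] * by (simp add: k_def)
      then show False using k z by simp
    qed
    then have "0 < cross (d t) (rtan t) * cross (ltan t) (z - \<gamma> t) + cross (ltan t) (d t) * cross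
      (rtan t) (z - \<gamma> t)"
      using nn ab by (smt (verit) mult_nonneg_nonneg mult_pos_pos)
    then show ?thesis using k by (simp add: zero_less_mult_iff flip: e)
  qed
  have "inj_on d {t \<in> {0..<L}. ltan t \<noteq> rtan t}"
  proof (rule inj_onI)
    fix s t assume st: "s \<in> {t \<in> {0..<L}. ltan t \<noteq> rtan t}" "t \<in> {t \<in> {0..<L}.
      ltan t \<noteq> rtan t}" "d s = d t"
    have "\<gamma> s = \<gamma> t"
    proof (rule ccontr)
      assume n: "\<gamma> s \<noteq> \<gamma> t"
      have "cross (d t) (\<gamma> s - \<gamma> t) > 0" "cross (d s) (\<gamma> t - \<gamma> s) > 0"
        using st n strict[of t "\<gamma> s"] strict[of s "\<gamma> t"] \<gamma>_in by auto
      then show False using st(3) by (simp add: cross_diff)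
    qed
    then show "s = t" using st \<gamma>_bij by (auto simp: bij_betw_def inj_on_def)
  qed
  moreover have "d ` {t \<in> {0..<L}. ltan t \<noteq> rtan t} \<subseteq> D" using d by blast
  then have "countable (d ` {t \<in> {0..<L}. ltan t \<noteq> rtan t})" using D(1) countable_subset by blast
  ultimately show ?thesis using countable_image_inj_on by blast
qed

text \<open>The exterior angle at \<open>\<gamma> t\<close>; \<open>\<beta> t / pi\<close> turns out
  to be the mass of the atom of \<open>np_measure\<close> there.\<close>

definition "\<beta> t = Arg (rtan t / ltan t)"

text \<open>\<open>sin (\<beta> t)\<close> equals \<open>cross (ltan t) (rtan t)\<close>, which is
  nonnegative and vanishes only for equal tangents; this excludes negative angles and
  \<open>pi\<close>.\<close>

lemma \<beta>: "0 \<le> \<beta> t" "\<beta> t < pi" "\<beta> t = 0 \<longleftrightarrow> ltan t = rtan t"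
  "rtan t = cis (\<beta> t) * ltan t"
proof -
  have n: "norm (rtan t / ltan t) = 1" "rtan t / ltan t \<noteq> 0" using rtan(1)[of t] ltan(1)[of t]
    rtan_nz ltan_nz by (auto simp: norm_divide)
  then have "cis (\<beta> t) = rtan t / ltan t" by (simp add: \<beta>_def cis_Arg sgn_div_norm)
  then show e: "rtan t = cis (\<beta> t) * ltan t" using ltan_nz by simp
  have im: "cross (ltan t) (rtan t) = sin (\<beta> t)"
  proof -
    have "cross (ltan t) (cis (\<beta> t) * ltan t) = sin (\<beta> t) * (norm (ltan t))\<^sup>2"
      unfolding cross_expand cmod_power2 by (simp add: algebra_simps power2_eq_square)
    then show ?thesis using ltan(1)[of t] e by simp
  qed
  have b: "- pi < \<beta> t" "\<beta> t \<le> pi" unfolding \<beta>_def using mpi_less_Arg Arg_le_pi by auto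
  have "\<beta> t \<noteq> pi"
  proof
    assume "\<beta> t = pi"
    then have "cross (ltan t) (rtan t) = 0" "rtan t = - ltan t" using im e by auto
    then show False using cross_tangents(2)[of t] ltan_nz[of t] by auto
  qed
  then show "\<beta> t < pi" using b by simp
  show "0 \<le> \<beta> t"
  proof (rule ccontr)
    assume "\<not> ?thesis"
    then have "sin (\<beta> t) < 0" using sin_gt_zero[of "- \<beta> t"] b by simp
    then show False using cross_tangents(1)[of t] im by simp
  qed
  then show "\<beta> t = 0 \<longleftrightarrow> ltan t = rtan t"
    using im cross_tangents(2)[of t] sin_gt_zero[of "\<beta> t"] \<open>\<beta> t < pi\<close> by force
qed

end

section \<open>The angle subtended by the boundary\<close>

text \<open>Moves the window of integration so that the singular time \<open>c\<close> of the kernel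
  sits at its ends.\<close>

lemma nn_integral_periodic:
  fixes f :: "real \<Rightarrow> ennreal"
  assumes f: "f \<in> borel_measurable borel" and per: "\<And>t. f (t + L) = f t"
    and c: "0 \<le> c" "c \<le> L"
  shows "(\<integral>\<^sup>+t. f t * indicator {0..<L} t \<partial>lborel) = (\<integral>\<^sup>+t. f t
    * indicator {c<..<c + L} t \<partial>lborel)"
proof -
  have m [measurable]: "f \<in> borel_measurable lborel" using f by simp
  have "(\<integral>\<^sup>+t. f t * indicator {c<..<c + L} t \<partial>lborel) = (\<integral>\<^sup>+t.
    f t * indicator {c..<c + L} t \<partial>lborel)"
    using AE_lborel_singleton[of c]
    by (intro nn_integral_cong_AE) (auto elim!: eventually_mono simp: indicator_def)
  also have "\<dots> = (\<integral>\<^sup>+t. f t * indicator {c..<L} t + f t * indicator {L..<c + L} t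
    \<partial>lborel)"
    using c by (intro nn_integral_cong) (auto simp: indicator_def)
  also have "\<dots> = (\<integral>\<^sup>+t. f t * indicator {c..<L} t \<partial>lborel) +
    (\<integral>\<^sup>+t. f t * indicator {L..<c + L} t \<partial>lborel)"
    by (intro nn_integral_add) auto
  also have "(\<integral>\<^sup>+t. f t * indicator {L..<c + L} t \<partial>lborel) =
    (\<integral>\<^sup>+t. f (L + 1 * t) * indicator {L..<c + L} (L + 1 * t) \<partial>lborel)"
    by (subst nn_integral_real_affine[where c = 1 and t = L]) auto
  also have "\<dots> = (\<integral>\<^sup>+t. f t * indicator {0..<c} t \<partial>lborel)"
    using per by (intro nn_integral_cong) (auto simp: indicator_def add.commute)
  also have "(\<integral>\<^sup>+t. f t * indicator {c..<L} t \<partial>lborel) + \<dots> =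
    (\<integral>\<^sup>+t. f t * indicator {c..<L} t + f t * indicator {0..<c} t \<partial>lborel)"
    by (intro nn_integral_add[symmetric]) auto
  also have "\<dots> = (\<integral>\<^sup>+t. f t * indicator {0..<L} t \<partial>lborel)"
    using c by (intro nn_integral_cong) (auto simp: indicator_def)
  finally show ?thesis by simp
qed

lemma Im_divide_cross: "Im (a / b) = cross b a / (norm b)\<^sup>2"
  by (simp add: Im_divide cross_expand cmod_power2)

context convex_curve
begin

lemma \<gamma>_measurable: "\<gamma> \<in> borel_measurable borel"
  using \<gamma>_cont by (rule borel_measurable_continuous_onI)

text \<open>Dividing by \<open>c\<close> turns the curve, seen from \<open>w\<close>, into the
  closed right half plane, where \<open>Ln\<close> is smooth away from 0. There
  \<open>Ln ((\<gamma> t - w) / c)\<close> is a primitive in the one-sided sense.\<close>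

lemma log_integral:
  assumes ab: "a \<le> b" and c: "c \<noteq> 0"
    and half: "\<And>t. a \<le> t \<Longrightarrow> t \<le> b \<Longrightarrow> Re ((\<gamma> t - w) / c) \<ge> 0"
    and nz: "\<And>t. a \<le> t \<Longrightarrow> t \<le> b \<Longrightarrow> \<gamma> t \<noteq> w"
  shows "set_integrable lborel {a..b} (\<lambda>t. rtan t / (\<gamma> t - w))"
    "(LINT t:{a..b}|lborel. rtan t / (\<gamma> t - w)) = Ln ((\<gamma> b - w) / c) - Ln ((\<gamma> a - w) / c)"
proof -
  have "compact ((\<lambda>t. norm (\<gamma> t - w)) ` {a..b})"
    by (intro compact_continuous_image continuous_intros continuous_on_subset[OF \<gamma>_cont]) auto
  then obtain t0 where t0: "t0 \<in> {a..b}" "\<And>t. t \<in> {a..b} \<Longrightarrow> norm (\<gamma> t0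
    - w) \<le> norm (\<gamma> t - w)"
    using compact_attains_inf[of "(\<lambda>t. norm (\<gamma> t - w)) ` {a..b}"] ab by fastforce
  define m where "m = norm (\<gamma> t0 - w)"
  have m: "m > 0" using nz[of t0] t0(1) by (simp add: m_def)
  have nonpos: "z \<notin> \<real>\<^sub>\<le>\<^sub>0" if "Re z \<ge> 0" "z \<noteq> 0" for z :: complex
    using that by (auto simp: complex_nonpos_Reals_iff complex_eq_iff)
  define F where "F t = Ln ((\<gamma> t - w) / c)" for t
  \<comment> \<open>Steps shorter than \<open>m / 2\<close>, half the distance from \<open>w\<close>
    to the arc, keep the segment from \<open>x\<close> to \<open>y\<close> away from 0, which bounds
    the derivative of \<open>Ln\<close> on it.\<close>
  have lip: "norm (F t - F s) \<le> 2 / m * (t - s)" if st: "a \<le> s" "s \<le> t" "t \<le> b" "t < s + m / 2" for s t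
  proof -
    define x where "x = (\<gamma> s - w) / c"
    define y where "y = (\<gamma> t - w) / c"
    have d: "norm (\<gamma> t - \<gamma> s) \<le> t - s" using \<gamma>_dist[OF st(2)] by (simp add:
      dist_norm norm_minus_commute)
    have yx: "y - x = (\<gamma> t - \<gamma> s) / c" by (simp add: x_def y_def flip: diff_divide_distrib)
    have "norm x \<ge> m / norm c"
      using t0(2)[of s] st c by (simp add: x_def m_def norm_divide divide_right_mono)
    moreover have "norm (y - x) \<le> (m / 2) / norm c"
      using d st c unfolding yx norm_divide by (intro divide_right_mono) auto
    ultimately have far: "norm z \<ge> m / (2 * norm c)" if "z \<in> closed_segment x y" for z
    proof -
      have "norm (z - x) \<le> norm (y - x)" using segment_bound1[OF that] by simp
      moreover have "norm x \<le> norm z + norm (z - x)" using norm_triangle_ineq4[of z "z - x"] by simp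
      moreover have "m / norm c - (m / 2) / norm c = m / (2 * norm c)" by (simp add: field_simps)
      ultimately show ?thesis
        using \<open>norm x \<ge> m / norm c\<close> \<open>norm (y - x) \<le> (m / 2) / norm c\<close> by linarith
    qed
    have Re: "Re z \<ge> 0" if "z \<in> closed_segment x y" for z
    proof -
      have "x \<in> {z. Re z \<ge> 0}" "y \<in> {z. Re z \<ge> 0}" using half[of s] half[of t] st by
        (auto simp: x_def y_def)
      then have "closed_segment x y \<subseteq> {z. Re z \<ge> 0}"
        by (intro closed_segment_subset convex_halfspace_Re_ge)
      then show ?thesis using that by auto
    qed
    have mc: "0 < m / (2 * norm c)" using m c by simp
    have "norm (Ln y - Ln x) \<le> (2 * norm c / m) * norm (y - x)"
    proof (rule field_differentiable_bound[of "closed_segment x y" Ln inverse])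
      fix z assume z: "z \<in> closed_segment x y"
      have "z \<noteq> 0" using far[OF z] mc by auto
      then show "(Ln has_field_derivative inverse z) (at z within closed_segment x y)"
        using nonpos[OF Re[OF z]] by (intro has_field_derivative_at_within[OF has_field_derivative_Ln])
      have "norm (inverse z) \<le> inverse (m / (2 * norm c))"
        unfolding norm_inverse using far[OF z] mc by (intro le_imp_inverse_le) auto
      then show "norm (inverse z) \<le> 2 * norm c / m" by simp
    qed auto
    also have "\<dots> = 2 / m * norm (\<gamma> t - \<gamma> s)" using c by (simp add: yx norm_divide)
    also have "\<dots> \<le> 2 / m * (t - s)" using d m by (intro mult_left_mono) auto
    finally show ?thesis by (simp add: F_def x_def y_def)
  qed
  have der: "(F has_vector_derivative rtan t / (\<gamma> t - w)) (at t within {t..})" if t: "a \<le> t" "t < b" for t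
  proof -
    have z: "\<gamma> t - w \<noteq> 0" "(\<gamma> t - w) / c \<noteq> 0" using nz[of t] t c by auto
    have "((\<lambda>t. (\<gamma> t - w) / c) has_vector_derivative rtan t / c) (at t within {t..})"
      by (intro has_vector_derivative_divide) (auto intro!: derivative_eq_intros rtan_derivative)
    moreover have "(Ln has_field_derivative inverse ((\<gamma> t - w) / c)) (at ((\<gamma> t - w) / c)
      within (\<lambda>t. (\<gamma> t - w) / c) ` {t..})"
      using nonpos[OF half[of t]] t z by (intro has_field_derivative_at_within[OF has_field_derivative_Ln]) auto
    ultimately have "(Ln \<circ> (\<lambda>t. (\<gamma> t - w) / c) has_vector_derivative (rtan t / c *
      inverse ((\<gamma> t - w) / c))) (at t within {t..})"
      by (rule field_vector_diff_chain_within)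
    moreover have "rtan t / c * inverse ((\<gamma> t - w) / c) = rtan t / (\<gamma> t - w)" using c z by simp
    ultimately show ?thesis using c by (simp add: F_def[abs_def] o_def)
  qed
  have meas: "(\<lambda>t. rtan t / (\<gamma> t - w)) \<in> borel_measurable borel"
    using rtan_measurable \<gamma>_measurable by measurable
  have m2: "0 < m / 2" using m by simp
  show "set_integrable lborel {a..b} (\<lambda>t. rtan t / (\<gamma> t - w))"
    by (rule integral_right_derivative(1)[OF ab m2 lip der meas])
  show "(LINT t:{a..b}|lborel. rtan t / (\<gamma> t - w)) = Ln ((\<gamma> b - w) / c) - Ln ((\<gamma> a - w) / c)"
    using integral_right_derivative(2)[OF ab m2 lip der meas] by (simp add: F_def)
qed

text \<open>The point \<open>\<gamma> s\<close> is on the left of the tangent at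
  \<open>\<gamma> t\<close>; for coinciding points the quotient is 0.\<close>

lemma density_nonneg: "0 \<le> Im (rtan t / (\<gamma> t - \<gamma> s))"
proof -
  have "0 \<le> cross (rtan t) (\<gamma> s - \<gamma> t)" using rtan(3) \<gamma>_in by auto
  also have "\<dots> = cross (\<gamma> t - \<gamma> s) (rtan t)" by (simp add: cross_expand algebra_simps)
  finally show ?thesis unfolding Im_divide_cross by simp
qed

lemma \<gamma>_neq: assumes "c < t" "t < c + L" shows "\<gamma> t \<noteq> \<gamma> c"
proof
  assume "\<gamma> t = \<gamma> c"
  then obtain n where n: "t = c + of_int n * L" by (rule \<gamma>_eqD)
  then have "0 < of_int n * L" "of_int n * L < 1 * L" using assms by auto
  then have "0 < real_of_int n" "real_of_int n < 1" using L_pos by (auto simp: zero_less_mult_iff)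
  then show False by simp
qed

text \<open>The integrand is the derivative of the argument of
  \<open>\<gamma> t - \<gamma> c\<close>. Over one period this argument moves from the direction of
  the right tangent to the opposite of the left tangent, a turn of
  \<open>pi - \<beta> c\<close>.\<close>

lemma angle_measure:
  "(\<integral>\<^sup>+t. ennreal (Im (rtan t / (\<gamma> t - \<gamma> c))) * indicator {c<..<c + L} t
    \<partial>lborel) = ennreal (pi - \<beta> c)"
proof -
  \<comment> \<open>Seen from \<open>\<gamma> c\<close>, this turns the body into the right half
    plane: the argument then runs from \<open>- (pi / 2)\<close> to
    \<open>pi / 2 - \<beta> c\<close> and meets no branch cut.\<close>
  define k where "k = \<i> * rtan c"
  have k: "k \<noteq> 0" "norm k = 1" using rtan_nz rtan(1)[of c] by (auto simp: k_def norm_mult)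
  have half: "Re ((\<gamma> t - \<gamma> c) / k) \<ge> 0" for t
  proof -
    have "Re ((\<gamma> t - \<gamma> c) / k) = cross (rtan c) (\<gamma> t - \<gamma> c)"
      using rtan(1)[of c] unfolding k_def
      by (simp add: Re_divide cross_expand cmod_def power2_eq_square algebra_simps)
    then show ?thesis using rtan(3)[of "\<gamma> t" c] \<gamma>_in by simp
  qed
  define A where "A t = Arg ((\<gamma> t - \<gamma> c) / k)" for t
  \<comment> \<open>Cut-offs decreasing to 0; denominators that start at 2 give
    \<open>h n < L - h n\<close> for every \<open>n\<close>.\<close>
  define h where "h n = L / 2 / real (Suc (Suc n))" for n
  have h: "0 < h n" "h n < L - h n" for n
  proof -
    show "0 < h n" using L_pos by (simp add: h_def)
    have "2 * (x / 2 / m) = x / m" for x m :: real by simp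
    then have "2 * h n = L / real (Suc (Suc n))" unfolding h_def .
    also have "\<dots> < L / 1" using L_pos by (intro divide_strict_left_mono) auto
    finally show "h n < L - h n" by simp
  qed
  have h_dec: "h (Suc n) \<le> h n" for n
    unfolding h_def using L_pos by (intro divide_left_mono) auto
  have h_lim: "h \<longlonglongrightarrow> 0"
    unfolding h_def[abs_def] by real_asymp
  define g where "g t = Im (rtan t / (\<gamma> t - \<gamma> c))" for t
  have g_meas [measurable]: "g \<in> borel_measurable borel"
    unfolding g_def using rtan_measurable \<gamma>_measurable by measurable
  have part: "(\<integral>\<^sup>+t. ennreal (g t) * indicator {c + h n..c + L - h n} t \<partial>lborel)
    = ennreal (A (c + L - h n) - A (c + h n))" for n
  proof -
    have ab: "c + h n \<le> c + L - h n" using h[of n] by simp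
    have nz: "\<gamma> t \<noteq> \<gamma> c" if "c + h n \<le> t" "t \<le> c + L - h n" for t
      using \<gamma>_neq[of c t] that h[of n] by auto
    have I: "set_integrable lborel {c + h n..c + L - h n} (\<lambda>t. rtan t / (\<gamma> t - \<gamma> c))"
      "(LINT t:{c + h n..c + L - h n}|lborel. rtan t / (\<gamma> t - \<gamma> c)) =
        Ln ((\<gamma> (c + L - h n) - \<gamma> c) / k) - Ln ((\<gamma> (c + h n) - \<gamma> c) / k)"
      by (rule log_integral[OF ab k(1)]; use half nz in blast)+
    have "(\<integral>\<^sup>+t. ennreal (g t) * indicator {c + h n..c + L - h n} t \<partial>lborel)
      = (\<integral>\<^sup>+t. ennreal (Im (indicator {c + h n..c + L - h n} t *\<^sub>R (rtan t /
        (\<gamma> t - \<gamma> c)))) \<partial>lborel)"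
      by (intro nn_integral_cong) (auto simp: indicator_def g_def)
    also have "\<dots> = ennreal (LINT t|lborel. Im (indicator {c + h n..c + L - h n} t *\<^sub>R (rtan t
      / (\<gamma> t - \<gamma> c))))"
      using I(1) density_nonneg unfolding set_integrable_def
      by (intro nn_integral_eq_integral integrable_Im AE_I2) (auto simp: indicator_def)
    also have "(LINT t|lborel. Im (indicator {c + h n..c + L - h n} t *\<^sub>R (rtan t / (\<gamma> t -
      \<gamma> c)))) = Im (LINT t:{c + h n..c + L - h n}|lborel. rtan t / (\<gamma> t - \<gamma> c))"
      using I(1) unfolding set_integrable_def set_lebesgue_integral_def by (rule integral_Im)
    also have "\<dots> = A (c + L - h n) - A (c + h n)"
      unfolding I(2) using nz[of "c + h n"] nz[of "c + L - h n"] h[of n] k(1) by (simp add: A_def Arg_eq_Im_Ln)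
    finally show ?thesis .
  qed
  have lim1: "(\<lambda>n. \<integral>\<^sup>+t. ennreal (g t) * indicator {c + h n..c + L - h n} t
    \<partial>lborel) \<longlonglongrightarrow>
    (\<integral>\<^sup>+t. ennreal (g t) * indicator {c<..<c + L} t \<partial>lborel)"
  proof (rule nn_integral_LIMSEQ)
    show "incseq (\<lambda>n t. ennreal (g t) * indicator {c + h n..c + L - h n} t)"
    proof (intro incseq_SucI le_funI mult_left_mono)
      fix n x
      show "(indicator {c + h n..c + L - h n} x :: ennreal) \<le> indicator {c + h (Suc n)..c + L - h (Suc n)} x"
        using h_dec[of n] by (auto simp: indicator_def)
    qed simp
    fix t
    show "(\<lambda>n. ennreal (g t) * indicator {c + h n..c + L - h n} t) \<longlonglongrightarrow>
      ennreal (g t) * indicator {c<..<c + L} t"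
    proof (cases "t \<in> {c<..<c + L}")
      case True
      then have "\<forall>\<^sub>F n in sequentially. h n < min (t - c) (c + L - t)"
        using h_lim by (intro order_tendstoD) auto
      then have "\<forall>\<^sub>F n in sequentially. ennreal (g t) * indicator {c + h n..c + L - h n} t
        = ennreal (g t) * indicator {c<..<c + L} t"
        by eventually_elim (use True in \<open>auto simp: indicator_def\<close>)
      then show ?thesis by (rule tendsto_eventually)
    next
      case False
      then have "t \<notin> {c + h n..c + L - h n}" for n using h[of n] by auto
      then show ?thesis using False by simp
    qed
  qed auto
  have lim2: "(\<lambda>n. ennreal (A (c + L - h n) - A (c + h n))) \<longlonglongrightarrow> ennreal
    ((pi / 2 - \<beta> c) - (- (pi / 2)))"
  proof (intro tendsto_ennrealI tendsto_diff)
    \<comment> \<open>Lengths do not affect the argument, and unit directions, unlike differences,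
      have nonzero limits at \<open>c\<close>.\<close>
    have A_sgn: "A t = Arg (sgn (\<gamma> t - \<gamma> c) / k)" if "\<gamma> t \<noteq> \<gamma> c" for t
    proof -
      have "d = sgn d * of_real (norm d)" if "d \<noteq> 0" for d :: complex
        using that by (simp add: sgn_div_norm scaleR_conv_of_real)
      from this[of "\<gamma> t - \<gamma> c"] that
      have "(\<gamma> t - \<gamma> c) / k = (sgn (\<gamma> t - \<gamma> c) / k) * of_real (norm (\<gamma>
        t - \<gamma> c))"
        by (metis times_divide_eq_left right_minus_eq)
      then have "A t = Arg ((sgn (\<gamma> t - \<gamma> c) / k) * of_real (norm (\<gamma> t - \<gamma> c)))"
        unfolding A_def by (rule arg_cong)
      also have "\<dots> = Arg (sgn (\<gamma> t - \<gamma> c) / k)" using that by (intro Arg_times_of_real2) simp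
      finally show ?thesis .
    qed
    have right: "((\<lambda>u. Arg (sgn (\<gamma> u - \<gamma> c) / k)) \<longlongrightarrow> - (pi / 2)) (at_right c)"
    proof -
      have "rtan c / k = - \<i>" using rtan_nz[of c] by (simp add: k_def)
      moreover have "- \<i> \<notin> \<real>\<^sub>\<le>\<^sub>0" by (simp add: complex_nonpos_Reals_iff)
      ultimately have "isCont Arg (rtan c / k)" using continuous_at_Arg by simp
      then have "((\<lambda>u. Arg (sgn (\<gamma> u - \<gamma> c) / k)) \<longlongrightarrow> Arg (rtan c
        / k)) (at_right c)"
        using k(1) by (intro isCont_tendsto_compose[of _ Arg] tendsto_divide tendsto_sgn_right tendsto_const)
      moreover have "Arg (- \<i>) = - (pi / 2)" using Arg_unique[of 1 "- (pi/2)" "- \<i>"] pi_gt_zero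
        by (simp add: cis_conv_exp[symmetric] exp_eq_polar complex_eq_iff)
      ultimately show ?thesis using \<open>rtan c / k = - \<i>\<close> by simp
    qed
    have left: "((\<lambda>u. Arg (sgn (\<gamma> u - \<gamma> c) / k)) \<longlongrightarrow> pi / 2 -
      \<beta> c) (at_left c)"
    proof -
      have e: "- ltan c / k = cis (pi / 2 - \<beta> c)"
      proof -
        have "- ltan c / k = \<i> / cis (\<beta> c)"
          using ltan_nz[of c] unfolding k_def \<beta>(4)[of c] by (simp add: field_simps)
        also have "\<dots> = cis (pi / 2 - \<beta> c)" by (simp add: cis_divide[symmetric])
        finally show ?thesis .
      qed
      have b: "- (pi / 2) < pi / 2 - \<beta> c" "pi / 2 - \<beta> c \<le> pi / 2" using \<beta>[of c] by auto
      have "cos (pi / 2 - \<beta> c) \<ge> 0" using b by (intro cos_ge_zero) auto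
      then have "- ltan c / k \<notin> \<real>\<^sub>\<le>\<^sub>0"
        unfolding e using sin_cos_squared_add[of "pi / 2 - \<beta> c"]
        by (auto simp: complex_nonpos_Reals_iff simp del: sin_cos_squared_add)
      then have "isCont Arg (- ltan c / k)" by (rule continuous_at_Arg)
      moreover have "((\<lambda>u. sgn (\<gamma> u - \<gamma> c)) \<longlongrightarrow> - ltan c) (at_left c)"
      proof -
        have "((\<lambda>u. - sgn (\<gamma> c - \<gamma> u)) \<longlongrightarrow> - ltan c) (at_left c)"
          by (intro tendsto_minus tendsto_sgn_left)
        then show ?thesis by (simp flip: sgn_minus)
      qed
      ultimately have "((\<lambda>u. Arg (sgn (\<gamma> u - \<gamma> c) / k)) \<longlongrightarrow> Arg
        (- ltan c / k)) (at_left c)"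
        using k(1) by (intro isCont_tendsto_compose[of _ Arg] tendsto_divide tendsto_const)
      moreover have "Arg (- ltan c / k) = pi / 2 - \<beta> c" unfolding e using b pi_gt_zero by (intro Arg_cis) auto
      ultimately show ?thesis by simp
    qed
    have fr: "filterlim (\<lambda>n. c + h n) (at_right c) sequentially"
      unfolding filterlim_at
    proof
      have "c + h n \<in> {c<..} \<and> c + h n \<noteq> c" for n using h(1)[of n] by simp
      then show "\<forall>\<^sub>F n in sequentially. c + h n \<in> {c<..} \<and> c + h n \<noteq> c" by
        (intro always_eventually) blast
      show "(\<lambda>n. c + h n) \<longlonglongrightarrow> c" using tendsto_add[OF tendsto_const h_lim, of c] by simp
    qed
    have fl: "filterlim (\<lambda>n. c - h n) (at_left c) sequentially"
      unfolding filterlim_at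
    proof
      have "c - h n \<in> {..<c} \<and> c - h n \<noteq> c" for n using h(1)[of n] by simp
      then show "\<forall>\<^sub>F n in sequentially. c - h n \<in> {..<c} \<and> c - h n \<noteq> c" by
        (intro always_eventually) blast
      show "(\<lambda>n. c - h n) \<longlonglongrightarrow> c" using tendsto_diff[OF tendsto_const h_lim, of c] by simp
    qed
    have nzh: "\<gamma> (c + h n) \<noteq> \<gamma> c" "\<gamma> (c + L - h n) \<noteq> \<gamma> c" for n
      using \<gamma>_neq[of c "c + h n"] \<gamma>_neq[of c "c + L - h n"] h[of n] by auto
    \<comment> \<open>Approaching the end of the period from the left is approaching
      \<open>c\<close> from the left.\<close>
    have per: "\<gamma> (c + L - h n) = \<gamma> (c - h n)" for n
      using \<gamma>_per[of "c - h n"] by (simp add: algebra_simps)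
    show "(\<lambda>n. A (c + h n)) \<longlonglongrightarrow> - (pi / 2)"
      using filterlim_compose[OF right fr] nzh by (simp add: A_sgn)
    show "(\<lambda>n. A (c + L - h n)) \<longlonglongrightarrow> pi / 2 - \<beta> c"
      using filterlim_compose[OF left fl] nzh by (simp add: A_sgn) (simp add: per)
  qed
  have "(\<integral>\<^sup>+t. ennreal (g t) * indicator {c<..<c + L} t \<partial>lborel) = ennreal ((pi
    / 2 - \<beta> c) - (- (pi / 2)))"
    by (rule LIMSEQ_unique[OF lim1[unfolded part] lim2])
  then show ?thesis by (simp add: g_def)
qed

end

section \<open>The Neumann-Poincare kernel\<close>

lemma measurable_add_measure: "borel_measurable (add_measure M N) = borel_measurable M"
  by (rule measurable_cong_sets) simp_all

lemma nn_integral_add_measure: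
  assumes N: "sets N = sets M" and f: "f \<in> borel_measurable M"
  shows "(\<integral>\<^sup>+x. f x \<partial>add_measure M N) = (\<integral>\<^sup>+x. f x \<partial>M)
    + (\<integral>\<^sup>+x. f x \<partial>N)"
  using f
proof (induct rule: borel_measurable_induct)
  case (cong f g)
  have sp: "space N = space M" using N by (rule sets_eq_imp_space_eq)
  have "(\<integral>\<^sup>+x. f x \<partial>add_measure M N) = (\<integral>\<^sup>+x. g x \<partial>add_measure M N)"
    "(\<integral>\<^sup>+x. f x \<partial>M) = (\<integral>\<^sup>+x. g x \<partial>M)"
      "(\<integral>\<^sup>+x. f x \<partial>N) = (\<integral>\<^sup>+x. g x \<partial>N)"
    using cong(3) sp by (auto intro!: nn_integral_cong)
  then show ?case using cong by simp
next
  case (set A)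
  then show ?case using N by (simp add: emeasure_add_measure)
next
  case (mult u c)
  then have "u \<in> borel_measurable N" "u \<in> borel_measurable (add_measure M N)"
    using N measurable_cong_sets[OF N refl] by (auto simp: measurable_add_measure)
  then show ?case using mult by (simp add: nn_integral_cmult distrib_left)
next
  case (add u v)
  then have "u \<in> borel_measurable N" "u \<in> borel_measurable (add_measure M N)"
    "v \<in> borel_measurable N" "v \<in> borel_measurable (add_measure M N)"
    using N measurable_cong_sets[OF N refl] by (auto simp: measurable_add_measure)
  then show ?case using add by (simp add: nn_integral_add add_ac)
next
  case (seq U)
  then have m: "U i \<in> borel_measurable N" "U i \<in> borel_measurable (add_measure M N)" for i
    using N measurable_cong_sets[OF N refl] by (auto simp: measurable_add_measure)
  have inc: "incseq (\<lambda>i. \<integral>\<^sup>+x. U i x \<partial>M)" "incseq (\<lambda>i.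
    \<integral>\<^sup>+x. U i x \<partial>N)"
    using seq(4) by (auto simp: incseq_def le_fun_def intro!: nn_integral_mono)
  have "(\<integral>\<^sup>+x. (SUP i. U i) x \<partial>add_measure M N) = (SUP i. \<integral>\<^sup>+x.
    U i x \<partial>add_measure M N)"
    unfolding SUP_apply using seq m by (intro nn_integral_monotone_convergence_SUP) auto
  also have "\<dots> = (SUP i. \<integral>\<^sup>+x. U i x \<partial>M) + (SUP i. \<integral>\<^sup>+x. U
    i x \<partial>N)"
    unfolding seq(3) by (rule ennreal_SUP_add[OF inc])
  also have "\<dots> = (\<integral>\<^sup>+x. (SUP i. U i) x \<partial>M) + (\<integral>\<^sup>+x. (SUP
    i. U i) x \<partial>N)"
    unfolding SUP_apply using seq m
    by (intro arg_cong2[where f = "(+)"] nn_integral_monotone_convergence_SUP[symmetric]) auto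
  finally show ?case .
qed

lemma integrable_add_measureD:
  fixes f :: "'a \<Rightarrow> 'b::{banach, second_countable_topology}"
  assumes N: "sets N = sets M" and f: "integrable (add_measure M N) f"
  shows "integrable M f" "integrable N f"
proof -
  have m: "f \<in> borel_measurable M" using f by (simp add: measurable_add_measure integrable_iff_bounded)
  moreover have "f \<in> borel_measurable N" using m measurable_cong_sets[OF N refl] by auto
  moreover have "(\<integral>\<^sup>+x. norm (f x) \<partial>add_measure M N) < \<infinity>" using f by
    (simp add: integrable_iff_bounded)
  then have "(\<integral>\<^sup>+x. norm (f x) \<partial>M) < \<infinity>" "(\<integral>\<^sup>+x. norm
    (f x) \<partial>N) < \<infinity>"
    using m nn_integral_add_measure[OF N, of "\<lambda>x. ennreal (norm (f x))"] by auto
  ultimately show "integrable M f" "integrable N f" by (auto simp: integrable_iff_bounded)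
qed

lemma integral_add_measure:
  fixes f :: "'a \<Rightarrow> 'b::{banach, second_countable_topology}"
  assumes N: "sets N = sets M" and f: "integrable (add_measure M N) f"
  shows "integral\<^sup>L (add_measure M N) f = integral\<^sup>L M f + integral\<^sup>L N f"
  using f
proof (induct rule: integrable_induct)
  case (base A c)
  have A: "A \<in> sets M" "A \<in> sets N" using base N by auto
  have fin: "emeasure M A < \<infinity>" "emeasure N A < \<infinity>"
    using base A by (auto simp: emeasure_add_measure[OF N])
  have "measure (add_measure M N) A = measure M A + measure N A"
    using fin A by (simp add: measure_def emeasure_add_measure[OF N] enn2real_plus)
  moreover have "A \<inter> space M = A" "A \<inter> space N = A" using A sets.sets_into_space by blast+
  moreover have "(LINT x|P. indicator A x *\<^sub>R c) = measure P (A \<inter> space P) *\<^sub>R c"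
    if "A \<in> sets P" "emeasure P A < \<infinity>" for P :: "'a measure"
    using that by (subst integral_scaleR_left) auto
  ultimately show ?case
    using base A fin by (simp add: scaleR_add_left)
next
  case (add f g)
  then show ?case
    using integrable_add_measureD[OF N add(1)] integrable_add_measureD[OF N add(3)] by simp
next
  case (lim f s)
  have sp: "space N = space M" using N by (rule sets_eq_imp_space_eq)
  have i: "integrable M f" "integrable N f" using integrable_add_measureD[OF N lim(5)] .
  have s: "integrable M (s i)" "integrable N (s i)" for i using integrable_add_measureD[OF N lim(1)] .
  have "(\<lambda>i. integral\<^sup>L (add_measure M N) (s i)) \<longlonglongrightarrow> integral\<^sup>L
    (add_measure M N) f"
    using lim by (intro integral_dominated_convergence[where w = "\<lambda>x. 2 * norm (f x)"]) auto
  moreover have "(\<lambda>i. integral\<^sup>L M (s i) + integral\<^sup>L N (s i))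
    \<longlonglongrightarrow> integral\<^sup>L M f + integral\<^sup>L N f"
    using lim i s sp
    by (intro tendsto_add integral_dominated_convergence[where w = "\<lambda>x. 2 * norm (f x)"]) auto
  ultimately show ?case unfolding lim(2) by (rule LIMSEQ_unique)
qed

lemma integral_scale_return:
  fixes f :: "'a \<Rightarrow> 'b::{banach, second_countable_topology}"
  assumes z: "z \<in> space M" "{z} \<in> sets M" and f: "f \<in> borel_measurable M" and r: "0 \<le> r"
  shows "integral\<^sup>L (scale_measure (ennreal r) (return M z)) f = r *\<^sub>R f z"
proof -
  let ?N = "scale_measure (ennreal r) (return M z)"
  have sp: "space ?N = space M" by (simp add: space_scale_measure)
  have "AE x in ?N. x = z"
  proof (rule AE_I)
    show "{x \<in> space ?N. x \<noteq> z} \<subseteq> space M - {z}" using sp by auto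
    show "space M - {z} \<in> sets ?N" using z by auto
    then show "emeasure ?N (space M - {z}) = 0" by simp
  qed
  then have "integral\<^sup>L ?N f = integral\<^sup>L ?N (\<lambda>_. f z)"
    using f measurable_cong_sets[of ?N M borel borel] by (intro integral_cong_AE) auto
  also have "\<dots> = r *\<^sub>R f z"
    using z r by (simp add: sp measure_def)
  finally show ?thesis .
qed

section \<open>The definitions expressed on the parameter interval\<close>

locale convex_body_interior = convex_body +
  assumes interior_nonempty: "interior \<Omega> \<noteq> {}"
begin

lemma boundary_param: "arclength_param \<Omega> (perimeter \<Omega>) (bdy \<Omega>)"
proof -
  obtain p where "p \<in> interior \<Omega>" using interior_nonempty by blast
  then obtain L \<gamma> where "arclength_param \<Omega> L \<gamma>" using arclength_param_exists by blast
  then have "case (L, \<gamma>) of (L, \<gamma>) \<Rightarrow> arclength_param \<Omega> L \<gamma>" by simp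
  then have "case boundary_param \<Omega> of (L, \<gamma>) \<Rightarrow> arclength_param \<Omega> L \<gamma>"
    unfolding boundary_param_def by (rule someI)
  then show ?thesis by (simp add: perimeter_def bdy_def case_prod_beta)
qed

sublocale convex_curve \<Omega> "perimeter \<Omega>" "bdy \<Omega>"
  by standard (rule boundary_param interior_nonempty)+

abbreviation "L \<equiv> perimeter \<Omega>"
abbreviation "\<gamma> \<equiv> bdy \<Omega>"
abbreviation "I \<equiv> restrict_space lborel {0..<L}"
abbreviation "Bd \<equiv> boundary_borel \<Omega>"
abbreviation "NP \<equiv> neumann_poincare \<Omega>"
abbreviation "dens \<equiv> np_density \<Omega>"

lemma bdy_time: "0 \<le> t \<Longrightarrow> t < L \<Longrightarrow> bdy_time \<Omega> (\<gamma> t) = t"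
  using \<gamma>_bij unfolding bdy_time_def bij_betw_def by (intro the_inv_into_f_f) auto

lemma frontierE:
  assumes "z \<in> frontier \<Omega>" obtains t where "0 \<le> t" "t < L" "z = \<gamma> t"
proof -
  have "z \<in> \<gamma> ` {0..<L}" using assms \<gamma>_bij by (simp add: bij_betw_def)
  then show ?thesis using that by auto
qed

lemma tangent_out: "0 \<le> t \<Longrightarrow> t < L \<Longrightarrow> tangent_out \<Omega> (\<gamma> t) = rtan t"
  unfolding tangent_out_def by (simp add: bdy_time tendsto_Lim[OF _ tendsto_sgn_right])

lemma tangent_in: "0 \<le> t \<Longrightarrow> t < L \<Longrightarrow> tangent_in \<Omega> (\<gamma> t) = ltan t"
  unfolding tangent_in_def by (simp add: bdy_time tendsto_Lim[OF _ tendsto_sgn_left])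

lemma corner: "0 \<le> t \<Longrightarrow> t < L \<Longrightarrow> corner \<Omega> (\<gamma> t)
  \<longleftrightarrow> ltan t \<noteq> rtan t"
  using \<beta>(1,3)[of t] unfolding corner_def angle_out_def by (simp add: tangent_in tangent_out
    less_le flip: \<beta>_def)

lemma interior_angle: "0 \<le> t \<Longrightarrow> t < L \<Longrightarrow> interior_angle \<Omega>
  (\<gamma> t) = pi - \<beta> t"
  unfolding interior_angle_def angle_out_def by (simp add: tangent_in tangent_out \<beta>_def)

lemma np_density:
  assumes "0 \<le> t" "t < L" "0 \<le> c" "c < L"
  shows "dens (\<gamma> c) (\<gamma> t) = (if t \<noteq> c \<and> ltan t = rtan t then 1 / pi * Im (rtan
    t / (\<gamma> t - \<gamma> c)) else 0)"
proof -
  have "\<gamma> t = \<gamma> c \<longleftrightarrow> t = c" using assms \<gamma>_bij by (auto simp: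
    bij_betw_def inj_on_def)
  moreover have "Re (- \<i> * rtan t / w) = Im (rtan t / w)" for w
  proof -
    have "- \<i> * rtan t / w = - (\<i> * (rtan t / w))" by simp
    then show ?thesis by (simp del: times_divide_eq_right)
  qed
  ultimately show ?thesis
    using assms by (simp add: np_density_def corner outward_normal_def tangent_out)
qed

lemma space_B: "space Bd = frontier \<Omega>"
  by (simp add: space_restrict_space)

lemma \<gamma>_measurable_B: "\<gamma> \<in> I \<rightarrow>\<^sub>M Bd"
  by (rule measurable_restrict_space2)
     (use \<gamma>_front \<gamma>_measurable in \<open>auto intro: measurable_restrict_space1\<close>)

text \<open>The inverse of \<open>\<gamma>\<close> jumps at \<open>\<gamma> 0\<close>, but each of
  its sublevel sets is empty, the image of a compact interval, or the whole boundary.\<close>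

lemma bdy_time_measurable: "bdy_time \<Omega> \<in> borel_measurable Bd"
  unfolding borel_measurable_iff_le
proof
  fix a
  have "{w \<in> space Bd. bdy_time \<Omega> w \<le> a} = \<gamma> ` ({0..<L} \<inter> {..a})"
  proof (intro set_eqI iffI)
    fix w assume w: "w \<in> {w \<in> space Bd. bdy_time \<Omega> w \<le> a}"
    then have "w \<in> frontier \<Omega>" by (simp add: space_B)
    then obtain t where t: "0 \<le> t" "t < L" "w = \<gamma> t" by (rule frontierE)
    then have "t \<le> a" using w bdy_time[OF t(1,2)] by simp
    then have "t \<in> {0..<L} \<inter> {..a}" using t(1,2) by simp
    then show "w \<in> \<gamma> ` ({0..<L} \<inter> {..a})" unfolding t(3) by (rule imageI)
  next
    fix w assume "w \<in> \<gamma> ` ({0..<L} \<inter> {..a})"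
    then obtain t where t: "0 \<le> t" "t < L" "t \<le> a" "w = \<gamma> t" by auto
    then show "w \<in> {w \<in> space Bd. bdy_time \<Omega> w \<le> a}"
      using bdy_time[OF t(1,2)] \<gamma>_front by (simp add: space_B)
  qed
  also have "\<dots> \<in> sets Bd"
  proof -
    have sub: "\<gamma> ` S \<subseteq> frontier \<Omega>" for S using \<gamma>_front by auto
    consider "a < 0" | "0 \<le> a" "a < L" | "L \<le> a" by linarith
    then show ?thesis
    proof cases
      case 1
      then have "{0..<L} \<inter> {..a} = {}" by auto
      then show ?thesis by simp
    next
      case 2
      then have e: "{0..<L} \<inter> {..a} = {0..a}" by auto
      have "compact (\<gamma> ` {0..a})"
        by (intro compact_continuous_image continuous_on_subset[OF \<gamma>_cont]) auto
      then have "closed (\<gamma> ` {0..a})" by (rule compact_imp_closed)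
      then show ?thesis unfolding e using sub by (auto simp: sets_restrict_space_iff)
    next
      case 3
      then have "{0..<L} \<inter> {..a} = {0..<L}" by auto
      then have "\<gamma> ` ({0..<L} \<inter> {..a}) = frontier \<Omega>"
        using \<gamma>_bij by (simp add: bij_betw_def)
      then show ?thesis using space_B sets.top[of "Bd"] by simp
    qed
  qed
  finally show "{w \<in> space Bd. bdy_time \<Omega> w \<le> a} \<in> sets Bd" .
qed

lemma singleton_B: "z \<in> frontier \<Omega> \<Longrightarrow> {z} \<in> sets Bd"
  by (auto simp: sets_restrict_space_iff)

lemma corners_measurable: "{z \<in> frontier \<Omega>. corner \<Omega> z} \<in> sets Bd"
proof -
  have "{z \<in> frontier \<Omega>. corner \<Omega> z} = \<gamma> ` {t \<in> {0..<L}. ltan t \<noteq> rtan t}"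
  proof (intro set_eqI iffI)
    fix w assume w: "w \<in> {z \<in> frontier \<Omega>. corner \<Omega> z}"
    then have "w \<in> frontier \<Omega>" by simp
    then obtain t where t: "0 \<le> t" "t < L" "w = \<gamma> t" by (rule frontierE)
    then have "ltan t \<noteq> rtan t" using w corner[OF t(1,2)] by blast
    then have "t \<in> {t \<in> {0..<L}. ltan t \<noteq> rtan t}" using t(1,2) by simp
    then show "w \<in> \<gamma> ` {t \<in> {0..<L}. ltan t \<noteq> rtan t}" unfolding t(3) by (rule imageI)
  next
    fix w assume "w \<in> \<gamma> ` {t \<in> {0..<L}. ltan t \<noteq> rtan t}"
    then obtain t where t: "0 \<le> t" "t < L" "ltan t \<noteq> rtan t" "w = \<gamma> t" by auto
    then show "w \<in> {z \<in> frontier \<Omega>. corner \<Omega> z}" using corner[OF t(1,2)] \<gamma>_front by simp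
  qed
  then have "countable {z \<in> frontier \<Omega>. corner \<Omega> z}" using countable_corners by simp
  moreover have "{z} \<in> sets Bd" if "z \<in> {z \<in> frontier \<Omega>. corner \<Omega> z}" for z
    using that singleton_B by auto
  ultimately show ?thesis by (rule sets.countable[rotated])
qed

text \<open>The tangent is a measurable function of time, so it is composed with
  \<open>bdy_time\<close>; the exceptional set is countable.\<close>

lemma np_density_measurable: "dens \<zeta> \<in> borel_measurable Bd"
proof -
  have id: "(\<lambda>z. z) \<in> borel_measurable Bd" by (intro measurable_restrict_space1) simp
  have "(\<lambda>z. rtan (bdy_time \<Omega> z)) \<in> borel_measurable Bd"
    by (rule measurable_compose[OF bdy_time_measurable rtan_measurable])
  then have m: "(\<lambda>z. 1 / pi * Re (- \<i> * rtan (bdy_time \<Omega> z) / (z - \<zeta>))) \<in>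
    borel_measurable Bd"
    using id by measurable
  have "{z \<in> frontier \<Omega>. z \<noteq> \<zeta> \<and> \<not> corner \<Omega> z} = frontier
    \<Omega> - ({z \<in> frontier \<Omega>. corner \<Omega> z} \<union> (frontier \<Omega> \<inter> {\<zeta>}))"
    by auto
  moreover have "frontier \<Omega> \<inter> {\<zeta>} \<in> sets Bd" by (auto simp: sets_restrict_space_iff)
  moreover have "frontier \<Omega> \<in> sets Bd" by (auto simp: sets_restrict_space_iff)
  ultimately have s: "{z \<in> space Bd. z \<noteq> \<zeta> \<and> \<not> corner \<Omega> z} \<in> sets Bd"
    unfolding space_B using corners_measurable by auto
  have "(\<lambda>z. if z \<noteq> \<zeta> \<and> \<not> corner \<Omega> z then 1 / pi * Re (- \<i> *
    rtan (bdy_time \<Omega> z) / (z - \<zeta>)) else 0)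
     \<in> borel_measurable Bd"
    using m s by (intro measurable_If) auto
  moreover have "dens \<zeta> z = (if z \<noteq> \<zeta> \<and> \<not> corner \<Omega> z then 1 / pi * Re
    (- \<i> * rtan (bdy_time \<Omega> z) / (z - \<zeta>)) else 0)"
    if "z \<in> space Bd" for z
  proof -
    obtain t where "0 \<le> t" "t < L" "z = \<gamma> t" using \<open>z \<in> _\<close> unfolding space_B
      by (rule frontierE)
    then show ?thesis by (simp add: np_density_def outward_normal_def tangent_out bdy_time)
  qed
  ultimately show ?thesis by (subst measurable_cong)
qed

text \<open>The exceptional times are countable; under integrals this removes the case distinction
  of \<open>np_density\<close>.\<close>

lemma AE_smooth: "AE t in I. ltan t = rtan t \<and> t \<noteq> c"
proof -
  have "countable ({t \<in> {0..<L}. ltan t \<noteq> rtan t} \<union> {c})" using countable_corners by simp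
  then have "AE t in lborel. t \<notin> {t \<in> {0..<L}. ltan t \<noteq> rtan t} \<union> {c}"
    by (intro AE_not_in null_setsI emeasure_lborel_countable) (auto intro: sets.countable)
  then have "AE t in lborel. t \<in> {0..<L} \<longrightarrow> ltan t = rtan t \<and> t \<noteq> c"
    by eventually_elim auto
  then show ?thesis by (subst AE_restrict_space_iff) auto
qed

lemma AE_I_mem: "AE t in I. 0 \<le> t \<and> t < L"
  by (subst AE_restrict_space_iff) auto

lemma np_density_nonneg: "z \<in> frontier \<Omega> \<Longrightarrow> w \<in> frontier \<Omega>
  \<Longrightarrow> 0 \<le> dens z w"
  by (elim frontierE) (simp add: np_density density_nonneg)

lemma nn_integral_kernel:
  assumes c: "0 \<le> c" "c < L"
  shows "(\<integral>\<^sup>+t. ennreal (1 / pi * Im (rtan t / (\<gamma> t - \<gamma> c))) \<partial>I) =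
    ennreal ((pi - \<beta> c) / pi)"
proof -
  define g where "g t = Im (rtan t / (\<gamma> t - \<gamma> c))" for t
  have g_meas [measurable]: "g \<in> borel_measurable borel"
    unfolding g_def using rtan_measurable \<gamma>_measurable by measurable
  have g_per: "g (t + L) = g t" for t
    using rtan_periodic[of t 1] by (simp add: g_def \<gamma>_per)
  have "(\<integral>\<^sup>+t. ennreal (1 / pi * g t) \<partial>I) = (\<integral>\<^sup>+t. ennreal (1 /
    pi) * ennreal (g t) \<partial>I)"
    using density_nonneg by (intro nn_integral_cong) (simp add: ennreal_mult[symmetric] g_def)
  also have "\<dots> = ennreal (1 / pi) * (\<integral>\<^sup>+t. ennreal (g t) \<partial>I)"
    by (intro nn_integral_cmult measurable_restrict_space1) simp
  also have "(\<integral>\<^sup>+t. ennreal (g t) \<partial>I) = (\<integral>\<^sup>+t. ennreal (g t) *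
    indicator {0..<L} t \<partial>lborel)"
    by (subst nn_integral_restrict_space) auto
  also have "\<dots> = (\<integral>\<^sup>+t. ennreal (g t) * indicator {c<..<c + L} t \<partial>lborel)"
    using c g_per by (intro nn_integral_periodic) auto
  also have "\<dots> = ennreal (pi - \<beta> c)" unfolding g_def by (rule angle_measure)
  also have "ennreal (1 / pi) * ennreal (pi - \<beta> c) = ennreal ((pi - \<beta> c) / pi)"
    using \<beta>(2)[of c] by (simp add: ennreal_mult[symmetric])
  finally show ?thesis by (simp add: g_def)
qed

lemma nn_integral_np_density:
  assumes c: "0 \<le> c" "c < L"
  shows "(\<integral>\<^sup>+\<sigma>. ennreal (dens (\<gamma> c) \<sigma>) \<partial>arclength_measure
    \<Omega>) = ennreal ((pi - \<beta> c) / pi)"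
proof -
  have "(\<integral>\<^sup>+\<sigma>. ennreal (dens (\<gamma> c) \<sigma>) \<partial>arclength_measure
    \<Omega>) = (\<integral>\<^sup>+t. ennreal (dens (\<gamma> c) (\<gamma> t)) \<partial>I)"
    unfolding arclength_measure_def using np_density_measurable
    by (intro nn_integral_distr \<gamma>_measurable_B) simp
  also have "\<dots> = (\<integral>\<^sup>+t. ennreal (1 / pi * Im (rtan t / (\<gamma> t - \<gamma> c))) \<partial>I)"
    using AE_smooth[of c] AE_I_mem
    by (intro nn_integral_cong_AE, eventually_elim) (use c in \<open>simp add: np_density\<close>)
  also have "\<dots> = ennreal ((pi - \<beta> c) / pi)" by (rule nn_integral_kernel[OF c])
  finally show ?thesis .
qed

lemma sets_np_measure: "sets (np_measure \<Omega> \<zeta>) = sets Bd"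
  and space_np_measure: "space (np_measure \<Omega> \<zeta>) = frontier \<Omega>"
  by (simp_all add: np_measure_def space_scale_measure space_B)

lemma np_parts_sets:
  "sets (density (arclength_measure \<Omega>) f) = sets (scale_measure r (return Bd \<zeta>))"
  by (simp add: arclength_measure_def)

text \<open>Seen from \<open>\<gamma> c\<close>, the curve subtends \<open>\<beta> c\<close> less
  than a half turn, and the atom supplies exactly this deficit.\<close>

lemma prob_space_np_measure:
  assumes "\<zeta> \<in> frontier \<Omega>" shows "prob_space (np_measure \<Omega> \<zeta>)"
proof
  obtain c where c: "0 \<le> c" "c < L" "\<zeta> = \<gamma> c" using assms by (rule frontierE)
  have fr: "frontier \<Omega> \<in> sets Bd" by (auto simp: sets_restrict_space_iff)
  have "emeasure (density (arclength_measure \<Omega>) (\<lambda>\<sigma>. ennreal (dens \<zeta>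
    \<sigma>))) (frontier \<Omega>)
      = (\<integral>\<^sup>+\<sigma>. ennreal (dens \<zeta> \<sigma>) * indicator (frontier \<Omega>)
        \<sigma> \<partial>arclength_measure \<Omega>)"
    using np_density_measurable fr by (intro emeasure_density) (auto simp: arclength_measure_def)
  also have "\<dots> = (\<integral>\<^sup>+\<sigma>. ennreal (dens \<zeta> \<sigma>)
    \<partial>arclength_measure \<Omega>)"
    by (intro nn_integral_cong) (auto simp: arclength_measure_def space_B indicator_def)
  also have "\<dots> = ennreal ((pi - \<beta> c) / pi)" unfolding c(3) by (rule nn_integral_np_density[OF c(1,2)])
  finally have d: "emeasure (density (arclength_measure \<Omega>) (\<lambda>\<sigma>. ennreal (dens
    \<zeta> \<sigma>))) (frontier \<Omega>) = ennreal ((pi - \<beta> c) / pi)" .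
  have ia: "1 - interior_angle \<Omega> \<zeta> / pi = \<beta> c / pi"
    using c by (simp add: interior_angle field_simps)
  have "emeasure (np_measure \<Omega> \<zeta>) (frontier \<Omega>) = ennreal (\<beta> c / pi) + ennreal
    ((pi - \<beta> c) / pi)"
    unfolding np_measure_def using fr assms d
    by (subst emeasure_add_measure[OF np_parts_sets]) (auto simp: ia)
  also have "\<dots> = ennreal (\<beta> c / pi + (pi - \<beta> c) / pi)"
    using \<beta>[of c] by (intro ennreal_plus[symmetric]) auto
  also have "\<dots> = 1" by (simp add: add_divide_distrib[symmetric])
  finally show "emeasure (np_measure \<Omega> \<zeta>) (space (np_measure \<Omega> \<zeta>)) = 1" by
    (simp add: space_np_measure)
qed

lemma integrable_np_measure:
  fixes f :: "complex \<Rightarrow> complex"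
  assumes z: "\<zeta> \<in> frontier \<Omega>" and f: "continuous_on (frontier \<Omega>) f"
  shows "integrable (np_measure \<Omega> \<zeta>) f"
proof -
  interpret prob_space "np_measure \<Omega> \<zeta>" by (rule prob_space_np_measure[OF z])
  have "compact (f ` frontier \<Omega>)"
    using compact_frontier[OF compact] f by (intro compact_continuous_image)
  then obtain B where "\<And>x. x \<in> frontier \<Omega> \<Longrightarrow> norm (f x) \<le> B"
    using compact_imp_bounded bounded_iff by (metis imageI)
  moreover have "f \<in> borel_measurable (np_measure \<Omega> \<zeta>)"
    using borel_measurable_continuous_on_restrict[OF f] measurable_cong_sets[OF sets_np_measure refl] by auto
  ultimately show ?thesis
    by (intro integrable_const_bound[where B = B] AE_I2) (auto simp: space_np_measure)
qed

text \<open>The form of the operator that is used from here on: the atom plus an integral over one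
  period with an explicit kernel.\<close>

lemma neumann_poincare_eq:
  assumes c: "0 \<le> c" "c < L" and f: "continuous_on (frontier \<Omega>) f"
  shows "NP f (\<gamma> c) =
    (\<beta> c / pi) *\<^sub>R f (\<gamma> c) + (LINT t|I. (1 / pi * Im (rtan t / (\<gamma> t - \<gamma>
      c))) *\<^sub>R f (\<gamma> t))"
proof -
  have fm: "f \<in> borel_measurable Bd" by (rule borel_measurable_continuous_on_restrict[OF f])
  have ia: "1 - interior_angle \<Omega> (\<gamma> c) / pi = \<beta> c / pi"
    using c by (simp add: interior_angle field_simps)
  have "NP f (\<gamma> c) =
     integral\<^sup>L (scale_measure (ennreal (1 - interior_angle \<Omega> (\<gamma> c) / pi)) (return Bd
       (\<gamma> c))) f +
     integral\<^sup>L (density (arclength_measure \<Omega>) (\<lambda>\<sigma>. ennreal (dens (\<gamma>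
       c) \<sigma>))) f"
    unfolding neumann_poincare_def np_measure_def
    using integrable_np_measure[OF \<gamma>_front f, of c] unfolding np_measure_def
    by (intro integral_add_measure np_parts_sets)
  also have "integral\<^sup>L (scale_measure (ennreal (1 - interior_angle \<Omega> (\<gamma> c) / pi))
    (return Bd (\<gamma> c))) f
    = (\<beta> c / pi) *\<^sub>R f (\<gamma> c)"
    unfolding ia using \<beta>(1)[of c] fm
    by (intro integral_scale_return) (auto simp: space_B \<gamma>_front singleton_B)
  also have "integral\<^sup>L (density (arclength_measure \<Omega>) (\<lambda>\<sigma>. ennreal (dens
    (\<gamma> c) \<sigma>))) f
    = (LINT \<sigma>|arclength_measure \<Omega>. dens (\<gamma> c) \<sigma> *\<^sub>R f \<sigma>)"
    using fm np_density_measurable np_density_nonneg \<gamma>_front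
    by (intro integral_density AE_I2) (auto simp: arclength_measure_def space_B)
  also have "\<dots> = (LINT t|I. dens (\<gamma> c) (\<gamma> t) *\<^sub>R f (\<gamma> t))"
    unfolding arclength_measure_def
    by (intro integral_distr \<gamma>_measurable_B borel_measurable_scaleR np_density_measurable fm)
  also have "\<dots> = (LINT t|I. (1 / pi * Im (rtan t / (\<gamma> t - \<gamma> c))) *\<^sub>R f (\<gamma> t))"
  proof (rule integral_cong_AE)
    have fg: "(\<lambda>t. f (\<gamma> t)) \<in> borel_measurable I" by (rule measurable_compose[OF
      \<gamma>_measurable_B fm])
    show "(\<lambda>t. dens (\<gamma> c) (\<gamma> t) *\<^sub>R f (\<gamma> t)) \<in> borel_measurable I"
      by (intro borel_measurable_scaleR fg measurable_compose[OF \<gamma>_measurable_B np_density_measurable])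
    have "(\<lambda>t. 1 / pi * Im (rtan t / (\<gamma> t - \<gamma> c))) \<in> borel_measurable borel"
      using rtan_measurable \<gamma>_measurable by measurable
    then have "(\<lambda>t. 1 / pi * Im (rtan t / (\<gamma> t - \<gamma> c))) \<in> borel_measurable I"
      by (intro measurable_restrict_space1) simp
    then show "(\<lambda>t. (1 / pi * Im (rtan t / (\<gamma> t - \<gamma> c))) *\<^sub>R f (\<gamma> t))
      \<in> borel_measurable I"
      by (intro borel_measurable_scaleR fg)
    show "AE t in I. dens (\<gamma> c) (\<gamma> t) *\<^sub>R f (\<gamma> t) = (1 / pi * Im (rtan t /
      (\<gamma> t - \<gamma> c))) *\<^sub>R f (\<gamma> t)"
      using AE_smooth[of c] AE_I_mem by eventually_elim (use c in \<open>simp add: np_density\<close>)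
  qed
  finally show ?thesis .
qed

end

section \<open>The Cauchy-type integral\<close>

lemma borel_measurable_cnj [measurable]:
  "f \<in> borel_measurable M \<Longrightarrow> (\<lambda>x. cnj (f x)) \<in> borel_measurable M"
  by (rule measurable_compose[OF _ borel_measurable_continuous_onI]) (auto intro: continuous_intros)

context convex_body_interior
begin

lemma finite_measure_I: "finite_measure I"
  using L_pos by (intro finite_measureI) (simp add: emeasure_restrict_space space_restrict_space)

lemma measurable_I: "f \<in> borel_measurable borel \<Longrightarrow> f \<in> borel_measurable I"
  by (intro measurable_restrict_space1) simp

lemma integrable_I_bounded:
  fixes f :: "real \<Rightarrow> complex"
  assumes "f \<in> borel_measurable borel" "\<And>t. norm (f t) \<le> B"
  shows "integrable I f"
proof -
  interpret finite_measure I by (rule finite_measure_I)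
  show ?thesis
    by (rule integrable_const_bound[where B = B, OF AE_I2]) (use assms measurable_I in auto)
qed

lemma integral_I:
  fixes f :: "real \<Rightarrow> complex"
  assumes "f \<in> borel_measurable borel"
  shows "(LINT t|I. f t) = (LINT t:{0..L}|lborel. f t)"
proof -
  have [measurable]: "f \<in> borel_measurable lborel" using assms by simp
  have "(LINT t|I. f t) = (LINT t|lborel. indicator {0..<L} t *\<^sub>R f t)"
    by (subst integral_restrict_space) auto
  also have "\<dots> = (LINT t:{0..L}|lborel. f t)"
    unfolding set_lebesgue_integral_def using AE_lborel_singleton[of L]
    by (intro integral_cong_AE) (auto elim!: eventually_mono simp: indicator_def)
  finally show ?thesis .
qed

lemma isCont_integral_I:
  fixes K :: "complex \<Rightarrow> real \<Rightarrow> complex"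
  assumes U: "open U" "z \<in> U" and meas: "\<And>w. K w \<in> borel_measurable borel"
    and bound: "\<And>w t. w \<in> U \<Longrightarrow> norm (K w t) \<le> B"
    and cont: "AE t in I. isCont (\<lambda>w. K w t) z"
  shows "isCont (\<lambda>w. LINT t|I. K w t) z"
  unfolding continuous_at_sequentially
proof (intro allI impI)
  fix x :: "nat \<Rightarrow> complex" assume x: "x \<longlonglongrightarrow> z"
  interpret finite_measure I by (rule finite_measure_I)
  \<comment> \<open>The bound \<open>B\<close> holds on \<open>U\<close> only, so the finitely many
    terms outside \<open>U\<close> are replaced by the limit \<open>z\<close>.\<close>
  define y where "y n = (if x n \<in> U then x n else z)" for n
  have ev: "\<forall>\<^sub>F n in sequentially. y n = x n"
    using topological_tendstoD[OF x U] by eventually_elim (simp add: y_def)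
  have y: "y \<longlonglongrightarrow> z" by (rule Lim_transform_eventually[OF x]) (use ev in \<open>auto
    elim: eventually_mono\<close>)
  have "(\<lambda>n. LINT t|I. K (y n) t) \<longlonglongrightarrow> (LINT t|I. K z t)"
  proof (rule integral_dominated_convergence[where w = "\<lambda>_. B"])
    show "AE t in I. (\<lambda>n. K (y n) t) \<longlonglongrightarrow> K z t"
      using cont by eventually_elim (rule isCont_tendsto_compose[OF _ y])
    show "AE t in I. norm (K (y n) t) \<le> B" for n
      by (intro AE_I2 bound) (simp add: y_def U)
  qed (auto intro: measurable_I meas)
  moreover have "\<forall>\<^sub>F n in sequentially. (LINT t|I. K (y n) t) = (LINT t|I. K (x n) t)"
    using ev by eventually_elim simp
  ultimately show "((\<lambda>w. LINT t|I. K w t) \<circ> x) \<longlonglongrightarrow> (LINT t|I. K z t)"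
    unfolding o_def by (rule Lim_transform_eventually)
qed

lemma curve_bound: obtains R where "R > 0" "\<And>t. norm (\<gamma> t) \<le> R"
proof -
  obtain R where "R > 0" "\<And>x. x \<in> \<Omega> \<Longrightarrow> norm x \<le> R" using bounded bounded_pos by blast
  then show ?thesis using that \<gamma>_in by blast
qed

lemma \<gamma>_L: "\<gamma> L = \<gamma> 0" using \<gamma>_per[of 0] by simp

lemma integral_rtan: "integrable I rtan" "(LINT t|I. rtan t) = 0"
proof -
  show "integrable I rtan" using rtan_measurable rtan(1) by (intro integrable_I_bounded[where B = 1]) auto
  have "(LINT t:{0..L}|lborel. rtan t) = \<gamma> L - \<gamma> 0"
  proof (rule integral_right_derivative(2)[of 0 L 1 \<gamma> 1 rtan])
    show "norm (\<gamma> t - \<gamma> s) \<le> 1 * (t - s)" if "s \<le> t" for s t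
      using \<gamma>_dist[OF that] by (simp add: dist_norm norm_minus_commute)
  qed (use L_pos rtan_derivative rtan_measurable in auto)
  then show "(LINT t|I. rtan t) = 0" by (simp add: integral_I rtan_measurable \<gamma>_L)
qed

text \<open>\<open>2 * Re (cnj (\<gamma> t) * rtan t)\<close> is the one-sided derivative of the
  squared norm of \<open>\<gamma>\<close>, which returns to its initial value. The imaginary part of
  the integral is twice the enclosed area.\<close>

lemma Re_area_integral: "Re (LINT t|I. cnj (\<gamma> t) * rtan t) = 0"
proof -
  obtain R where R: "R > 0" "\<And>t. norm (\<gamma> t) \<le> R" using curve_bound by blast
  have m: "(\<lambda>t. cnj (\<gamma> t) * rtan t) \<in> borel_measurable borel"
    using \<gamma>_measurable rtan_measurable by measurable
  define F where "F t = \<gamma> t * cnj (\<gamma> t)" for t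
  have "(LINT t:{0..L}|lborel. \<gamma> t * cnj (rtan t) + rtan t * cnj (\<gamma> t)) = F L - F 0"
  proof (rule integral_right_derivative(2)[of 0 L 1 F "2 * R"])
    fix s t :: real assume st: "s \<le> t"
    have d: "norm (\<gamma> t - \<gamma> s) \<le> t - s" using \<gamma>_dist[OF st] by (simp add:
      dist_norm norm_minus_commute)
    have "F t - F s = (\<gamma> t - \<gamma> s) * cnj (\<gamma> t) + \<gamma> s * cnj (\<gamma> t -
      \<gamma> s)" by (simp add: F_def algebra_simps)
    then have "norm (F t - F s) \<le> norm (\<gamma> t - \<gamma> s) * norm (\<gamma> t) + norm (\<gamma>
      s) * norm (\<gamma> t - \<gamma> s)"
      by (metis norm_triangle_ineq norm_mult complex_mod_cnj)
    also have "\<dots> \<le> (t - s) * R + R * (t - s)"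
      using d R by (intro add_mono mult_mono) (use st in auto)
    finally show "norm (F t - F s) \<le> 2 * R * (t - s)" by (simp add: algebra_simps)
  next
    fix t
    have c: "((\<lambda>t. cnj (\<gamma> t)) has_vector_derivative cnj (rtan t)) (at t within {t..})"
      by (rule bounded_linear.has_vector_derivative[OF bounded_linear_cnj rtan_derivative])
    show "(F has_vector_derivative \<gamma> t * cnj (rtan t) + rtan t * cnj (\<gamma> t)) (at t within {t..})"
      unfolding F_def using has_vector_derivative_mult[OF rtan_derivative c] by simp
  qed (use L_pos rtan_measurable \<gamma>_measurable in \<open>auto intro: borel_measurable_add
    borel_measurable_times borel_measurable_cnj\<close>)
  moreover have "\<gamma> t * cnj (rtan t) + rtan t * cnj (\<gamma> t) = complex_of_real (2 * Re (cnj
    (\<gamma> t) * rtan t))" for t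
    by (simp add: complex_eq_iff algebra_simps)
  ultimately have "(LINT t:{0..L}|lborel. complex_of_real (2 * Re (cnj (\<gamma> t) * rtan t))) = 0"
    by (simp add: F_def \<gamma>_L)
  moreover have "(\<lambda>t. complex_of_real (2 * Re (cnj (\<gamma> t) * rtan t))) \<in> borel_measurable borel"
    using m by measurable
  ultimately have 0: "(LINT t|I. complex_of_real (2 * Re (cnj (\<gamma> t) * rtan t))) = 0"
    by (simp only: integral_I)
  have int: "integrable I (\<lambda>t. cnj (\<gamma> t) * rtan t)"
    using R rtan(1) m by (intro integrable_I_bounded[where B = R]) (auto simp: norm_mult)
  have "(LINT t|I. complex_of_real (2 * Re (cnj (\<gamma> t) * rtan t))) = complex_of_real (2 * Re (LINT
    t|I. cnj (\<gamma> t) * rtan t))"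
    by (simp only: integral_complex_of_real integral_mult_right_zero integral_Re[OF int])
  with 0 show ?thesis by simp
qed

text \<open>A separating line puts the curve, seen from \<open>z\<close>, into a half plane, so one
  branch of the logarithm serves the whole closed curve.\<close>

lemma integral_log_outside:
  assumes z: "z \<notin> \<Omega>" shows "(LINT t|I. rtan t / (\<gamma> t - z)) = 0"
proof -
  obtain a b where ab: "inner a z < b" "\<And>x. x \<in> \<Omega> \<Longrightarrow> b < inner a x"
    using separating_hyperplane_closed_point[OF convex closed z] by blast
  have pos: "inner a (\<gamma> t - z) > 0" for t
    using ab(1) ab(2)[OF \<gamma>_in[of t]] by (simp add: inner_diff_right)
  have a: "a \<noteq> 0" using pos[of 0] by auto
  have nz: "\<gamma> t \<noteq> z" for t using z \<gamma>_in by auto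
  have half: "Re ((\<gamma> t - z) / a) \<ge> 0" for t
  proof -
    have "Re ((\<gamma> t - z) / a) = inner a (\<gamma> t - z) / (norm a)\<^sup>2"
      by (simp add: Re_divide inner_complex_def cmod_power2 algebra_simps)
    then show ?thesis using pos[of t] by simp
  qed
  have "(LINT t:{0..L}|lborel. rtan t / (\<gamma> t - z)) = Ln ((\<gamma> L - z) / a) - Ln ((\<gamma> 0 - z) / a)"
    using L_pos a half nz by (intro log_integral(2)) auto
  moreover have "(\<lambda>t. rtan t / (\<gamma> t - z)) \<in> borel_measurable borel"
    using rtan_measurable \<gamma>_measurable by measurable
  ultimately show ?thesis by (simp add: integral_I \<gamma>_L)
qed

text \<open>This is \<open>2 * pi * \<i>\<close> times the function \<open>G\<close> of the
  overview. The conjugate in the numerator cancels the singularity in modulus, so crossing the curve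
  causes no jump.\<close>

definition cauchy_type :: "complex \<Rightarrow> complex" where
  "cauchy_type z = (LINT t|I. cnj (\<gamma> t - z) / (\<gamma> t - z) * rtan t)"

lemma kernel_measurable: "(\<lambda>t. cnj (\<gamma> t - z) / (\<gamma> t - z) * rtan t) \<in> borel_measurable borel"
  using rtan_measurable \<gamma>_measurable by measurable

lemma kernel_norm: "norm (cnj (\<gamma> t - z) / (\<gamma> t - z) * rtan t) \<le> 1"
proof -
  \<comment> \<open>An inequality because the quotient is 0 at \<open>w = 0\<close>.\<close>
  have "norm (cnj w / w) \<le> 1" for w :: complex unfolding norm_divide complex_mod_cnj by simp
  from this[of "\<gamma> t - z"] show ?thesis by (simp only: norm_mult rtan(1) mult_1_right)
qed

text \<open>The kernel is bounded and continuous at \<open>z\<close> for all times of a period but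
  at most one, that with \<open>\<gamma> t = z\<close>, so dominated convergence applies.\<close>

lemma isCont_cauchy_type: "isCont cauchy_type z"
  unfolding cauchy_type_def[abs_def]
proof (rule isCont_integral_I[of UNIV])
  show "AE t in I. isCont (\<lambda>w. cnj (\<gamma> t - w) / (\<gamma> t - w) * rtan t) z"
  proof (cases "z \<in> frontier \<Omega>")
    case True
    then obtain c where c: "0 \<le> c" "c < L" "z = \<gamma> c" by (rule frontierE)
    show ?thesis using AE_smooth[of c] AE_I_mem
    proof eventually_elim
      case (elim t)
      then have "\<gamma> t \<noteq> z" using c \<gamma>_bij by (auto simp: bij_betw_def inj_on_def)
      then show ?case by (intro continuous_intros) auto
    qed
  next
    case False
    then have "\<gamma> t \<noteq> z" for t using \<gamma>_front by auto
    then show ?thesis by (intro AE_I2 continuous_intros) auto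
  qed
qed (simp, simp, rule kernel_measurable, rule kernel_norm)

lemma outside_dist:
  assumes "z \<notin> \<Omega>" obtains d where "d > 0" "\<forall>w\<in>ball z d. \<forall>t. norm
    (\<gamma> t - w) \<ge> d"
    "ball z d \<inter> \<Omega> = {}"
proof -
  have "open (- \<Omega>)" using closed by (simp add: open_Compl)
  then obtain e where e: "e > 0" "ball z e \<subseteq> - \<Omega>" using assms open_contains_ball by blast
  show ?thesis
  proof (rule that[of "e / 2"])
    show "\<forall>w\<in>ball z (e / 2). \<forall>t. norm (\<gamma> t - w) \<ge> e / 2"
    proof (intro ballI allI)
    fix w t assume w: "w \<in> ball z (e / 2)"
    have "\<gamma> t \<notin> ball z e" using e \<gamma>_in by auto
    then have "e \<le> dist z (\<gamma> t)" by simp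
    also have "\<dots> \<le> dist z w + dist w (\<gamma> t)" by (rule dist_triangle)
    finally show "norm (\<gamma> t - w) \<ge> e / 2" using w by (simp add: dist_norm norm_minus_commute)
    qed
  next
    have "ball z (e / 2) \<subseteq> ball z e" using e by (intro subset_ball) simp
    then show "ball z (e / 2) \<inter> \<Omega> = {}" using e by auto
  qed (use e in simp)
qed

text \<open>The summand with \<open>cnj z\<close> is a multiple of the integral in
  \<open>integral_log_outside\<close>; its vanishing removes the conjugate dependence on
  \<open>z\<close>.\<close>

lemma cauchy_type_outside:
  assumes z: "z \<notin> \<Omega>" shows "cauchy_type z = (LINT t|I. cnj (\<gamma> t) * rtan t / (\<gamma> t - z))"
    and "integrable I (\<lambda>t. cnj (\<gamma> t) * rtan t / (\<gamma> t - z))"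
proof -
  obtain d where d: "d > 0" "\<forall>w\<in>ball z d. \<forall>t. norm (\<gamma> t - w) \<ge> d" and
    "ball z d \<inter> \<Omega> = {}"
    by (rule outside_dist[OF z])
  have "z \<in> ball z d" using d(1) by simp
  then have dz: "norm (\<gamma> t - z) \<ge> d" for t using d(2) by blast
  obtain R where R: "R > 0" "\<And>t. norm (\<gamma> t) \<le> R" using curve_bound by blast
  have i1: "integrable I (\<lambda>t. rtan t / (\<gamma> t - z))"
  proof (rule integrable_I_bounded)
    show "norm (rtan t / (\<gamma> t - z)) \<le> 1 / d" for t
      unfolding norm_divide rtan(1) using dz[of t] d(1) less_le_trans[OF d(1) dz[of t]]
      by (intro divide_left_mono mult_pos_pos) auto
  qed (use rtan_measurable \<gamma>_measurable in measurable)
  show i2: "integrable I (\<lambda>t. cnj (\<gamma> t) * rtan t / (\<gamma> t - z))"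
  proof (rule integrable_I_bounded)
    show "norm (cnj (\<gamma> t) * rtan t / (\<gamma> t - z)) \<le> R / d" for t
      unfolding norm_divide norm_mult rtan(1) using dz[of t] d R by (intro frac_le) auto
  qed (use rtan_measurable \<gamma>_measurable in measurable)
  have "cauchy_type z = (LINT t|I. cnj (\<gamma> t) * rtan t / (\<gamma> t - z) - cnj z * (rtan t / (\<gamma> t - z)))"
    unfolding cauchy_type_def by (intro Bochner_Integration.integral_cong) (auto simp: algebra_simps
      diff_divide_distrib)
  also have "\<dots> = (LINT t|I. cnj (\<gamma> t) * rtan t / (\<gamma> t - z)) - cnj z * (LINT t|I. rtan
    t / (\<gamma> t - z))"
    by (subst Bochner_Integration.integral_diff[OF i2 integrable_mult_right[OF i1]])
       (simp only: integral_mult_right_zero)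
  finally show "cauchy_type z = (LINT t|I. cnj (\<gamma> t) * rtan t / (\<gamma> t - z))"
    by (simp add: integral_log_outside[OF z])
qed

text \<open>The difference quotient at \<open>z\<close> is exactly \<open>Q w\<close>, so
  differentiability reduces to continuity of \<open>Q\<close> at \<open>z\<close>.\<close>

lemma cauchy_type_holomorphic: "cauchy_type holomorphic_on - \<Omega>"
proof (rule holomorphic_onI)
  fix z assume "z \<in> - \<Omega>"
  then have z: "z \<notin> \<Omega>" by simp
  obtain d where d: "d > 0" "\<forall>w\<in>ball z d. \<forall>t. norm (\<gamma> t - w) \<ge> d"
    and disj: "ball z d \<inter> \<Omega> = {}" by (rule outside_dist[OF z])
  obtain R where R: "R > 0" "\<And>t. norm (\<gamma> t) \<le> R" using curve_bound by blast
  have zb: "z \<in> ball z d" using d(1) by simp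
  define Q where "Q w = (LINT t|I. cnj (\<gamma> t) * rtan t / ((\<gamma> t - w) * (\<gamma> t - z)))" for w
  have "isCont Q z"
    unfolding Q_def[abs_def]
  proof (rule isCont_integral_I[of "ball z d"])
    show "(\<lambda>t. cnj (\<gamma> t) * rtan t / ((\<gamma> t - w) * (\<gamma> t - z))) \<in>
      borel_measurable borel" for w
      using rtan_measurable \<gamma>_measurable by measurable
    show "norm (cnj (\<gamma> t) * rtan t / ((\<gamma> t - w) * (\<gamma> t - z))) \<le> R / (d * d)" if
      "w \<in> ball z d" for w t
    proof -
      have "d * d \<le> norm (\<gamma> t - w) * norm (\<gamma> t - z)"
        using d that zb by (intro mult_mono) auto
      then show ?thesis unfolding norm_divide norm_mult rtan(1) using d(1) R by (intro frac_le) auto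
    qed
    have "\<gamma> t - z \<noteq> 0" for t using z \<gamma>_in by auto
    then show "AE t in I. isCont (\<lambda>w. cnj (\<gamma> t) * rtan t / ((\<gamma> t - w) * (\<gamma> t - z))) z"
      by (intro AE_I2 continuous_intros) auto
  qed (use zb in auto)
  then have Q: "(Q \<longlongrightarrow> Q z) (at z)" by (simp add: isCont_def)
  have "(cauchy_type has_field_derivative Q z) (at z)"
    unfolding has_field_derivative_iff
  proof (rule Lim_transform_eventually[OF Q])
    have "\<forall>\<^sub>F w in at z. w \<in> ball z d" using zb by (intro eventually_at_in_open') auto
    moreover have "\<forall>\<^sub>F w in at z. w \<noteq> z" by (simp add: eventually_at_filter)
    ultimately show "\<forall>\<^sub>F w in at z. Q w = (cauchy_type w - cauchy_type z) / (w - z)"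
    proof eventually_elim
      case (elim w)
      then have w: "w \<notin> \<Omega>" using disj by auto
      have nz: "\<gamma> t - w \<noteq> 0" "\<gamma> t - z \<noteq> 0" for t using w z \<gamma>_in by auto
      have "cauchy_type w - cauchy_type z = (LINT t|I. cnj (\<gamma> t) * rtan t / (\<gamma> t - w) - cnj
        (\<gamma> t) * rtan t / (\<gamma> t - z))"
        using cauchy_type_outside[OF w] cauchy_type_outside[OF z] by simp
      also have "\<dots> = (LINT t|I. (w - z) * (cnj (\<gamma> t) * rtan t / ((\<gamma> t - w) * (\<gamma> t - z))))"
      proof (intro Bochner_Integration.integral_cong refl)
        fix t
        have "a / x - a / y = (y - x) * (a / (x * y))" if "x \<noteq> 0" "y \<noteq> 0" for a x y :: complex
          using that by (simp add: field_simps)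
        from this[OF nz(1)[of t] nz(2)[of t], of "cnj (\<gamma> t) * rtan t"]
        show "cnj (\<gamma> t) * rtan t / (\<gamma> t - w) - cnj (\<gamma> t) * rtan t / (\<gamma> t - z)
          = (w - z) * (cnj (\<gamma> t) * rtan t / ((\<gamma> t - w) * (\<gamma> t - z)))"
          by simp
      qed
      also have "\<dots> = (w - z) * Q w" unfolding Q_def by (rule integral_mult_right_zero)
      finally show ?case using elim by simp
    qed
  qed
  then show "cauchy_type field_differentiable at z within - \<Omega>"
    using field_differentiable_at_within field_differentiable_def by blast
qed

text \<open>Subtracting the claimed limit cancels the leading term: the integrand becomes \<open>cnj
  (\<gamma> t) * rtan t * (\<gamma> t - k) / (\<gamma> t - z)\<close>, of order
  \<open>1 / norm z\<close>.\<close>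

lemma cauchy_type_at_infinity:
  "((\<lambda>z. (z - k) * cauchy_type z) \<longlongrightarrow> - (LINT t|I. cnj (\<gamma> t) * rtan t)) at_infinity"
proof -
  obtain R where R: "R > 0" "\<And>t. norm (\<gamma> t) \<le> R" using curve_bound by blast
  define J where "J = (LINT t|I. cnj (\<gamma> t) * rtan t)"
  have iJ: "integrable I (\<lambda>t. cnj (\<gamma> t) * rtan t)"
  proof (rule integrable_I_bounded)
    show "norm (cnj (\<gamma> t) * rtan t) \<le> R" for t using R by (simp add: norm_mult rtan(1))
  qed (use rtan_measurable \<gamma>_measurable in measurable)
  define C where "C = R * (R + norm k) * L"
  have meas_I: "measure I (space I) = L"
    using L_pos by (simp add: measure_restrict_space space_restrict_space)
  have est: "norm ((z - k) * cauchy_type z + J) \<le> C / (norm z - R)" if z: "norm z > R" "z \<notin> \<Omega>" for z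
  proof -
    note ct = cauchy_type_outside[OF z(2)]
    have nz: "\<gamma> t - z \<noteq> 0" for t using z \<gamma>_in by auto
    have "(z - k) * cauchy_type z + J = (LINT t|I. (z - k) * (cnj (\<gamma> t) * rtan t / (\<gamma> t -
      z)) + cnj (\<gamma> t) * rtan t)"
      unfolding ct(1) J_def
      by (subst Bochner_Integration.integral_add[OF integrable_mult_right[OF ct(2)] iJ])
         (simp only: integral_mult_right_zero)
    also have "\<dots> = (LINT t|I. cnj (\<gamma> t) * rtan t * (\<gamma> t - k) / (\<gamma> t - z))"
    proof (intro Bochner_Integration.integral_cong refl)
      fix t
      show "(z - k) * (cnj (\<gamma> t) * rtan t / (\<gamma> t - z)) + cnj (\<gamma> t) * rtan t = cnj
        (\<gamma> t) * rtan t * (\<gamma> t - k) / (\<gamma> t - z)"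
        using nz[of t] by (simp add: divide_simps) (simp add: algebra_simps)
    qed
    finally have e: "(z - k) * cauchy_type z + J = (LINT t|I. cnj (\<gamma> t) * rtan t * (\<gamma> t -
      k) / (\<gamma> t - z))" .
    have b: "norm (cnj (\<gamma> t) * rtan t * (\<gamma> t - k) / (\<gamma> t - z)) \<le> R * (R + norm
      k) / (norm z - R)" for t
    proof -
      have "norm (\<gamma> t - k) \<le> R + norm k" using norm_triangle_ineq4[of "\<gamma> t" k] R(2)[of t] by linarith
      moreover have "norm z - R \<le> norm (\<gamma> t - z)"
        using norm_triangle_ineq2[of z "\<gamma> t"] R(2)[of t] by (simp add: norm_minus_commute)
      ultimately show ?thesis
        unfolding norm_divide norm_mult rtan(1) using R z by (intro frac_le mult_mono) auto
    qed
    interpret finite_measure I by (rule finite_measure_I)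
    have "norm (LINT t|I. cnj (\<gamma> t) * rtan t * (\<gamma> t - k) / (\<gamma> t - z)) \<le> (LINT
      t|I. norm (cnj (\<gamma> t) * rtan t * (\<gamma> t - k) / (\<gamma> t - z)))"
      by (rule integral_norm_bound)
    also have "\<dots> \<le> (LINT t|I. R * (R + norm k) / (norm z - R))"
    proof (rule integral_mono)
      have "integrable I (\<lambda>t. cnj (\<gamma> t) * rtan t * (\<gamma> t - k) / (\<gamma> t - z))"
      proof (rule integrable_I_bounded)
        show "norm (cnj (\<gamma> t) * rtan t * (\<gamma> t - k) / (\<gamma> t - z)) \<le> R * (R + norm
          k) / (norm z - R)" for t by (rule b)
      qed (use rtan_measurable \<gamma>_measurable in measurable)
      then show "integrable I (\<lambda>t. norm (cnj (\<gamma> t) * rtan t * (\<gamma> t - k) / (\<gamma> t - z)))"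
        by (rule integrable_norm)
    qed (use b in auto)
    also have "\<dots> = C / (norm z - R)" using meas_I by (simp add: C_def)
    finally show ?thesis by (simp only: e)
  qed
  have "((\<lambda>z::complex. C / (norm z - R)) \<longlongrightarrow> 0) at_infinity"
  proof (rule tendsto_divide_0[OF tendsto_const])
    have "filterlim (\<lambda>z::complex. - R + norm z) at_top at_infinity"
      by (intro filterlim_tendsto_add_at_top[OF tendsto_const] filterlim_norm_at_top)
    then show "filterlim (\<lambda>z::complex. norm z - R) at_infinity at_infinity"
      using filterlim_at_top_imp_at_infinity by fastforce
  qed
  moreover have "\<forall>\<^sub>F z in at_infinity. norm ((z - k) * cauchy_type z + J) \<le> C / (norm z - R)"
  proof -
    obtain R' where R': "\<And>x. x \<in> \<Omega> \<Longrightarrow> norm x \<le> R'" using bounded bounded_iff by blast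
    have "\<forall>\<^sub>F z :: complex in at_infinity. max R R' < norm z"
      using filterlim_norm_at_top filterlim_at_top_dense by blast
    then show ?thesis
    proof eventually_elim
      case (elim z)
      then have "z \<notin> \<Omega>" using R'[of z] by auto
      then show ?case using est[of z] elim by simp
    qed
  qed
  ultimately have "((\<lambda>z. (z - k) * cauchy_type z + J) \<longlongrightarrow> 0) at_infinity"
    by (rule Lim_null_comparison[rotated])
  then have "((\<lambda>z. (z - k) * cauchy_type z - - J) \<longlongrightarrow> 0) at_infinity" by simp
  then show ?thesis unfolding J_def[symmetric] by (rule LIM_zero_cancel)
qed

text \<open>Multiplying the kernel by \<open>\<sigma> - \<zeta>\<close> splits it into
  \<open>d\<sigma>\<close>, which integrates to zero, and
  the conjugate of \<open>cnj (\<sigma> - \<zeta>) / (\<sigma> - \<zeta>) d\<sigma>\<close>.\<close>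

lemma neumann_poincare_id:
  assumes z: "z \<in> frontier \<Omega>"
  shows "cauchy_type z = 2 * of_real pi * \<i> * cnj (NP (\<lambda>w. w) z - z)"
proof -
  obtain c where c: "0 \<le> c" "c < L" "z = \<gamma> c" using z by (rule frontierE)
  define \<rho> where "\<rho> t = 1 / pi * Im (rtan t / (\<gamma> t - \<gamma> c))" for t
  have \<rho>_meas: "\<rho> \<in> borel_measurable borel"
    unfolding \<rho>_def using rtan_measurable \<gamma>_measurable by measurable
  have "has_bochner_integral I \<rho> ((pi - \<beta> c) / pi)"
  proof (rule has_bochner_integral_nn_integral)
    show "AE t in I. 0 \<le> \<rho> t" using density_nonneg by (simp add: \<rho>_def)
    show "(\<integral>\<^sup>+t. ennreal (\<rho> t) \<partial>I) = ennreal ((pi - \<beta> c) / pi)"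
      unfolding \<rho>_def by (rule nn_integral_kernel[OF c(1,2)])
    show "0 \<le> (pi - \<beta> c) / pi" using \<beta>(2)[of c] by simp
  qed (rule measurable_I[OF \<rho>_meas])
  then have \<rho>: "integrable I \<rho>" "(LINT t|I. \<rho> t) = (pi - \<beta> c) / pi"
    by (auto simp: has_bochner_integral_iff)
  \<comment> \<open>This will be \<open>\<rho> t * (\<gamma> t - z)\<close>: the imaginary part in
    \<open>\<rho>\<close> is \<open>(w - cnj w) / (2 * \<i>)\<close> with
    \<open>w = rtan t / (\<gamma> t - z)\<close>.\<close>
  define g where "g t = (rtan t - cnj (cnj (\<gamma> t - z) / (\<gamma> t - z) * rtan t)) / (2 * of_real
    pi * \<i>)" for t
  have kint: "integrable I (\<lambda>t. cnj (\<gamma> t - z) / (\<gamma> t - z) * rtan t)"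
    by (rule integrable_I_bounded[OF kernel_measurable kernel_norm])
  have cint: "integrable I (\<lambda>t. cnj (cnj (\<gamma> t - z) / (\<gamma> t - z) * rtan t))"
    using kint by (rule integrable_cnj)
  have dint: "integrable I (\<lambda>t. rtan t - cnj (cnj (\<gamma> t - z) / (\<gamma> t - z) * rtan t))"
    using integral_rtan(1) cint by (rule Bochner_Integration.integrable_diff)
  have g_int: "integrable I g"
    unfolding g_def by (rule integrable_divide_zero) (rule dint)
  have g_val: "(LINT t|I. g t) = - cnj (cauchy_type z) / (2 * of_real pi * \<i>)"
    unfolding g_def integral_divide_zero Bochner_Integration.integral_diff[OF integral_rtan(1) cint]
      integral_rtan(2) Bochner_Integration.integral_cnj cauchy_type_def[symmetric] by simp
  have g_meas: "g \<in> borel_measurable I" using g_int by simp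
  have g_eq: "AE t in I. \<rho> t *\<^sub>R \<gamma> t = of_real (\<rho> t) * z + g t"
    using AE_smooth[of c] AE_I_mem
  proof eventually_elim
    case (elim t)
    then have nz: "\<gamma> t - z \<noteq> 0" using c \<gamma>_bij by (auto simp: bij_betw_def inj_on_def)
    define w where "w = rtan t / (\<gamma> t - z)"
    have "of_real (\<rho> t) = (w - cnj w) / (2 * of_real pi * \<i>)"
      unfolding complex_diff_cnj by (simp add: \<rho>_def w_def c(3))
    then have "of_real (\<rho> t) * (\<gamma> t - z) = (rtan t / (\<gamma> t - z) - cnj (rtan t /
      (\<gamma> t - z))) / (2 * of_real pi * \<i>) * (\<gamma> t - z)"
      by (simp only: w_def)
    also have "\<dots> = (rtan t / (\<gamma> t - z) - cnj (rtan t / (\<gamma> t - z))) * (\<gamma> t - z)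
      / (2 * of_real pi * \<i>)"
      by (rule times_divide_eq_left)
    finally have e: "of_real (\<rho> t) * (\<gamma> t - z) = (rtan t / (\<gamma> t - z) - cnj (rtan t /
      (\<gamma> t - z))) * (\<gamma> t - z) / (2 * of_real pi * \<i>)" .
    have "(a / u - cnj (a / u)) * u = a - cnj (cnj u / u * a)" if "u \<noteq> 0" for a u :: complex
      using that by (simp add: left_diff_distrib)
    from this[OF nz, of "rtan t"]
    have "(rtan t / (\<gamma> t - z) - cnj (rtan t / (\<gamma> t - z))) * (\<gamma> t - z) / (2 * of_real
      pi * \<i>) = g t"
      unfolding g_def by (rule arg_cong)
    with e have "of_real (\<rho> t) * (\<gamma> t - z) = g t" by (rule trans)
    then show ?case by (simp add: scaleR_conv_of_real algebra_simps)
  qed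
  have \<gamma>_I: "\<gamma> \<in> borel_measurable I" by (rule measurable_I[OF \<gamma>_measurable])
  have m1: "(\<lambda>t. \<rho> t *\<^sub>R \<gamma> t) \<in> borel_measurable I"
    using measurable_I[OF \<rho>_meas] \<gamma>_I by measurable
  have i\<rho>: "integrable I (\<lambda>t. complex_of_real (\<rho> t) * z)" using \<rho>(1) by simp
  have m2: "(\<lambda>t. of_real (\<rho> t) * z + g t) \<in> borel_measurable I"
    using i\<rho> g_int by simp
  have "(LINT t|I. \<rho> t *\<^sub>R \<gamma> t) = (LINT t|I. of_real (\<rho> t) * z + g t)"
    by (rule integral_cong_AE[OF m1 m2 g_eq])
  also have "\<dots> = of_real ((pi - \<beta> c) / pi) * z + - cnj (cauchy_type z) / (2 * of_real pi * \<i>)"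
    using i\<rho> g_int by (simp add: \<rho>(2) g_val)
  finally have "NP (\<lambda>w. w) z = (\<beta> c / pi) *\<^sub>R z + (of_real ((pi - \<beta> c) / pi) *
    z + - cnj (cauchy_type z) / (2 * of_real pi * \<i>))"
    unfolding c(3) by (subst neumann_poincare_eq[OF c(1,2)]) (auto simp: \<rho>_def)
  \<comment> \<open>The atom and the total mass of \<open>\<rho>\<close> together give
    \<open>z\<close> exactly once.\<close>
  also have "\<dots> = (\<beta> c / pi + (pi - \<beta> c) / pi) *\<^sub>R z - cnj (cauchy_type z) / (2 *
    of_real pi * \<i>)"
    by (simp only: scaleR_conv_of_real of_real_add) (simp add: distrib_right)
  also have "\<beta> c / pi + (pi - \<beta> c) / pi = 1" by (simp add: add_divide_distrib[symmetric])
  finally have "NP (\<lambda>w. w) z - z = - cnj (cauchy_type z) / (2 * of_real pi * \<i>)" by simp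
  then show ?thesis by simp
qed

end

section \<open>Disks\<close>

text \<open>The maximum principle for \<open>exp (\<plusminus> \<i> H)\<close> makes \<open>Im H\<close>
  vanish in the exterior of \<open>S\<close>.\<close>

lemma exterior_real_boundary_constant:
  fixes H :: "complex \<Rightarrow> complex"
  assumes S: "compact S" "convex S"
    and cont: "continuous_on UNIV H" and hol: "H holomorphic_on - S"
    and real: "\<And>z. z \<in> frontier S \<Longrightarrow> Im (H z) = 0"
    and lim: "(H \<longlongrightarrow> of_real l) at_infinity"
  obtains c where "\<And>z. z \<in> frontier S \<Longrightarrow> H z = c"
proof -
  have op: "open (- S)" using S(1) by (simp add: compact_imp_closed open_Compl)
  have con: "connected (- S)"
    by (rule connected_complement_bounded_convex) (use S in \<open>auto intro: compact_imp_bounded\<close>)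
  have le: "Im (k * H z) \<le> 0" if z: "z \<notin> S" and k: "k = 1 \<or> k = - 1" for z and k :: complex
  proof (rule field_le_epsilon)
    fix \<epsilon> :: real assume e: "\<epsilon> > 0"
    have "((\<lambda>z. Im (H z)) \<longlongrightarrow> Im (of_real l)) at_infinity" by (intro tendsto_intros lim)
    then have "\<forall>\<^sub>F z in at_infinity. \<bar>Im (H z)\<bar> < \<epsilon>" using e by (simp
      add: tendsto_iff dist_real_def)
    then obtain R where R: "\<And>z. norm z \<ge> R \<Longrightarrow> \<bar>Im (H z)\<bar> < \<epsilon>"
      by (auto simp: eventually_at_infinity)
    \<comment> \<open>The exterior is cut off by a circle beyond \<open>z\<close> on which
      \<open>Im (H w)\<close> is already small.\<close>
    define R' where "R' = max R (norm z) + 1"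
    have R': "R \<le> R'" "norm z < R'" by (auto simp: R'_def)
    define U where "U = ball 0 R' \<inter> - S"
    have U: "open U" "bounded U" "z \<in> U" using op R' z by (auto simp: U_def)
    \<comment> \<open>The norm of this exponential is \<open>exp (Im (k * H z))\<close>; the two
      values of \<open>k\<close> give the upper and the lower bound.\<close>
    have "norm (exp (- \<i> * (k * H z))) \<le> exp \<epsilon>"
    proof (rule maximum_modulus_frontier[where f = "\<lambda>z. exp (- \<i> * (k * H z))" and S = U])
      show "(\<lambda>z. exp (- \<i> * (k * H z))) holomorphic_on interior U"
        unfolding interior_open[OF U(1)]
        by (intro holomorphic_intros holomorphic_on_subset[OF hol]) (auto simp: U_def)
      show "continuous_on (closure U) (\<lambda>z. exp (- \<i> * (k * H z)))"
        by (intro continuous_intros continuous_on_subset[OF cont]) auto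
      fix w assume w: "w \<in> frontier U"
      have "frontier U \<subseteq> frontier (ball 0 R') \<union> frontier (- S)"
        unfolding U_def by (rule frontier_Int_subset)
      then have "w \<in> frontier (ball 0 R') \<or> w \<in> frontier S" using w by (auto simp: frontier_complement)
      then have "\<bar>Im (H w)\<bar> \<le> \<epsilon>"
      proof
        assume "w \<in> frontier (ball 0 R')"
        then have "norm w = R'" using le_less_trans[OF norm_ge_zero R'(2)] by (subst (asm) frontier_ball) auto
        then show ?thesis using R[of w] R' by simp
      qed (use real e in auto)
      then show "norm (exp (- \<i> * (k * H w))) \<le> exp \<epsilon>" using k by auto
    qed (use U in auto)
    then show "Im (k * H z) \<le> 0 + \<epsilon>" by simp
  qed
  have im0: "Im (H z) = 0" if "z \<notin> S" for z
    using le[OF that, of 1] le[OF that, of "- 1"] by simp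
  \<comment> \<open>\<open>H\<close> is now real outside \<open>S\<close>, so this function has
    modulus 1 throughout and attains its maximum inside the domain.\<close>
  have "(\<lambda>z. exp (\<i> * H z)) constant_on - S"
  proof (cases "- S = {}")
    case False
    then obtain z where z: "z \<in> - S" by blast
    show ?thesis
    proof (rule maximum_modulus_principle[OF _ op con op order_refl z])
      show "(\<lambda>z. exp (\<i> * H z)) holomorphic_on - S" by (intro holomorphic_intros hol)
    qed (use z im0 in auto)
  qed (simp add: constant_on_def)
  then obtain e where e: "\<And>z. z \<in> - S \<Longrightarrow> exp (\<i> * H z) = e" by (auto simp: constant_on_def)
  have "\<exists>c. \<forall>z\<in>- S. H z = c"
  proof (cases "- S = {}")
    case False
    then obtain w where w: "w \<in> - S" by blast
    have "H z = H w" if z: "z \<in> - S" for z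
    proof -
      \<comment> \<open>\<open>\<i> * H\<close> and a constant are continuous logarithms of the same
        constant function.\<close>
      have "\<i> * H z - \<i> * H w = \<i> * H w - \<i> * H w"
        by (rule continuous_logs_increment[OF con _ _ _ z w, of "\<lambda>z. \<i> * H z" "\<lambda>_. \<i> * H w"])
           (use e w in \<open>auto intro!: continuous_intros continuous_on_subset[OF cont]\<close>)
      then show ?thesis by simp
    qed
    then show ?thesis by blast
  qed simp
  then obtain c where c: "\<And>z. z \<in> - S \<Longrightarrow> H z = c" by blast
  \<comment> \<open>The frontier of \<open>S\<close> lies in the closure of the exterior, and
    continuity carries the value there.\<close>
  have "H z = c" if "z \<in> closure (- S)" for z
    by (rule continuous_constant_on_closure[OF _ c that]) (use cont continuous_on_subset in blast)
  then show ?thesis using that by (auto simp: frontier_closures)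
qed

text \<open>The frontier spans the body, which gives one inclusion. For the other, the open ball is
  connected, meets the body and misses its frontier, so it lies inside.\<close>

lemma convex_body_cball:
  fixes S :: "complex set"
  assumes S: "compact S" "convex S" "interior S \<noteq> {}" and fr: "\<And>z. z \<in> frontier S
    \<Longrightarrow> norm (z - k) = r"
  shows "0 < r \<and> S = cball k r"
proof -
  have "frontier S \<subseteq> cball k r" using fr by (auto simp: dist_norm norm_minus_commute)
  then have "convex hull (frontier S) \<subseteq> cball k r" by (intro hull_minimal) auto
  then have sub: "S \<subseteq> cball k r" using Krein_Milman_frontier[OF S(2,1)] by simp
  have int: "interior S \<subseteq> ball k r" using interior_mono[OF sub] by (simp add: interior_cball)
  then have r: "r > 0" using S(3) by (metis ball_eq_empty not_le subset_empty)
  have "ball k r - S = {}"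
  proof (rule ccontr)
    assume "ball k r - S \<noteq> {}"
    moreover have "ball k r \<inter> S \<noteq> {}" using int S(3) interior_subset by blast
    ultimately have "ball k r \<inter> frontier S \<noteq> {}" by (intro connected_Int_frontier) auto
    then show False using fr by (auto simp: dist_norm norm_minus_commute)
  qed
  then have "closure (ball k r) \<subseteq> S" using S(1) by (intro closure_minimal) (auto intro: compact_imp_closed)
  then show ?thesis using r sub by (auto simp: closure_ball)
qed

context convex_body_interior
begin

lemma disk_if_neumann_poincare_id_constant:
  assumes const: "\<And>z. z \<in> frontier \<Omega> \<Longrightarrow> NP (\<lambda>w. w) z = k"
  shows "\<exists>c r. 0 < r \<and> \<Omega> = cball c r"
proof -
  define H where "H z = (z - k) * cauchy_type z / (2 * of_real pi * \<i>)" for z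
  define J where "J = (LINT t|I. cnj (\<gamma> t) * rtan t)"
  have H_fr: "H z = of_real (- (norm (z - k))\<^sup>2)" if "z \<in> frontier \<Omega>" for z
  proof -
    have "H z = (z - k) * cnj (k - z)"
    proof -
      have "a * (b * x) / b = a * x" if "b \<noteq> 0" for a b x :: complex using that by simp
      from this[of "2 * of_real pi * \<i>"] show ?thesis
        unfolding H_def neumann_poincare_id[OF that] const[OF that] by simp
    qed
    also have "\<dots> = - ((z - k) * cnj (z - k))" by (simp add: algebra_simps)
    also have "\<dots> = of_real (- (norm (z - k))\<^sup>2)" by (simp only: complex_norm_square of_real_minus)
    finally show ?thesis .
  qed
  have cont: "continuous_on UNIV H"
    unfolding H_def using isCont_cauchy_type
    by (intro continuous_intros continuous_at_imp_continuous_on) auto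
  have hol: "H holomorphic_on - \<Omega>"
    unfolding H_def by (intro holomorphic_intros cauchy_type_holomorphic) auto
  have "((\<lambda>z. (z - k) * cauchy_type z / (2 * of_real pi * \<i>)) \<longlongrightarrow> - J / (2 *
    of_real pi * \<i>)) at_infinity"
    unfolding J_def by (intro tendsto_divide cauchy_type_at_infinity tendsto_const) simp
  \<comment> \<open>A purely imaginary integral divided by \<open>2 * pi * \<i>\<close> is real, as
    the maximum principle requires.\<close>
  moreover have "J = of_real (Im J) * \<i>" using Re_area_integral by (simp add: complex_eq_iff J_def)
  then have "- J / (2 * of_real pi * \<i>) = of_real (- Im J / (2 * pi))"
    by (metis (no_types, lifting) J_def complex_i_not_zero nonzero_mult_divide_mult_cancel_right
      minus_mult_left of_real_divide of_real_minus of_real_mult of_real_numeral)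
  ultimately have lim: "(H \<longlongrightarrow> of_real (- Im J / (2 * pi))) at_infinity"
    unfolding H_def[abs_def] by simp
  obtain c where c: "\<And>z. z \<in> frontier \<Omega> \<Longrightarrow> H z = c"
    by (rule exterior_real_boundary_constant[OF compact convex cont hol _ lim]) (simp_all add: H_fr)
  have "(norm (z - k))\<^sup>2 = - Re c" if "z \<in> frontier \<Omega>" for z
    using c[OF that] H_fr[OF that] by (metis Re_complex_of_real minus_minus)
  then have "norm (z - k) = sqrt (- Re c)" if "z \<in> frontier \<Omega>" for z
    using that by (metis norm_ge_zero real_sqrt_unique)
  then show ?thesis using convex_body_cball[OF compact convex interior_nonempty] by blast
qed

section \<open>The operator on a disk\<close>

lemma cball_support:
  assumes \<Omega>: "\<Omega> = cball a r" and r: "r > 0" and w: "norm (w - a) = r"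
    and \<tau>: "norm \<tau> = 1" "\<And>z. z \<in> \<Omega> \<Longrightarrow> cross \<tau> (z - w) \<ge> 0"
  shows "\<tau> = \<i> * (w - a) / r"
proof -
  define y where "y = cnj \<tau> * (a - w)"
  have ny: "norm y = r" using w \<tau>(1) by (simp add: y_def norm_mult norm_minus_commute)
  \<comment> \<open>The point of the disk farthest to the right of \<open>\<tau>\<close>. As it is
    not beyond the tangent, the centre has distance at least \<open>r\<close> from the tangent; it
    has distance \<open>r\<close> from \<open>w\<close>, which fixes the direction.\<close>
  have "a - r *\<^sub>R (\<i> * \<tau>) \<in> \<Omega>" using \<tau>(1) r by (simp add: \<Omega> dist_norm norm_mult)
  then have "0 \<le> cross \<tau> (a - r *\<^sub>R (\<i> * \<tau>) - w)" by (rule \<tau>(2))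
  also have "\<dots> = Im y - r * (norm \<tau>)\<^sup>2"
    unfolding y_def cross_expand cmod_power2 by (simp add: algebra_simps power2_eq_square)
  finally have "r \<le> Im y" using \<tau>(1) by simp
  moreover have "(Re y)\<^sup>2 + (Im y)\<^sup>2 = r\<^sup>2" using ny by (simp flip: cmod_power2)
  moreover have "Im y \<le> r" using abs_Im_le_cmod[of y] ny by simp
  ultimately have "y = \<i> * of_real r" by (simp add: complex_eq_iff)
  then have "\<tau> * y = \<tau> * (\<i> * of_real r)" by simp
  moreover have "\<tau> * cnj \<tau> = 1" using \<tau>(1) complex_norm_square[of \<tau>] by simp
  then have "\<tau> * y = a - w" unfolding y_def by (metis mult.assoc mult_1)
  ultimately have "\<tau> * \<i> * of_real r = a - w" by (simp add: mult.assoc)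
  then have "\<i> * (\<tau> * \<i> * of_real r) = \<i> * (a - w)" by simp
  then have "\<tau> * of_real r = \<i> * (w - a)" by (simp add: algebra_simps)
  then show ?thesis using r by (simp add: eq_divide_eq)
qed

text \<open>The inscribed angle theorem: seen from a boundary point, the circle is traversed at half
  the angular speed seen from the centre. So the kernel is constant, and there are no
  corners.\<close>

lemma neumann_poincare_cball:
  assumes \<Omega>: "\<Omega> = cball a r" and r: "r > 0" and f: "continuous_on (frontier \<Omega>) f"
    and z: "z \<in> frontier \<Omega>"
  shows "NP f z = (LINT t|I. (1 / (2 * pi * r)) *\<^sub>R f (\<gamma> t))"
proof -
  obtain c where c: "0 \<le> c" "c < L" "z = \<gamma> c" using z by (rule frontierE)
  have n: "norm (\<gamma> t - a) = r" for t
    using \<gamma>_front[of t] r unfolding \<Omega> frontier_cball by (simp add: dist_norm norm_minus_commute)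
  have rtan_eq: "rtan t = \<i> * (\<gamma> t - a) / r" for t by (rule cball_support[OF \<Omega> r n rtan(1) rtan(3)])
  have ltan_eq: "ltan t = \<i> * (\<gamma> t - a) / r" for t by (rule cball_support[OF \<Omega> r n ltan(1) ltan(3)])
  have \<beta>0: "\<beta> c = 0" using \<beta>(3)[of c] rtan_eq ltan_eq by simp
  have kernel: "Im (rtan t / (\<gamma> t - \<gamma> c)) = 1 / (2 * r)" if ne: "\<gamma> t \<noteq> \<gamma> c" for t
  proof -
    define u where "u = \<gamma> t - a"
    define v where "v = \<gamma> c - a"
    have uv: "(Re u)\<^sup>2 + (Im u)\<^sup>2 = r\<^sup>2" "(Re v)\<^sup>2 + (Im v)\<^sup>2 = r\<^sup>2"
      unfolding cmod_power2[symmetric] using n[of t] n[of c] by (simp_all add: u_def v_def)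
    have d: "\<gamma> t - \<gamma> c = u - v" "u - v \<noteq> 0" using ne by (auto simp: u_def v_def)
    \<comment> \<open>Half of this is \<open>r\<^sup>2 - (Re u * Re v + Im u * Im v)\<close>, which
      is \<open>r\<close> times the cross product below, so the positions of the two points
      cancel.\<close>
    have D: "(norm (u - v))\<^sup>2 = 2 * (r\<^sup>2 - (Re u * Re v + Im u * Im v))"
      unfolding cmod_power2 using uv by (simp add: power2_eq_square algebra_simps)
    have D0: "(norm (u - v))\<^sup>2 \<noteq> 0" using d by simp
    have "Im (rtan t / (\<gamma> t - \<gamma> c)) = cross (u - v) (\<i> * u / r) / (norm (u - v))\<^sup>2"
      unfolding Im_divide_cross rtan_eq d(1) u_def[symmetric] ..
    also have "cross (u - v) (\<i> * u / r) = ((Re u)\<^sup>2 + (Im u)\<^sup>2 - (Re u * Re v + Im u * Im v)) / r"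
      using r by (simp add: cross_expand field_simps power2_eq_square)
    also have "\<dots> = (norm (u - v))\<^sup>2 / (2 * r)" unfolding D uv by (rule
      mult_divide_mult_cancel_left[symmetric]) simp
    finally show ?thesis using D0 by simp
  qed
  have "NP f z = (LINT t|I. (1 / pi * Im (rtan t / (\<gamma> t - \<gamma> c))) *\<^sub>R f (\<gamma> t))"
    unfolding c(3) neumann_poincare_eq[OF c(1,2) f] \<beta>0 by simp
  also have "\<dots> = (LINT t|I. (1 / (2 * pi * r)) *\<^sub>R f (\<gamma> t))"
  proof (rule integral_cong_AE)
    have fg: "(\<lambda>t. f (\<gamma> t)) \<in> borel_measurable I"
      by (rule measurable_compose[OF \<gamma>_measurable_B borel_measurable_continuous_on_restrict[OF f]])
    show "(\<lambda>t. (1 / (2 * pi * r)) *\<^sub>R f (\<gamma> t)) \<in> borel_measurable I" using fg by simp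
    have "(\<lambda>t. 1 / pi * Im (rtan t / (\<gamma> t - \<gamma> c))) \<in> borel_measurable borel"
      using rtan_measurable \<gamma>_measurable by measurable
    then show "(\<lambda>t. (1 / pi * Im (rtan t / (\<gamma> t - \<gamma> c))) *\<^sub>R f (\<gamma> t))
      \<in> borel_measurable I"
      by (intro borel_measurable_scaleR fg measurable_I)
    show "AE t in I. (1 / pi * Im (rtan t / (\<gamma> t - \<gamma> c))) *\<^sub>R f (\<gamma> t) = (1 /
      (2 * pi * r)) *\<^sub>R f (\<gamma> t)"
      using AE_smooth[of c] AE_I_mem
    proof eventually_elim
      case (elim t)
      then have "\<gamma> t \<noteq> \<gamma> c" using c \<gamma>_bij by (auto simp: bij_betw_def inj_on_def)
      then show ?case by (simp add: kernel)
    qed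
  qed
  finally show ?thesis .
qed

section \<open>Quotient norms and operator norms\<close>

lemma frontier_nonempty: "frontier \<Omega> \<noteq> {}" using \<gamma>_front by blast

text \<open>Suprema are taken in the reals and bound their terms only if these are bounded;
  \<open>B\<close> ensures this.\<close>

lemma norm_le_SUP:
  fixes g :: "complex \<Rightarrow> complex"
  assumes "\<And>z. z \<in> frontier \<Omega> \<Longrightarrow> norm (g z) \<le> B" "w \<in> frontier \<Omega>"
  shows "norm (g w - c) \<le> (SUP \<zeta>\<in>frontier \<Omega>. norm (g \<zeta> - c))"
proof (rule cSUP_upper[OF assms(2) bdd_aboveI2])
  show "norm (g x - c) \<le> B + norm c" if "x \<in> frontier \<Omega>" for x
    using norm_triangle_ineq4[of "g x" c] assms(1)[OF that] by linarith
qed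

lemma quotient_norm_le:
  assumes B: "\<And>z. z \<in> frontier \<Omega> \<Longrightarrow> norm (g z) \<le> B"
    and C: "\<And>z. z \<in> frontier \<Omega> \<Longrightarrow> norm (g z - c) \<le> C"
  shows "0 \<le> quotient_norm \<Omega> g" "quotient_norm \<Omega> g \<le> C"
proof -
  have nn: "0 \<le> (SUP \<zeta>\<in>frontier \<Omega>. norm (g \<zeta> - d))" for d
  proof -
    obtain z where z: "z \<in> frontier \<Omega>" using frontier_nonempty by blast
    show ?thesis by (rule order_trans[OF norm_ge_zero norm_le_SUP[OF B z]])
  qed
  then show "0 \<le> quotient_norm \<Omega> g" unfolding quotient_norm_def by (intro cINF_greatest) auto
  have "quotient_norm \<Omega> g \<le> (SUP \<zeta>\<in>frontier \<Omega>. norm (g \<zeta> - c))"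
    unfolding quotient_norm_def by (intro cINF_lower bdd_belowI2[where m = 0] nn) auto
  also have "\<dots> \<le> C" using C by (intro cSUP_least frontier_nonempty)
  finally show "quotient_norm \<Omega> g \<le> C" .
qed

text \<open>This avoids choosing a minimizing constant: a constant within \<open>e / 2\<close> of
  all values keeps any two values within \<open>e\<close> of each other.\<close>

lemma quotient_norm_0D:
  assumes B: "\<And>z. z \<in> frontier \<Omega> \<Longrightarrow> norm (g z) \<le> B"
    and 0: "quotient_norm \<Omega> g = 0" and z: "z \<in> frontier \<Omega>" and w: "w \<in> frontier \<Omega>"
  shows "g z = g w"
proof -
  have "norm (g z - g w) \<le> 0 + e" if e: "e > 0" for e
  proof -
    have "quotient_norm \<Omega> g < e / 2" using 0 e by simp
    then obtain c where c: "(SUP \<zeta>\<in>frontier \<Omega>. norm (g \<zeta> - c)) < e / 2"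
      unfolding quotient_norm_def using cInf_lessD[of "range (\<lambda>c. SUP \<zeta>\<in>frontier
        \<Omega>. norm (g \<zeta> - c))" "e / 2"] by blast
    have "norm (g x - c) < e / 2" if "x \<in> frontier \<Omega>" for x
      using norm_le_SUP[OF B that] c by (rule le_less_trans)
    then have "norm (g z - c) < e / 2" "norm (g w - c) < e / 2" using z w by auto
    moreover have "norm (g z - g w) \<le> norm (g z - c) + norm (g w - c)"
      using norm_triangle_ineq4[of "g z - c" "g w - c"] by simp
    ultimately show ?thesis by simp
  qed
  then have "norm (g z - g w) \<le> 0" by (rule field_le_epsilon)
  then show ?thesis by simp
qed

lemma continuous_frontier_bounded:
  fixes f :: "complex \<Rightarrow> complex"
  assumes "continuous_on (frontier \<Omega>) f"
  obtains B where "\<And>z. z \<in> frontier \<Omega> \<Longrightarrow> norm (f z) \<le> B"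
proof -
  have "compact (f ` frontier \<Omega>)"
    using compact_frontier[OF compact] assms by (intro compact_continuous_image)
  then show ?thesis using that compact_imp_bounded bounded_iff by (metis imageI)
qed

text \<open>\<open>NP f z - c\<close> is the average of \<open>f - c\<close> with respect to a
  probability measure.\<close>

lemma neumann_poincare_diff_le:
  assumes f: "continuous_on (frontier \<Omega>) f" and C: "\<And>z. z \<in> frontier \<Omega>
    \<Longrightarrow> norm (f z - c) \<le> C"
    and z: "z \<in> frontier \<Omega>"
  shows "norm (NP f z - c) \<le> C"
proof -
  interpret prob_space "np_measure \<Omega> z" by (rule prob_space_np_measure[OF z])
  have i: "integrable (np_measure \<Omega> z) f" by (rule integrable_np_measure[OF z f])
  have "NP f z - c = (LINT \<sigma>|np_measure \<Omega> z. f \<sigma> - c)"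
    unfolding neumann_poincare_def using i by (simp add: prob_space)
  also have "norm \<dots> \<le> (LINT \<sigma>|np_measure \<Omega> z. norm (f \<sigma> - c))" by (rule
    integral_norm_bound)
  also have "\<dots> \<le> (LINT \<sigma>|np_measure \<Omega> z. C)"
    using i C by (intro integral_mono integrable_norm Bochner_Integration.integrable_diff) (auto simp: space_np_measure)
  also have "\<dots> = C" by (simp add: prob_space)
  finally show ?thesis .
qed

text \<open>Averaging contracts the distance to every constant. The bound also makes the real
  supremum in \<open>np_quotient_opnorm\<close> an upper bound of its terms.\<close>

lemma quotient_norm_neumann_poincare:
  assumes f: "continuous_on (frontier \<Omega>) f"
  shows "0 \<le> quotient_norm \<Omega> (NP f)"
    "quotient_norm \<Omega> (NP f) \<le> quotient_norm \<Omega> f"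
proof -
  obtain B where B: "\<And>z. z \<in> frontier \<Omega> \<Longrightarrow> norm (f z) \<le> B" using
    continuous_frontier_bounded[OF f] by blast
  have KB: "norm (NP f z) \<le> B" if "z \<in> frontier \<Omega>" for z
    using neumann_poincare_diff_le[OF f _ that, where c = 0 and C = B] B by simp
  show "0 \<le> quotient_norm \<Omega> (NP f)"
    by (rule quotient_norm_le(1)[OF KB, where c = 0 and C = B]) (use KB in auto)
  have "quotient_norm \<Omega> (NP f) \<le> (SUP \<zeta>\<in>frontier \<Omega>. norm (f \<zeta> - c))" for c
  proof (rule quotient_norm_le(2)[OF KB, where c = c])
    fix z assume z: "z \<in> frontier \<Omega>"
    show "norm (NP f z - c) \<le> (SUP \<zeta>\<in>frontier \<Omega>. norm (f \<zeta> - c))"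
      by (rule neumann_poincare_diff_le[OF f norm_le_SUP[OF B] z])
  qed
  then show "quotient_norm \<Omega> (NP f) \<le> quotient_norm \<Omega> f"
    unfolding quotient_norm_def[of \<Omega> f] by (intro cINF_greatest) auto
qed

text \<open>One proof for both constants. In one direction the identity, scaled into the unit ball,
  is the only test function; in the other, the operator of a disk maps every continuous function to
  a constant.\<close>

lemma np_quotient_opnorm_eq_0_iff:
  assumes S: "S \<subseteq> boundary_continuous \<Omega>" and id: "\<And>c. (\<lambda>z. c * z) \<in> S"
  shows "np_quotient_opnorm \<Omega> S = 0 \<longleftrightarrow> (\<exists>c r. 0 < r \<and> \<Omega> = cball c r)"
proof
  have cont: "continuous_on (frontier \<Omega>) f" if "f \<in> S" for f using S that by (auto simp:
    boundary_continuous_def)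
  {
    assume 0: "np_quotient_opnorm \<Omega> S = 0"
    obtain R where R: "R > 0" "\<And>x. x \<in> \<Omega> \<Longrightarrow> norm x \<le> R" using bounded
      bounded_pos by blast
    \<comment> \<open>Scales the identity to norm at most 1 on the boundary.\<close>
    define c where "c = complex_of_real (1 / R)"
    define f where "f z = c * z" for z
    have fS: "f \<in> S" unfolding f_def using id by simp
    have fb: "norm (f z) \<le> 1" if "z \<in> frontier \<Omega>" for z
      using R(2)[OF frontier_in[OF that]] R(1) by (simp add: f_def c_def norm_mult norm_divide)
    have "quotient_norm \<Omega> f \<le> 1" by (rule quotient_norm_le(2)[OF fb, where c = 0]) (use fb in auto)
    then have "quotient_norm \<Omega> (NP f) \<le> np_quotient_opnorm \<Omega> S"
      unfolding np_quotient_opnorm_def using fS quotient_norm_neumann_poincare(2) cont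
      by (intro cSUP_upper bdd_aboveI2[where M = 1]) (auto intro: order_trans)
    then have q0: "quotient_norm \<Omega> (NP f) = 0"
      using 0 quotient_norm_neumann_poincare(1)[OF cont[OF fS]] by simp
    have Kb: "norm (NP f z) \<le> 1" if "z \<in> frontier \<Omega>" for z
      using neumann_poincare_diff_le[OF cont[OF fS] _ that, where c = 0 and C = 1] fb by simp
    have Kf: "NP f z = c * NP (\<lambda>w. w) z" for z
      unfolding neumann_poincare_def f_def by (rule integral_mult_right_zero)
    have "c \<noteq> 0" using R(1) by (simp add: c_def)
    moreover have "NP f z = NP f (\<gamma> 0)" if "z \<in> frontier \<Omega>" for z
      by (rule quotient_norm_0D[OF Kb q0 that \<gamma>_front])
    ultimately have "NP (\<lambda>w. w) z = NP (\<lambda>w. w) (\<gamma> 0)" if "z \<in> frontier \<Omega>" for z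
      using that by (simp add: Kf)
    then show "\<exists>c r. 0 < r \<and> \<Omega> = cball c r" by (rule disk_if_neumann_poincare_id_constant)
  }
  {
    assume "\<exists>c r. 0 < r \<and> \<Omega> = cball c r"
    then obtain a r where ar: "0 < r" "\<Omega> = cball a r" by blast
    have K0: "quotient_norm \<Omega> (NP f) = 0" if "f \<in> S" for f
    proof -
      define k where "k = (LINT t|I. (1 / (2 * pi * r)) *\<^sub>R f (\<gamma> t))"
      have K: "NP f z = k" if "z \<in> frontier \<Omega>" for z
        unfolding k_def by (rule neumann_poincare_cball[OF ar(2,1) cont[OF \<open>f \<in> S\<close>] that])
      have "quotient_norm \<Omega> (NP f) \<le> 0"
        by (rule quotient_norm_le(2)[where B = "norm k" and c = k]) (simp_all add: K)
      then show ?thesis using quotient_norm_neumann_poincare(1)[OF cont[OF that]] by simp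
    qed
    \<comment> \<open>The zero function keeps the supremum from ranging over the empty set.\<close>
    have "quotient_norm \<Omega> (\<lambda>z. 0 * z) \<le> 1" by (rule quotient_norm_le(2)[where B = 0
      and c = 0]) simp_all
    then have "(\<lambda>z. 0 * z) \<in> {f \<in> S. quotient_norm \<Omega> f \<le> 1}" using id[of 0] by blast
    then have "(\<lambda>f. quotient_norm \<Omega> (NP f)) ` {f \<in> S. quotient_norm \<Omega> f \<le> 1} = {0}"
      using K0 by (auto simp: image_iff)
    then show "np_quotient_opnorm \<Omega> S = 0" by (simp add: np_quotient_opnorm_def)
  }
qed

end

theorem proposition27:
  fixes \<Omega> :: "complex set"
  assumes "compact \<Omega>" and "convex \<Omega>" and "interior \<Omega> \<noteq> {}"
  shows "((\<exists>c r. 0 < r \<and> \<Omega> = cball c r) \<longleftrightarrow> configuration_constant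
    \<Omega> = 0) \<and>
         (configuration_constant \<Omega> = 0 \<longleftrightarrow> analytic_configuration_constant \<Omega> = 0)"
proof -
  interpret convex_body_interior \<Omega> by standard (use assms in auto)
  have "configuration_constant \<Omega> = 0 \<longleftrightarrow> (\<exists>c r. 0 < r \<and> \<Omega> = cball c r)"
    unfolding configuration_constant_def
    by (rule np_quotient_opnorm_eq_0_iff) (auto simp: boundary_continuous_def intro!: continuous_intros)
  moreover have "analytic_configuration_constant \<Omega> = 0 \<longleftrightarrow> (\<exists>c r. 0 < r
    \<and> \<Omega> = cball c r)"
    unfolding analytic_configuration_constant_def
  proof (rule np_quotient_opnorm_eq_0_iff)
    show "analytic_algebra \<Omega> \<subseteq> boundary_continuous \<Omega>"
      using frontier_in by (auto simp: analytic_algebra_def boundary_continuous_def intro: continuous_on_subset)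
    show "(\<lambda>z. c * z) \<in> analytic_algebra \<Omega>" for c
      by (auto simp: analytic_algebra_def intro!: continuous_intros holomorphic_intros)
  qed
  ultimately show ?thesis by blast
qed

end
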